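(* Let $H$ and $Y$ be Hilbert spaces, $A_0:\mathcal{D}(A_0)\to H$ a strictly positive self-adjoint operator and $C_0\in\mathcal{L}(H,Y)$ such that $C_0^*C_0\in\mathcal{L}(\mathcal{D}(A_0^{3/2}))\cap\mathcal{L}(\mathcal{D}(A_0^{1/2}))$. Let $X=\mathcal{D}(A_0^{1/2})\times H$, $A=\begin{pmatrix}0&I\\ -A_0&0\end{pmatrix}$ with $\mathcal{D}(A)=\mathcal{D}(A_0)\times\mathcal{D}(A_0^{1/2})$, and $C=\begin{bmatrix}0&C_0\end{bmatrix}\in\mathcal{L}(X,Y)$. Assume that the pair $(A,C)$ is exactly observable in time $\tau>0$ and set $\eta:=\|\mathbb{L}_\tau\|_{\mathcal{L}(X)}<1$. Let $(H_h)_{h>0}$ be a family of finite-dimensional subspaces of $\mathcal{D}(A_0^{1/2})$ satisfying the approximation property stated in the context with exponent $\theta>0$. Let $(w_0,w_1)\in\mathcal{D}(A_0^{3/2})\times\mathcal{D}(A_0)$ be the initial value $(w(0),\dot w(0))$ of the system $\ddot w(t)+A_0w(t)=0$ for $t\ge0$, with output $y(t)=C_0\dot w(t)$ for $t\in[0,\tau]$, let $y_h\in L^1([0,\tau],Y)$ be an approximation of $y$, set $$N_h=\theta\,\frac{\ln h}{\ln\eta},$$ and let $$\begin{bmatrix}w_{0,h}\\ w_{1,h}\end{bmatrix}=\sum_{0\le n\le N_h}\mathbb{L}_{h,\tau}^{n}\begin{bmatrix}w_h^-(0)\\ \dot w_h^-(0)\end{bmatrix}$$ (sum over integers $n$). Then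 there exist $M_\tau>0$ (which may depend on $\tau$ but not on $(w_0,w_1)$ or $h$) and $h^*>0$ such that for all $h\in(0,h^* )$ $$\|w_0-w_{0,h}\|_{1/2}+\|w_1-w_{1,h}\|\le M_\tau\left[h^\theta\ln^2h\left(\|w_0\|_{3/2}+\|w_1\|_1\right)+|\ln h|\int_0^\tau\|C_0^*(y(s)-y_h(s))\|\,ds\right].$$
   Context: Notation. $\langle\cdot,\cdot\rangle$ and $\|\cdot\|$ are the inner product and norm of $H$; $\|\varphi\|_\alpha=\|A_0^\alpha\varphi\|$ is the norm of $\mathcal{D}(A_0^\alpha)$, and $\langle\varphi,\psi\rangle_{1/2}=\langle A_0^{1/2}\varphi,A_0^{1/2}\psi\rangle$. $X$ has norm $\|(z_1,z_2)\|=(\|z_1\|_{1/2}^2+\|z_2\|^2)^{1/2}$. The dot denotes the time derivative. Exact observability of $(A,C)$ in time $\tau$: there is $k_\tau>0$ such that $\int_0^\tau\|Cz(t)\|^2dt\ge k_\tau^2\|z_0\|^2$ for all $z_0\in\mathcal{D}(A)$, where $\dot z=Az$, $z(0)=z_0$. Semigroups. $\mathbb{T}^+$ and $\mathbb{T}^-$ are the $C_0$-semigroups on $X$ generated by $A-C^*C$ and $-A-C^*C$ respectively, and $\mathbb{L}_\tau=\mathbb{T}^-_\tau\mathbb{T}^+_\tau$. Under exact observability in time $\tau$ it is known that $\|\mathbb{L}_\tau\|_{\mathcal{L}(X)}<1$. Galerkin spaces. $H_h\subset\mathcal{D}(A_0^{1/2})$ is endowed with the norm of $H$. $\pi_h$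 is the orthogonal projection from $\mathcal{D}(A_0^{1/2})$ (with inner product $\langle\cdot,\cdot\rangle_{1/2}$) onto $H_h$. Approximation property: there exist $M>0$, $\theta>0$, $h^*>0$ such that $\|\pi_h\varphi-\varphi\|\le Mh^\theta\|\varphi\|_{1/2}$ for all $\varphi\in\mathcal{D}(A_0^{1/2})$ and all $h\in(0,h^* )$. Discrete semigroups. For $(p_{0,h},p_{1,h})\in H_h\times H_h$ let $p_h:[0,\tau]\to H_h$ solve $$(G)\qquad\langle\ddot p_h(t),\varphi_h\rangle+\langle p_h(t),\varphi_h\rangle_{1/2}+\langle C_0^*C_0\dot p_h(t),\varphi_h\rangle=0\quad\forall\varphi_h\in H_h,\qquad p_h(0)=p_{0,h},\ \dot p_h(0)=p_{1,h}.$$ For $p_0,p_1\in\mathcal{D}(A_0^{1/2})$: $\mathbb{T}^+_{h,t}\begin{bmatrix}p_0\\ p_1\end{bmatrix}=\begin{bmatrix}p_h(t)\\ \dot p_h(t)\end{bmatrix}$, where $p_h$ solves $(G)$ with data $(\pi_hp_0,\pi_hp_1)$; $\mathbb{T}^-_{h,t}\begin{bmatrix}p_0\\ p_1\end{bmatrix}=\begin{bmatrix}p_h(t)\\ -\dot p_h(t)\end{bmatrix}$, where $p_h$ solves $(G)$ with data $(\pi_hp_0,-\pi_hp_1)$. Set $\mathbb{L}_{h,\tau}=\mathbb{T}^-_{h,\tau}\mathbb{T}^+_{h,\tau}$. Discrete observers. $w_h^+,w_h^-:[0,\tau]\to H_h$ satisfy, for all $\varphi_h\in H_h$ and $t\in[0,\tau]$,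 $$\langle\ddot w_h^+(t),\varphi_h\rangle+\langle w_h^+(t),\varphi_h\rangle_{1/2}+\langle C_0^*C_0\dot w_h^+(t),\varphi_h\rangle=\langle C_0^*y_h(t),\varphi_h\rangle,\quad w_h^+(0)=\dot w_h^+(0)=0,$$ $$\langle\ddot w_h^-(t),\varphi_h\rangle+\langle w_h^-(t),\varphi_h\rangle_{1/2}-\langle C_0^*C_0\dot w_h^-(t),\varphi_h\rangle=-\langle C_0^*y_h(t),\varphi_h\rangle,\quad w_h^-(\tau)=w_h^+(\tau),\ \dot w_h^-(\tau)=\dot w_h^+(\tau).$$ *)

theory Defs
  imports "HOL-Analysis.Analysis"
begin

section \<open>Unbounded operators\<close>

text \<open>An operator with domain is a partial map: \<open>dom A\<close> is its domain, \<open>A \<circ>\<^sub>m B\<close> is the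
  composition with its natural domain, and equality of partial maps is equality of graphs.\<close>

abbreviation ap :: "('a \<rightharpoonup> 'b) \<Rightarrow> 'a \<Rightarrow> 'b"
  where "ap A x \<equiv> the (A x)"

definition linear_operator :: "('a::real_vector \<rightharpoonup> 'b::real_vector) \<Rightarrow> bool"
  where "linear_operator A \<longleftrightarrow> subspace (dom A) \<and>
    (\<forall>x\<in>dom A. \<forall>y\<in>dom A. ap A (x + y) = ap A x + ap A y) \<and>
    (\<forall>c. \<forall>x\<in>dom A. ap A (c *\<^sub>R x) = c *\<^sub>R ap A x)"

text \<open>The last conjunct says that \<open>A\<close> and its Hilbert space adjoint have the same graph.\<close>

definition self_adjoint :: "('h::real_inner \<rightharpoonup> 'h) \<Rightarrow> bool"
  where "self_adjoint A \<longleftrightarrow> linear_operator A \<and> closure (dom A) = UNIV \<and>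
    (\<forall>y z. A y = Some z \<longleftrightarrow> (\<forall>x\<in>dom A. ap A x \<bullet> y = x \<bullet> z))"

definition nonneg_operator :: "('h::real_inner \<rightharpoonup> 'h) \<Rightarrow> bool"
  where "nonneg_operator A \<longleftrightarrow> (\<forall>x\<in>dom A. 0 \<le> ap A x \<bullet> x)"

definition strictly_positive :: "('h::real_inner \<rightharpoonup> 'h) \<Rightarrow> bool"
  where "strictly_positive A \<longleftrightarrow> (\<exists>m>0. \<forall>x\<in>dom A. m * (norm x)\<^sup>2 \<le> ap A x \<bullet> x)"

definition op_sqrt :: "('h::real_inner \<rightharpoonup> 'h) \<Rightarrow> ('h \<rightharpoonup> 'h)"
  where "op_sqrt A = (THE B. self_adjoint B \<and> nonneg_operator B \<and> B \<circ>\<^sub>m B = A)"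

definition op_three_halves :: "('h::real_inner \<rightharpoonup> 'h) \<Rightarrow> ('h \<rightharpoonup> 'h)"
  where "op_three_halves A = A \<circ>\<^sub>m op_sqrt A"

text \<open>For \<open>P = A\<^sub>0\<^sup>\<alpha>\<close>: the everywhere defined map \<open>S\<close> restricts to a bounded operator on
  \<open>dom P\<close> equipped with the norm \<open>\<parallel>P x\<parallel>\<close>.\<close>

definition bounded_on_domain :: "('h::real_inner \<rightharpoonup> 'h) \<Rightarrow> ('h \<Rightarrow> 'h) \<Rightarrow> bool"
  where "bounded_on_domain P S \<longleftrightarrow>
    (\<exists>K. \<forall>x\<in>dom P. S x \<in> dom P \<and> norm (ap P (S x)) \<le> K * norm (ap P x))"

definition inner_half :: "('h::real_inner \<rightharpoonup> 'h) \<Rightarrow> 'h \<Rightarrow> 'h \<Rightarrow> real"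
  where "inner_half A x y = ap (op_sqrt A) x \<bullet> ap (op_sqrt A) y"

definition norm_half :: "('h::real_inner \<rightharpoonup> 'h) \<Rightarrow> 'h \<Rightarrow> real"
  where "norm_half A x = norm (ap (op_sqrt A) x)"


section \<open>Strongly continuous semigroups\<close>

text \<open>The normed space is a subspace \<open>X\<close> of the underlying type with its own norm \<open>N\<close>
  (unrelated to any norm of the type); values of operators outside \<open>X\<close> are irrelevant.\<close>

definition C0_semigroup ::
  "'x::real_vector set \<Rightarrow> ('x \<Rightarrow> real) \<Rightarrow> (real \<Rightarrow> 'x \<Rightarrow> 'x) \<Rightarrow> bool"
  where "C0_semigroup X N T \<longleftrightarrow>
    (\<forall>t\<ge>0. (\<forall>x\<in>X. T t x \<in> X) \<and>
            (\<forall>x\<in>X. \<forall>y\<in>X. T t (x + y) = T t x + T t y) \<and>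
            (\<forall>c. \<forall>x\<in>X. T t (c *\<^sub>R x) = c *\<^sub>R T t x) \<and>
            (\<exists>K. \<forall>x\<in>X. N (T t x) \<le> K * N x)) \<and>
    (\<forall>x\<in>X. T 0 x = x) \<and>
    (\<forall>s\<ge>0. \<forall>t\<ge>0. \<forall>x\<in>X. T (s + t) x = T s (T t x)) \<and>
    (\<forall>x\<in>X. ((\<lambda>t. N (T t x - x)) \<longlongrightarrow> 0) (at_right 0))"

definition C0_semigroup_generated_by ::
  "'x::real_vector set \<Rightarrow> ('x \<Rightarrow> real) \<Rightarrow> (real \<Rightarrow> 'x \<Rightarrow> 'x) \<Rightarrow> ('x \<rightharpoonup> 'x) \<Rightarrow> bool"
  where "C0_semigroup_generated_by X N T G \<longleftrightarrow> C0_semigroup X N T \<and>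
    (\<forall>x y. G x = Some y \<longleftrightarrow> x \<in> X \<and> y \<in> X \<and>
      ((\<lambda>t. N ((1 / t) *\<^sub>R (T t x - x) - y)) \<longlongrightarrow> 0) (at_right 0))"

definition operator_norm_on ::
  "'x set \<Rightarrow> ('x \<Rightarrow> real) \<Rightarrow> ('x \<Rightarrow> 'x) \<Rightarrow> real"
  where "operator_norm_on X N S = (SUP x\<in>{x\<in>X. N x \<le> 1}. N (S x))"

text \<open>\<open>z' = G z\<close> on \<open>[0,\<infinity>)\<close>, the derivative being taken in the norm \<open>N\<close>.\<close>

definition classical_solution ::
  "('x::real_vector \<Rightarrow> real) \<Rightarrow> ('x \<rightharpoonup> 'x) \<Rightarrow> (real \<Rightarrow> 'x) \<Rightarrow> bool"
  where "classical_solution N G z \<longleftrightarrow> (\<forall>t\<ge>0. z t \<in> dom G \<and>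
    ((\<lambda>s. N ((1 / (s - t)) *\<^sub>R (z s - z t) - ap G (z t))) \<longlongrightarrow> 0) (at t within {0..}))"


section \<open>The second order system\<close>

definition state_space :: "('h::real_inner \<rightharpoonup> 'h) \<Rightarrow> ('h \<times> 'h) set"
  where "state_space A0 = dom (op_sqrt A0) \<times> UNIV"

definition state_norm :: "('h::real_inner \<rightharpoonup> 'h) \<Rightarrow> 'h \<times> 'h \<Rightarrow> real"
  where "state_norm A0 z = sqrt ((norm_half A0 (fst z))\<^sup>2 + (norm (snd z))\<^sup>2)"

definition wave_operator :: "('h::real_inner \<rightharpoonup> 'h) \<Rightarrow> ('h \<times> 'h \<rightharpoonup> 'h \<times> 'h)"
  where "wave_operator A0 = (\<lambda>(z1, z2).
    if z1 \<in> dom A0 \<and> z2 \<in> dom (op_sqrt A0) then Some (z2, - ap A0 z1) else None)"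

text \<open>\<open>s A - C\<^sup>* C\<close>; since \<open>C = [0 C\<^sub>0]\<close>, the adjoint of \<open>C\<close> with respect to the inner product
  of the state space is \<open>y \<mapsto> (0, C\<^sub>0\<^sup>* y)\<close>.\<close>

definition damped_operator ::
  "real \<Rightarrow> ('h::real_inner \<rightharpoonup> 'h) \<Rightarrow> ('h \<Rightarrow> 'y::real_inner) \<Rightarrow> ('h \<times> 'h \<rightharpoonup> 'h \<times> 'h)"
  where "damped_operator s A0 C0 = (\<lambda>z.
    map_option (\<lambda>u. s *\<^sub>R u - (0, adjoint C0 (C0 (snd z)))) (wave_operator A0 z))"

definition exactly_observable ::
  "('h::real_inner \<rightharpoonup> 'h) \<Rightarrow> ('h \<Rightarrow> 'y::real_inner) \<Rightarrow> real \<Rightarrow> bool"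
  where "exactly_observable A0 C0 \<tau> \<longleftrightarrow>
    (\<exists>k>0. \<forall>z0 \<in> dom (wave_operator A0). \<forall>z.
       classical_solution (state_norm A0) (wave_operator A0) z \<and> z 0 = z0 \<longrightarrow>
       k\<^sup>2 * (state_norm A0 z0)\<^sup>2 \<le> integral {0..\<tau>} (\<lambda>t. (norm (C0 (snd (z t))))\<^sup>2))"

definition wave_solution ::
  "('h::real_inner \<rightharpoonup> 'h) \<Rightarrow> 'h \<Rightarrow> 'h \<Rightarrow> (real \<Rightarrow> 'h) \<Rightarrow> (real \<Rightarrow> 'h) \<Rightarrow> bool"
  where "wave_solution A0 w0 w1 w w' \<longleftrightarrow>
    (\<forall>t\<ge>0. w t \<in> dom A0 \<and>
       (w has_vector_derivative w' t) (at t within {0..}) \<and>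
       (w' has_vector_derivative - ap A0 (w t)) (at t within {0..})) \<and>
    w 0 = w0 \<and> w' 0 = w1"

text \<open>Bochner's space \<open>L\<^sup>1([0,\<tau>],E)\<close>. The library's \<open>integrable\<close> needs a second countable
  type, which would exclude nonseparable spaces.\<close>

definition bochner_L1 :: "real \<Rightarrow> (real \<Rightarrow> 'e::real_normed_vector) \<Rightarrow> bool"
  where "bochner_L1 \<tau> f \<longleftrightarrow>
    (\<exists>s. (\<forall>n::nat. simple_function (lebesgue_on {0..\<tau>}) (s n)) \<and>
         (AE t in lebesgue_on {0..\<tau>}. (\<lambda>n. s n t) \<longlonglongrightarrow> f t)) \<and>
    integrable (lebesgue_on {0..\<tau>}) (\<lambda>t. norm (f t))"


section \<open>Galerkin approximation\<close>

definition galerkin_projection :: "('h::real_inner \<rightharpoonup> 'h) \<Rightarrow> 'h set \<Rightarrow> 'h \<Rightarrow> 'h"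
  where "galerkin_projection A0 V x =
    (THE v. v \<in> V \<and> (\<forall>\<phi>\<in>V. inner_half A0 (x - v) \<phi> = 0))"

definition approximation_property ::
  "('h::real_inner \<rightharpoonup> 'h) \<Rightarrow> (real \<Rightarrow> 'h set) \<Rightarrow> real \<Rightarrow> bool"
  where "approximation_property A0 V \<theta> \<longleftrightarrow>
    (\<exists>M>0. \<exists>hs>0. \<forall>\<phi>\<in>dom (op_sqrt A0). \<forall>h\<in>{0<..<hs}.
       norm (galerkin_projection A0 (V h) \<phi> - \<phi>) \<le> M * h powr \<theta> * norm_half A0 \<phi>)"

definition galerkin_solution ::
  "('h::real_inner \<rightharpoonup> 'h) \<Rightarrow> ('h \<Rightarrow> 'y::real_inner) \<Rightarrow> 'h set \<Rightarrow> real \<Rightarrow> 'h \<Rightarrow> 'h \<Rightarrow>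
   (real \<Rightarrow> 'h) \<Rightarrow> (real \<Rightarrow> 'h) \<Rightarrow> bool"
  where "galerkin_solution A0 C0 V \<tau> p0 p1 p p' \<longleftrightarrow>
    (\<exists>p''. \<forall>t\<in>{0..\<tau>}. p t \<in> V \<and>
       (p has_vector_derivative p' t) (at t within {0..\<tau>}) \<and>
       (p' has_vector_derivative p'' t) (at t within {0..\<tau>}) \<and>
       (\<forall>\<phi>\<in>V. p'' t \<bullet> \<phi> + inner_half A0 (p t) \<phi> + adjoint C0 (C0 (p' t)) \<bullet> \<phi> = 0)) \<and>
    p 0 = p0 \<and> p' 0 = p1"

definition discrete_semigroup_plus ::
  "('h::real_inner \<rightharpoonup> 'h) \<Rightarrow> ('h \<Rightarrow> 'y::real_inner) \<Rightarrow> 'h set \<Rightarrow> real \<Rightarrow> real \<Rightarrow>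
   'h \<times> 'h \<Rightarrow> 'h \<times> 'h"
  where "discrete_semigroup_plus A0 C0 V \<tau> t = (\<lambda>(p0, p1).
    THE z. \<exists>p p'. galerkin_solution A0 C0 V \<tau>
        (galerkin_projection A0 V p0) (galerkin_projection A0 V p1) p p' \<and>
      z = (p t, p' t))"

definition discrete_semigroup_minus ::
  "('h::real_inner \<rightharpoonup> 'h) \<Rightarrow> ('h \<Rightarrow> 'y::real_inner) \<Rightarrow> 'h set \<Rightarrow> real \<Rightarrow> real \<Rightarrow>
   'h \<times> 'h \<Rightarrow> 'h \<times> 'h"
  where "discrete_semigroup_minus A0 C0 V \<tau> t = (\<lambda>(p0, p1).
    THE z. \<exists>p p'. galerkin_solution A0 C0 V \<tau>
        (galerkin_projection A0 V p0) (- galerkin_projection A0 V p1) p p' \<and>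
      z = (p t, - p' t))"

definition discrete_L ::
  "('h::real_inner \<rightharpoonup> 'h) \<Rightarrow> ('h \<Rightarrow> 'y::real_inner) \<Rightarrow> 'h set \<Rightarrow> real \<Rightarrow> 'h \<times> 'h \<Rightarrow> 'h \<times> 'h"
  where "discrete_L A0 C0 V \<tau> =
    discrete_semigroup_minus A0 C0 V \<tau> \<tau> \<circ> discrete_semigroup_plus A0 C0 V \<tau> \<tau>"

text \<open>The observer equations, with \<open>s = 1\<close> forward and \<open>s = -1\<close> backward. The datum \<open>g\<close> is only
  integrable, so solutions are of class \<open>W\<^sup>2\<^sup>,\<^sup>1\<close>: \<open>w'\<close> is the indefinite integral of an integrable
  \<open>w''\<close> and the equation holds almost everywhere. This includes solutions for which
  the equation holds at every time.\<close>

definition observer_solution ::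
  "real \<Rightarrow> ('h::real_inner \<rightharpoonup> 'h) \<Rightarrow> ('h \<Rightarrow> 'y::real_inner) \<Rightarrow> 'h set \<Rightarrow> real \<Rightarrow>
   (real \<Rightarrow> 'y) \<Rightarrow> (real \<Rightarrow> 'h) \<Rightarrow> (real \<Rightarrow> 'h) \<Rightarrow> bool"
  where "observer_solution s A0 C0 V \<tau> g w w' \<longleftrightarrow>
    (\<exists>w''. bochner_L1 \<tau> w'' \<and>
      (\<forall>t\<in>{0..\<tau>}. w t \<in> V \<and>
         (w has_vector_derivative w' t) (at t within {0..\<tau>}) \<and>
         (w'' has_integral w' t - w' 0) {0..t}) \<and>
      (AE t in lebesgue_on {0..\<tau>}. \<forall>\<phi>\<in>V.
         w'' t \<bullet> \<phi> + inner_half A0 (w t) \<phi> + s * (adjoint C0 (C0 (w' t)) \<bullet> \<phi>)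
           = s * (adjoint C0 (g t) \<bullet> \<phi>)))"

end

theory Submission
  imports Defs
begin

text \<open>
  Write \<open>Q = C\<^sub>0\<^sup>* C\<^sub>0\<close>, let \<open>T\<close> be the semigroup of the damped equation
  \<open>p'' + A\<^sub>0 p + Q p' = 0\<close>, and let \<open>\<sigma>\<close> reverse the velocity. The backward semigroup is \<open>\<sigma> T \<sigma>\<close>, so that
  \<open>L = (\<sigma> T\<^sub>\<tau>)\<^sup>2\<close>: everything is said in terms of the half cycle \<open>G = \<sigma> T\<^sub>\<tau>\<close>, and its discretisation
  \<open>G\<^sub>h\<close> satisfies \<open>L\<^sub>h = G\<^sub>h\<^sup>2\<close> on the Galerkin space.

  If \<open>z\<^sub>0\<close> is the unknown initial state, the exact observers, run forward and then backward, end at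
  \<open>(I - L) z\<^sub>0\<close>, and \<open>\<Sum>\<^sub>n\<^sub>\<le>\<^sub>N L\<^sup>n (I - L) z\<^sub>0 = z\<^sub>0 - L\<^sup>N\<^sup>+\<^sup>1 z\<^sub>0\<close>. The truncation error is at most
  \<open>\<eta>\<^sup>N\<^sup>+\<^sup>1 \<parallel>z\<^sub>0\<parallel> \<le> h\<^sup>\<theta> \<parallel>z\<^sub>0\<parallel>\<close> by the choice of \<open>N\<^sub>h\<close>. Since \<open>G\<^sub>h\<close> is a contraction, replacing \<open>L\<^sup>n\<close>
  by \<open>L\<^sub>h\<^sup>n\<close> adds up \<open>2 n\<close> one step errors, and replacing the exact observers by the Galerkin ones
  costs one more observer error in each summand. Summing over \<open>n \<le> N\<^sub>h\<close>, which is of the size of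
  \<open>\<bar>ln h\<bar>\<close>, gives the factors \<open>ln\<^sup>2 h\<close> and \<open>\<bar>ln h\<bar>\<close>.

  Three facts carry the argument.

  \<^item> \<^emph>\<open>Decay.\<close> The undamped solution differs from the damped one by a term that is driven by the
    damping, and the damping is measured by the loss of energy. So observability bounds the loss of
    energy of \<open>T\<close> over \<open>[0, \<tau>]\<close> from below (\<open>observability_decay\<close>), whence \<open>\<eta> < 1\<close>.

  \<^item> \<^emph>\<open>Uniform regularity.\<close> A one step error at \<open>G\<^sup>n z\<^sub>0\<close> is bounded by \<open>h\<^sup>\<theta>\<close> times the norm of
    \<open>G\<^sup>n z\<^sub>0\<close> in the domain of the square of the generator, and this norm must not grow with \<open>n\<close>. The
    semigroup contracts it. The reversal \<open>\<sigma>\<close> changes it by a term of lower order, which decays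
    geometrically by interpolation with the decay of \<open>G\<^sup>n z\<^sub>0\<close> in the energy norm
    (\<open>iterates_regular\<close>).

  \<^item> \<^emph>\<open>Galerkin error.\<close> The projection of an exact solution solves the Galerkin equation up to
    projection errors, and the energy of a Galerkin solution grows at most by the integral of the
    norm of its source (\<open>energy_estimate\<close>, \<open>galerkin_error\<close>). This covers the discrete semigroups
    and the observers, whose data are only integrable.

  Unbounded operators are handled through the bounded operator \<open>R = A\<^sub>0\<^sup>-\<^sup>1\<^sup>/\<^sup>2\<close>
  (\<open>op_sqrt_inverse\<close>). A state \<open>(R a, b)\<close> is written in the coordinates \<open>(a, b)\<close>, in which its
  energy norm is the Hilbert space norm of a pair, and a generator is represented by its bounded
  inverse, whose range is the domain. Integrals are taken of real functions only, after pairing with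
  a test vector.
\<close>


section \<open>Hilbert spaces\<close>

lemma parallelogram_law:
  fixes a b :: "'a::real_inner"
  shows "(norm (a + b))\<^sup>2 + (norm (a - b))\<^sup>2 = 2 * (norm a)\<^sup>2 + 2 * (norm b)\<^sup>2"
  by (simp add: power2_norm_eq_inner inner_simps inner_commute)

lemma norm_add_scaleR_square:
  fixes a b :: "'a::real_inner"
  shows "(norm (a + c *\<^sub>R b))\<^sup>2 = (norm a)\<^sup>2 + 2 * c * (a \<bullet> b) + c\<^sup>2 * (norm b)\<^sup>2"
  unfolding power2_norm_eq_inner by (simp add: inner_simps inner_commute[of b a] power2_eq_square algebra_simps)

text \<open>A sequence in \<open>S\<close> that minimises the distance to \<open>x\<close> is Cauchy by the parallelogram law. Its
  limit is a nearest point, and moving it along \<open>S\<close> cannot shorten its distance to \<open>x\<close>.\<close>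

lemma closed_proper_subspace_orthogonal:
  fixes S :: "'a::{real_inner,complete_space} set"
  assumes S: "subspace S" "closed S" and x: "x \<notin> S"
  shows "\<exists>y. y \<noteq> 0 \<and> (\<forall>s\<in>S. y \<bullet> s = 0)"
proof -
  have ne: "S \<noteq> {}" using S(1) subspace_0 by blast
  define d where "d = infdist x S"
  have d0: "0 \<le> d" by (simp add: d_def infdist_nonneg)
  have dle: "d \<le> norm (x - s)" if "s \<in> S" for s
    using infdist_le[OF that, of x] by (simp add: d_def dist_norm)
  have "\<exists>s\<in>S. norm (x - s) < d + 1 / Suc n" for n
  proof -
    have "Inf (dist x ` S) < d + 1 / Suc n" using ne by (simp add: d_def infdist_notempty)
    then obtain r where "r \<in> dist x ` S" "r < d + 1 / Suc n"
      using cInf_lessD[of "dist x ` S"] ne by blast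
    then show ?thesis by (auto simp: dist_norm)
  qed
  then obtain s where s: "\<And>n. s n \<in> S" "\<And>n. norm (x - s n) < d + 1 / Suc n" by metis
  have gap: "(norm (s m - s n))\<^sup>2 \<le> 2 * (d + 1 / Suc m)\<^sup>2 + 2 * (d + 1 / Suc n)\<^sup>2 - 4 * d\<^sup>2" for m n
  proof -
    have mid: "(1/2) *\<^sub>R (s m + s n) \<in> S" using s(1) S(1) by (simp add: subspace_add subspace_scale)
    have "d \<le> norm (x - (1/2) *\<^sub>R (s m + s n))" by (rule dle[OF mid])
    then have "(2 * d)\<^sup>2 \<le> (2 * norm (x - (1/2) *\<^sub>R (s m + s n)))\<^sup>2"
      using d0 by (intro power_mono) auto
    also have "2 * norm (x - (1/2) *\<^sub>R (s m + s n)) = norm (2 *\<^sub>R (x - (1/2) *\<^sub>R (s m + s n)))" by simp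
    also have "2 *\<^sub>R (x - (1/2) *\<^sub>R (s m + s n)) = (x - s m) + (x - s n)"
      by (simp add: algebra_simps scaleR_2)
    finally have 1: "4 * d\<^sup>2 \<le> (norm ((x - s m) + (x - s n)))\<^sup>2" by (simp add: power_mult_distrib)
    have 2: "(norm (s m - s n))\<^sup>2 = (norm ((x - s m) - (x - s n)))\<^sup>2"
      by (simp add: norm_minus_commute)
    have "(norm (x - s m))\<^sup>2 \<le> (d + 1 / Suc m)\<^sup>2" "(norm (x - s n))\<^sup>2 \<le> (d + 1 / Suc n)\<^sup>2"
      by (rule power_mono[OF less_imp_le[OF s(2)] norm_ge_zero])+
    then show ?thesis using parallelogram_law[of "x - s m" "x - s n"] 1 2 by linarith
  qed
  have "Cauchy s"
  proof (rule metric_CauchyI)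
    fix e :: real assume e: "0 < e"
    have "(\<lambda>n. 4 * (d + 1 / real (Suc n))\<^sup>2 - 4 * d\<^sup>2) \<longlonglongrightarrow> 4 * (d + 0)\<^sup>2 - 4 * d\<^sup>2"
      by (intro tendsto_intros LIMSEQ_Suc[OF lim_1_over_n])
    then have "(\<lambda>n. 4 * (d + 1 / real (Suc n))\<^sup>2 - 4 * d\<^sup>2) \<longlonglongrightarrow> 0" by simp
    then have "\<forall>\<^sub>F n in sequentially. 4 * (d + 1 / real (Suc n))\<^sup>2 - 4 * d\<^sup>2 < e\<^sup>2"
      using e by (intro order_tendstoD(2)) auto
    then obtain N where N: "4 * (d + 1 / real (Suc N))\<^sup>2 - 4 * d\<^sup>2 < e\<^sup>2"
      by (auto simp: eventually_sequentially)
    have "dist (s m) (s n) < e" if "m \<ge> N" "n \<ge> N" for m n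
    proof -
      have mono: "(d + 1 / real (Suc k))\<^sup>2 \<le> (d + 1 / real (Suc N))\<^sup>2" if "k \<ge> N" for k
        using d0 that by (intro power_mono add_left_mono) (auto simp: frac_le)
      have "(norm (s m - s n))\<^sup>2 < e\<^sup>2"
        using gap[of m n] mono[OF that(1)] mono[OF that(2)] N by linarith
      then show ?thesis using e by (simp add: dist_norm power2_less_imp_less)
    qed
    then show "\<exists>N. \<forall>m\<ge>N. \<forall>n\<ge>N. dist (s m) (s n) < e" by blast
  qed
  then obtain p where p: "s \<longlonglongrightarrow> p" using Cauchy_convergent convergent_def by blast
  have pS: "p \<in> S" using closed_sequentially[OF S(2)] s(1) p by blast
  have pd: "norm (x - p) \<le> d"
  proof (rule LIMSEQ_le)
    show "(\<lambda>n. norm (x - s n)) \<longlonglongrightarrow> norm (x - p)" by (intro tendsto_intros p)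
    show "(\<lambda>n. d + 1 / real (Suc n)) \<longlonglongrightarrow> d"
      using tendsto_add[OF tendsto_const LIMSEQ_Suc[OF lim_1_over_n], of d] by simp
    show "\<exists>N. \<forall>n\<ge>N. norm (x - s n) \<le> d + 1 / real (Suc n)" using s(2) less_imp_le by blast
  qed
  define y where "y = x - p"
  have y0: "y \<noteq> 0" using x pS by (auto simp: y_def)
  have "y \<bullet> v = 0" if v: "v \<in> S" for v
  proof (rule ccontr)
    assume nz: "y \<bullet> v \<noteq> 0"
    then have v0: "v \<bullet> v > 0" by auto
    define c where "c = (y \<bullet> v) / (v \<bullet> v)"
    have "p + c *\<^sub>R v \<in> S" using pS v S(1) by (simp add: subspace_add subspace_scale)
    then have "d \<le> norm (x - (p + c *\<^sub>R v))" by (rule dle)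
    then have "norm y \<le> norm (y - c *\<^sub>R v)" using pd by (simp add: y_def algebra_simps)
    then have "(norm y)\<^sup>2 \<le> (norm (y - c *\<^sub>R v))\<^sup>2" by (intro power_mono) auto
    also have "\<dots> = (norm y)\<^sup>2 - 2 * c * (y \<bullet> v) + c\<^sup>2 * (v \<bullet> v)"
      using norm_add_scaleR_square[of y "- c" v] by (simp add: power2_norm_eq_inner)
    also have "\<dots> = (norm y)\<^sup>2 - (y \<bullet> v)\<^sup>2 / (v \<bullet> v)"
      using v0 by (simp add: c_def power2_eq_square field_simps)
    finally have "(y \<bullet> v)\<^sup>2 / (v \<bullet> v) \<le> 0" by simp
    then show False using nz v0 by (simp add: divide_le_0_iff)
  qed
  then show ?thesis using y0 by blast
qed

text \<open>The representing vector is a multiple of a vector orthogonal to the kernel of \<open>f\<close>.\<close>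

lemma riesz_representation:
  fixes f :: "'a::{real_inner,complete_space} \<Rightarrow> real"
  assumes f: "bounded_linear f"
  shows "\<exists>z. \<forall>x. f x = x \<bullet> z"
proof (cases "\<forall>x. f x = 0")
  case True then show ?thesis by (intro exI[of _ 0]) simp
next
  case False
  then obtain u where u: "f u \<noteq> 0" by blast
  interpret f: bounded_linear f by (rule f)
  let ?S = "{x. f x = 0}"
  have "subspace ?S" by (auto simp: subspace_def f.add f.scaleR f.zero)
  moreover have "closed ?S"
    by (intro closed_Collect_eq f.continuous_on continuous_intros)
  ultimately obtain y where y: "y \<noteq> 0" "\<And>s. f s = 0 \<Longrightarrow> y \<bullet> s = 0"
    using closed_proper_subspace_orthogonal[of ?S u] u by auto
  have fy: "f y \<noteq> 0" using y by (metis inner_eq_zero_iff)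
  have "f x = x \<bullet> ((f y / (y \<bullet> y)) *\<^sub>R y)" for x
  proof -
    have "f (f y *\<^sub>R x - f x *\<^sub>R y) = 0" by (simp add: f.diff f.scaleR)
    then have "y \<bullet> (f y *\<^sub>R x - f x *\<^sub>R y) = 0" by (rule y(2))
    then have "f y * (x \<bullet> y) = f x * (y \<bullet> y)" by (simp add: inner_simps inner_commute)
    then show ?thesis using y(1) by (simp add: field_simps)
  qed
  then show ?thesis by blast
qed

text \<open>The adjoint is defined by choice among the maps with this property; the Riesz theorem provides
  such a map.\<close>

lemma adjoint_inner:
  fixes f :: "'a::{real_inner,complete_space} \<Rightarrow> 'b::real_inner"
  assumes f: "bounded_linear f"
  shows "f x \<bullet> y = x \<bullet> adjoint f y"
proof -
  have "\<exists>z. \<forall>x. f x \<bullet> y = x \<bullet> z" for y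
    by (rule riesz_representation)
      (use bounded_linear_compose[OF bounded_linear_inner_left f] in simp)
  then obtain g where "\<forall>x y. f x \<bullet> y = x \<bullet> g y" by metis
  then show ?thesis using someI[of "\<lambda>g. \<forall>x y. f x \<bullet> y = x \<bullet> g y" g]
    unfolding adjoint_def by blast
qed

lemma bounded_linear_adjoint:
  fixes f :: "'a::{real_inner,complete_space} \<Rightarrow> 'b::real_inner"
  assumes f: "bounded_linear f"
  shows "bounded_linear (adjoint f)"
proof -
  interpret f: bounded_linear f by (rule f)
  obtain K where K: "\<And>x. norm (f x) \<le> norm x * K" "K > 0" using f.pos_bounded by blast
  show ?thesis
  proof (rule bounded_linear_intro[where K = K])
    show "adjoint f (x + y) = adjoint f x + adjoint f y" for x y
      by (rule vector_eq_ldot[THEN iffD1]) (simp add: inner_add_right adjoint_inner[OF f, symmetric])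
    show "adjoint f (r *\<^sub>R x) = r *\<^sub>R adjoint f x" for r x
      by (rule vector_eq_ldot[THEN iffD1]) (simp add: adjoint_inner[OF f, symmetric])
    show "norm (adjoint f y) \<le> norm y * K" for y
    proof (cases "adjoint f y = 0")
      case True then show ?thesis using K(2) by simp
    next
      case False
      have "(norm (adjoint f y))\<^sup>2 = f (adjoint f y) \<bullet> y"
        by (simp add: adjoint_inner[OF f] power2_norm_eq_inner)
      also have "\<dots> \<le> norm (f (adjoint f y)) * norm y" by (rule norm_cauchy_schwarz)
      also have "\<dots> \<le> norm (adjoint f y) * K * norm y" by (intro mult_right_mono K) auto
      finally show ?thesis using False by (simp add: power2_eq_square mult_ac)
    qed
  qed
qed

text \<open>By the category theorem one of the closed sets \<open>{x. \<forall>n. \<parallel>F n x\<parallel> \<le> m}\<close> contains a ball.\<close>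

lemma banach_steinhaus_sequence:
  fixes F :: "nat \<Rightarrow> 'a::{real_normed_vector,complete_space} \<Rightarrow> 'b::real_normed_vector"
  assumes lin: "\<And>n. bounded_linear (F n)" and pt: "\<And>x. \<exists>K. \<forall>n. norm (F n x) \<le> K"
  shows "\<exists>K. \<forall>n x. norm (F n x) \<le> K * norm x"
proof (rule ccontr)
  assume neg: "\<not> ?thesis"
  define C where "C m = {x. \<forall>n. norm (F n x) \<le> real m}" for m
  have clo: "closed (C m)" for m
    unfolding C_def by (intro closed_Collect_all closed_Collect_le continuous_intros
        bounded_linear.continuous_on[OF lin])
  have int: "interior (C m) = {}" for m
  proof (rule ccontr)
    assume "interior (C m) \<noteq> {}"
    then obtain x r where r: "r > 0" "cball x r \<subseteq> C m"
      by (meson ex_in_conv mem_interior_cball)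
    have "norm (F n y) \<le> 2 * real m / r * norm y" for n y
    proof (cases "y = 0")
      case True then show ?thesis by (simp add: bounded_linear.linear[OF lin] linear_0)
    next
      case False
      interpret F: bounded_linear "F n" by (rule lin)
      let ?v = "(r / norm y) *\<^sub>R y"
      have "x + ?v \<in> cball x r" "x \<in> cball x r" using r(1) False by (auto simp: dist_norm)
      then have "x + ?v \<in> C m" "x \<in> C m" using r(2) by blast+
      then have "norm (F n (x + ?v)) \<le> m" "norm (F n x) \<le> m" by (auto simp: C_def)
      then have "norm (F n (x + ?v) - F n x) \<le> 2 * m" using norm_triangle_ineq4[of "F n (x + ?v)" "F n x"]
        by linarith
      then have "r / norm y * norm (F n y) \<le> 2 * m" using r by (simp add: F.add F.scaleR)
      then show ?thesis using r False by (simp add: field_simps)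
    qed
    then show False using neg by blast
  qed
  have all: "(\<Union>m. C m) = UNIV"
  proof -
    have "\<exists>m. x \<in> C m" for x
    proof -
      obtain K where "\<forall>n. norm (F n x) \<le> K" using pt by blast
      moreover obtain m where "K \<le> real m" using real_arch_simple by blast
      ultimately show ?thesis unfolding C_def by (intro exI[of _ m]) (auto intro: order_trans)
    qed
    then show ?thesis by blast
  qed
  have "Met_TC.mtopology interior_of \<Union>(range C) = {}"
    by (rule Met_TC.metric_Baire_category_alt) (use clo int in auto)
  then show False using all by auto
qed


section \<open>Square roots of positive operators\<close>

text \<open>A fixed point \<open>Y\<close> of \<open>Y \<mapsto> (S + Y\<^sup>2) / 2\<close> satisfies \<open>(I - Y)\<^sup>2 = I - S\<close>.\<close>

fun sqrt_iter :: "('a::real_vector \<Rightarrow> 'a) \<Rightarrow> nat \<Rightarrow> 'a \<Rightarrow> 'a" where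
  "sqrt_iter S 0 x = 0"
| "sqrt_iter S (Suc n) x = (1/2) *\<^sub>R (S x + sqrt_iter S n (sqrt_iter S n x))"

text \<open>The same iteration with \<open>S\<close> replaced by the number 1. If \<open>\<parallel>S\<parallel> \<le> 1\<close>, it dominates the operator
  norms and their increments, so that its convergence implies that of the operators.\<close>

fun sqrt_major :: "nat \<Rightarrow> real" where
  "sqrt_major 0 = 0"
| "sqrt_major (Suc n) = (1 + (sqrt_major n)\<^sup>2) / 2"

lemma sqrt_major_bounds: "0 \<le> sqrt_major n" "sqrt_major n \<le> 1" "sqrt_major n \<le> sqrt_major (Suc n)"
proof -
  have *: "0 \<le> sqrt_major n \<and> sqrt_major n \<le> 1" for n
    by (induction n) (auto simp: power_le_one)
  then show "0 \<le> sqrt_major n" "sqrt_major n \<le> 1" by auto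
  have "0 \<le> (1 - sqrt_major n)\<^sup>2" by simp
  then show "sqrt_major n \<le> sqrt_major (Suc n)" by (simp add: power2_diff)
qed

context
  fixes S :: "'a::{real_inner,complete_space} \<Rightarrow> 'a"
  assumes S: "bounded_linear S" and contr: "\<And>x. norm (S x) \<le> norm x"
begin

lemma sqrt_iter_linear: "linear (sqrt_iter S n)"
proof (induction n)
  case (Suc n)
  interpret L: linear "sqrt_iter S n" by fact
  interpret S: bounded_linear S by (rule S)
  show ?case by (rule linearI) (simp_all add: L.add L.scaleR S.add S.scaleR algebra_simps)
qed (auto intro: linearI)

lemma sqrt_iter_bound: "norm (sqrt_iter S n x) \<le> sqrt_major n * norm x"
proof (induction n arbitrary: x)
  case (Suc n)
  have "norm (sqrt_iter S (Suc n) x) \<le> (norm (S x) + norm (sqrt_iter S n (sqrt_iter S n x))) / 2"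
    using norm_triangle_ineq[of "S x" "sqrt_iter S n (sqrt_iter S n x)"] by simp
  also have "\<dots> \<le> (norm x + sqrt_major n * (sqrt_major n * norm x)) / 2"
    using contr[of x] order_trans[OF Suc mult_left_mono[OF Suc sqrt_major_bounds(1)]]
    by (simp add: add_mono)
  also have "\<dots> = sqrt_major (Suc n) * norm x" by (simp add: power2_eq_square field_simps)
  finally show ?case .
qed simp

text \<open>For consecutive iterates \<open>Y\<close> and \<open>Z\<close>, \<open>Y\<^sup>2 - Z\<^sup>2 = Y (Y - Z) + (Y - Z) Z\<close>, which has the same form as
  the recursion for the increments of the dominating sequence.\<close>

lemma sqrt_iter_step:
  "norm (sqrt_iter S (Suc n) x - sqrt_iter S n x) \<le> (sqrt_major (Suc n) - sqrt_major n) * norm x"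
proof (induction n arbitrary: x)
  case 0 show ?case using contr[of x] by simp
next
  case (Suc n)
  let ?Y = "sqrt_iter S (Suc n)" and ?Z = "sqrt_iter S n"
  let ?y = "sqrt_major (Suc n)" and ?z = "sqrt_major n"
  interpret L: linear ?Y by (rule sqrt_iter_linear)
  have "sqrt_iter S (Suc (Suc n)) x - ?Y x = (1/2) *\<^sub>R (?Y (?Y x) - ?Z (?Z x))"
    by (simp only: sqrt_iter.simps(2)[of S "Suc n"] sqrt_iter.simps(2)[of S n x])
      (simp only: algebra_simps scaleR_right_diff_distrib)
  also have "\<dots> = (1/2) *\<^sub>R (?Y (?Y x - ?Z x) + (?Y (?Z x) - ?Z (?Z x)))"
    by (simp only: L.diff) simp
  finally have "norm (sqrt_iter S (Suc (Suc n)) x - ?Y x)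
      \<le> (norm (?Y (?Y x - ?Z x)) + norm (?Y (?Z x) - ?Z (?Z x))) / 2"
    using norm_triangle_ineq[of "?Y (?Y x - ?Z x)" "?Y (?Z x) - ?Z (?Z x)"] by simp
  also have "\<dots> \<le> (?y * ((?y - ?z) * norm x) + (?y - ?z) * (?z * norm x)) / 2"
  proof -
    have "norm (?Y (?Y x - ?Z x)) \<le> ?y * norm (?Y x - ?Z x)" by (rule sqrt_iter_bound)
    also have "\<dots> \<le> ?y * ((?y - ?z) * norm x)"
      by (intro mult_left_mono Suc sqrt_major_bounds)
    finally have 1: "norm (?Y (?Y x - ?Z x)) \<le> ?y * ((?y - ?z) * norm x)" .
    have "norm (?Y (?Z x) - ?Z (?Z x)) \<le> (?y - ?z) * norm (?Z x)" by (rule Suc)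
    also have "\<dots> \<le> (?y - ?z) * (?z * norm x)"
      using sqrt_major_bounds(3)[of n] by (intro mult_left_mono sqrt_iter_bound) auto
    finally show ?thesis using 1 by simp
  qed
  also have "\<dots> = (sqrt_major (Suc (Suc n)) - ?y) * norm x"
    by (simp only: sqrt_major.simps(2)[of "Suc n"] sqrt_major.simps(2)[of n])
      (simp add: power2_eq_square field_simps)
  finally show ?case .
qed

lemma sqrt_iter_diff:
  assumes "n \<le> m"
  shows "norm (sqrt_iter S m x - sqrt_iter S n x) \<le> (sqrt_major m - sqrt_major n) * norm x"
  using assms
proof (induction m rule: dec_induct)
  case (step m)
  have "norm (sqrt_iter S (Suc m) x - sqrt_iter S n x)
      \<le> norm (sqrt_iter S (Suc m) x - sqrt_iter S m x) + norm (sqrt_iter S m x - sqrt_iter S n x)"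
    using norm_triangle_ineq[of "sqrt_iter S (Suc m) x - sqrt_iter S m x" "sqrt_iter S m x - sqrt_iter S n x"]
    by (simp del: sqrt_iter.simps)
  also have "\<dots> \<le> (sqrt_major (Suc m) - sqrt_major m) * norm x + (sqrt_major m - sqrt_major n) * norm x"
    by (intro add_mono sqrt_iter_step step.IH)
  finally show ?case by (simp add: algebra_simps)
qed simp

lemma sqrt_iter_limit:
  obtains Y where "bounded_linear Y" "\<And>x. norm (Y x) \<le> norm x"
    "\<And>x. Y x = (1/2) *\<^sub>R (S x + Y (Y x))"
    "\<And>x. (\<lambda>n. sqrt_iter S n x) \<longlonglongrightarrow> Y x"
proof -
  have "incseq sqrt_major" using sqrt_major_bounds(3) by (rule incseq_SucI)
  then obtain L where L: "sqrt_major \<longlonglongrightarrow> L"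
    using sqrt_major_bounds(2) incseq_convergent by blast
  then have Cy: "Cauchy sqrt_major" using LIMSEQ_imp_Cauchy by blast
  have "Cauchy (\<lambda>n. sqrt_iter S n x)" for x
  proof (rule CauchyI')
    fix e :: real assume e: "0 < e"
    define d where "d = e / (norm x + 1)"
    have d: "0 < d" "d * norm x < e"
      using e by (auto simp: d_def field_simps add_pos_nonneg add_nonneg_pos)
    obtain M where M: "\<And>m n. M \<le> m \<Longrightarrow> M \<le> n \<Longrightarrow> norm (sqrt_major m - sqrt_major n) < d"
      using CauchyD[OF Cy d(1)] by blast
    have "norm (sqrt_iter S m x - sqrt_iter S n x) < e" if "M \<le> m" "m < n" for m n
    proof -
      have "norm (sqrt_iter S m x - sqrt_iter S n x) \<le> (sqrt_major n - sqrt_major m) * norm x"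
        using sqrt_iter_diff[of m n x] that by (simp add: norm_minus_commute)
      also have "\<dots> \<le> d * norm x"
        using M[of n m] that by (intro mult_right_mono) auto
      finally show ?thesis using d(2) by simp
    qed
    then show "\<exists>M. \<forall>m\<ge>M. \<forall>n>m. dist (sqrt_iter S m x) (sqrt_iter S n x) < e"
      unfolding dist_norm by blast
  qed
  then have "\<exists>l. (\<lambda>n. sqrt_iter S n x) \<longlonglongrightarrow> l" for x using Cauchy_convergent convergent_def by blast
  then obtain Y where Y: "\<And>x. (\<lambda>n. sqrt_iter S n x) \<longlonglongrightarrow> Y x" by metis
  have Yc: "norm (Y x) \<le> norm x" for x
  proof (rule LIMSEQ_le_const2[OF tendsto_norm[OF Y]], intro exI allI impI)
    fix n show "norm (sqrt_iter S n x) \<le> norm x"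
      using sqrt_iter_bound[of n x] mult_right_mono[OF sqrt_major_bounds(2)[of n], of "norm x"] by simp
  qed
  have lin: "Y (x + y) = Y x + Y y" "Y (r *\<^sub>R x) = r *\<^sub>R Y x" for x y r
  proof -
    have "(\<lambda>n. sqrt_iter S n (x + y)) \<longlonglongrightarrow> Y x + Y y"
      using tendsto_add[OF Y[of x] Y[of y]] by (simp add: linear_add[OF sqrt_iter_linear])
    then show "Y (x + y) = Y x + Y y" using Y LIMSEQ_unique by blast
    have "(\<lambda>n. sqrt_iter S n (r *\<^sub>R x)) \<longlonglongrightarrow> r *\<^sub>R Y x"
      using tendsto_scaleR[OF tendsto_const Y[of x]] by (simp add: linear_scale[OF sqrt_iter_linear])
    then show "Y (r *\<^sub>R x) = r *\<^sub>R Y x" using Y LIMSEQ_unique by blast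
  qed
  have bl: "bounded_linear Y" by (rule bounded_linear_intro[where K = 1]) (use lin Yc in auto)
  have fixpt: "Y x = (1/2) *\<^sub>R (S x + Y (Y x))" for x
  proof -
    have 1: "(\<lambda>n. sqrt_iter S n (sqrt_iter S n x - Y x)) \<longlonglongrightarrow> 0"
    proof (rule Lim_null_comparison)
      show "\<forall>\<^sub>F n in sequentially. norm (sqrt_iter S n (sqrt_iter S n x - Y x)) \<le> norm (sqrt_iter S n x - Y x)"
      proof (rule always_eventually, rule allI)
        fix n
        show "norm (sqrt_iter S n (sqrt_iter S n x - Y x)) \<le> norm (sqrt_iter S n x - Y x)"
          using sqrt_iter_bound[of n "sqrt_iter S n x - Y x"]
            mult_right_mono[OF sqrt_major_bounds(2)[of n], of "norm (sqrt_iter S n x - Y x)"] by simp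
      qed
      show "(\<lambda>n. norm (sqrt_iter S n x - Y x)) \<longlonglongrightarrow> 0"
        using tendsto_norm[OF tendsto_diff[OF Y[of x] tendsto_const[of "Y x"]]] by simp
    qed
    have "(\<lambda>n. sqrt_iter S n (sqrt_iter S n x)) \<longlonglongrightarrow> Y (Y x)"
      using tendsto_add[OF 1 Y[of "Y x"]] by (simp add: linear_diff[OF sqrt_iter_linear])
    then have "(\<lambda>n. sqrt_iter S (Suc n) x) \<longlonglongrightarrow> (1/2) *\<^sub>R (S x + Y (Y x))"
      by (auto intro!: tendsto_intros)
    then show ?thesis using LIMSEQ_Suc[OF Y[of x]] LIMSEQ_unique by blast
  qed
  show thesis by (rule that[OF bl Yc fixpt Y])
qed

end

text \<open>The iteration is applied to \<open>S = I - m T\<close>, which is a contraction by the positivity assumption.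
  Commutation with \<open>C\<close> passes from \<open>T\<close> to the iterates and to their limit.\<close>

lemma positive_square_root:
  fixes T :: "'a::{real_inner,complete_space} \<Rightarrow> 'a"
  assumes T: "bounded_linear T" and sym: "\<And>x y. T x \<bullet> y = x \<bullet> T y"
    and m: "m > 0" and pos: "\<And>x. m * (norm (T x))\<^sup>2 \<le> T x \<bullet> x"
  obtains R where "bounded_linear R" "\<And>x y. R x \<bullet> y = x \<bullet> R y" "\<And>x. 0 \<le> R x \<bullet> x"
    "\<And>x. R (R x) = T x"
    "\<And>C x. \<lbrakk>bounded_linear C; \<And>x. C (T x) = T (C x)\<rbrakk> \<Longrightarrow> C (R x) = R (C x)"
proof -
  interpret T: bounded_linear T by (rule T)
  define S where "S x = x - m *\<^sub>R T x" for x
  have blS: "bounded_linear S"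
    unfolding S_def by (intro bounded_linear_sub bounded_linear_ident bounded_linear_scaleR_right
        bounded_linear_compose[OF bounded_linear_scaleR_right T])
  interpret S: bounded_linear S by (rule blS)
  have Sc: "norm (S x) \<le> norm x" for x
  proof -
    have "(norm (S x))\<^sup>2 = (norm x)\<^sup>2 - 2 * m * (T x \<bullet> x) + m\<^sup>2 * (norm (T x))\<^sup>2"
      using norm_add_scaleR_square[of x "- m" "T x"] by (simp add: S_def inner_commute)
    also have "\<dots> = (norm x)\<^sup>2 - m * (T x \<bullet> x) - m * (T x \<bullet> x - m * (norm (T x))\<^sup>2)"
      by (simp add: algebra_simps power2_eq_square)
    also have "\<dots> \<le> (norm x)\<^sup>2"
    proof -
      have "0 \<le> m * (norm (T x))\<^sup>2" using m by simp
      then have "0 \<le> T x \<bullet> x" using pos[of x] by linarith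
      then have "0 \<le> m * (T x \<bullet> x)" "0 \<le> m * (T x \<bullet> x - m * (norm (T x))\<^sup>2)"
        using m pos[of x] by auto
      then show ?thesis by linarith
    qed
    finally show ?thesis by (rule power2_le_imp_le) simp
  qed
  have symS: "S x \<bullet> y = x \<bullet> S y" for x y by (simp add: S_def inner_simps sym)
  obtain Y where Y: "bounded_linear Y" "\<And>x. norm (Y x) \<le> norm x"
    "\<And>x. Y x = (1/2) *\<^sub>R (S x + Y (Y x))" "\<And>x. (\<lambda>n. sqrt_iter S n x) \<longlonglongrightarrow> Y x"
    using sqrt_iter_limit[OF blS Sc] by blast
  interpret Y: bounded_linear Y by (rule Y)
  have "sqrt_iter S n x \<bullet> y = x \<bullet> sqrt_iter S n y" for n x y
    by (induction n arbitrary: x y) (simp_all add: inner_simps symS)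
  then have symY: "Y x \<bullet> y = x \<bullet> Y y" for x y
    using tendsto_inner[OF Y(4)[of x] tendsto_const[of y]]
      tendsto_inner[OF tendsto_const[of x] Y(4)[of y]] LIMSEQ_unique by fastforce
  define R where "R x = (1 / sqrt m) *\<^sub>R (x - Y x)" for x
  have blR: "bounded_linear R"
    unfolding R_def by (intro bounded_linear_compose[OF bounded_linear_scaleR_right]
        bounded_linear_sub bounded_linear_ident Y)
  show thesis
  proof (rule that[of R])
    show "bounded_linear R" by fact
    show "R x \<bullet> y = x \<bullet> R y" for x y by (simp add: R_def inner_simps symY)
    show "0 \<le> R x \<bullet> x" for x
    proof -
      have "Y x \<bullet> x \<le> norm (Y x) * norm x" by (rule norm_cauchy_schwarz)
      also have "\<dots> \<le> norm x * norm x" by (intro mult_right_mono Y) auto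
      finally have "Y x \<bullet> x \<le> x \<bullet> x" by (simp add: power2_norm_eq_inner[symmetric] power2_eq_square)
      then show ?thesis using m by (simp add: R_def inner_simps)
    qed
    show "R (R x) = T x" for x
    proof -
      have "2 *\<^sub>R Y x = S x + Y (Y x)" by (subst Y(3)) simp
      then have "Y x + Y x = x - m *\<^sub>R T x + Y (Y x)" by (simp add: S_def scaleR_2)
      then have e: "x - Y x - (Y x - Y (Y x)) = m *\<^sub>R T x" by (simp add: algebra_simps)
      have "R (R x) = (1 / m) *\<^sub>R (x - Y x - (Y x - Y (Y x)))"
        using m by (simp add: R_def Y.diff Y.scaleR scaleR_right_diff_distrib)
      then show ?thesis using m by (simp add: e)
    qed
    show "C (R x) = R (C x)" if C: "bounded_linear C" and com: "\<And>x. C (T x) = T (C x)" for C x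
    proof -
      interpret C: bounded_linear C by (rule C)
      have "C (S x) = S (C x)" for x by (simp add: S_def C.diff C.scaleR com)
      then have "C (sqrt_iter S n x) = sqrt_iter S n (C x)" for n x
        by (induction n arbitrary: x) (simp_all add: C.add C.scaleR C.zero)
      then have "C (Y x) = Y (C x)"
        using C.tendsto[OF Y(4)[of x]] Y(4)[of "C x"] LIMSEQ_unique by fastforce
      then show ?thesis by (simp add: R_def C.diff C.scaleR)
    qed
  qed
qed

text \<open>Since \<open>R\<close> and \<open>S\<close> commute, \<open>S + R\<close> annihilates \<open>y = S x - R x\<close>. Hence both nonnegative numbers
  \<open>S y \<bullet> y\<close> and \<open>R y \<bullet> y\<close> vanish, and then so do \<open>S y\<close> and \<open>R y\<close>.\<close>

lemma positive_square_root_unique: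
  fixes R S :: "'a::real_inner \<Rightarrow> 'a"
  assumes lin: "linear R" "linear S" and sym: "\<And>x y. R x \<bullet> y = x \<bullet> R y" "\<And>x y. S x \<bullet> y = x \<bullet> S y"
    and pos: "\<And>x. 0 \<le> R x \<bullet> x" "\<And>x. 0 \<le> S x \<bullet> x"
    and eq: "\<And>x. R (R x) = S (S x)" and com: "\<And>x. S (R x) = R (S x)"
  shows "R x = S x"
proof -
  interpret R: linear R by fact
  interpret S: linear S by fact
  define y where "y = S x - R x"
  have "S y + R y = 0" by (simp add: y_def S.diff R.diff eq com)
  then have s: "S y \<bullet> y + R y \<bullet> y = 0" by (metis inner_add_left inner_zero_left)
  have zero: "P y = 0" if "linear P" "\<And>x y. P x \<bullet> y = x \<bullet> P y" "\<And>x. 0 \<le> P x \<bullet> x" "P y \<bullet> y = 0" for P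
  proof (rule ccontr)
    assume n: "P y \<noteq> 0"
    interpret P: linear P by fact
    define a where "a = P y \<bullet> P y"
    define b where "b = P (P y) \<bullet> P y"
    have a: "a > 0" using n by (simp add: a_def)
    have b: "b \<ge> 0" using that(3) by (simp add: b_def)
    \<comment> \<open>the form at \<open>y + t *\<^sub>R P y\<close> is \<open>2 * t * a + t\<^sup>2 * b\<close>, negative for this \<open>t\<close>\<close>
    define t where "t = - a / (b + 1)"
    have "0 \<le> P (y + t *\<^sub>R P y) \<bullet> (y + t *\<^sub>R P y)" by (rule that(3))
    also have "\<dots> = 2 * t * a + t\<^sup>2 * b"
      by (simp add: P.add P.scale inner_simps that(2)[of "P y" y] that(4) a_def b_def power2_eq_square algebra_simps)
    also have "\<dots> = - a\<^sup>2 * (b + 2) / (b + 1)\<^sup>2"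
      using b by (simp add: t_def power2_eq_square divide_simps) (simp add: algebra_simps)
    also have "\<dots> < 0" using a b by (simp add: divide_neg_pos)
    finally show False by simp
  qed
  have "S y = 0" "R y = 0"
    using zero[of S] zero[of R] s pos(1)[of y] pos(2)[of y] lin sym pos by auto
  then have "(S x - R x) \<bullet> y = 0" by (simp add: inner_diff_left sym)
  then show ?thesis by (simp add: y_def)
qed

section \<open>The square root of an unbounded positive operator\<close>

lemma self_adjointD:
  assumes "self_adjoint P"
  shows "linear_operator P" "closure (dom P) = UNIV"
    "P y = Some z \<longleftrightarrow> (\<forall>x\<in>dom P. ap P x \<bullet> y = x \<bullet> z)"
  using assms by (auto simp: self_adjoint_def)

text \<open>The kernel of a self-adjoint operator is orthogonal to its range.\<close>

lemma inverse_of_surjective_self_adjoint: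
  fixes P :: "'h::real_inner \<rightharpoonup> 'h"
  assumes P: "self_adjoint P" and surj: "\<And>y. \<exists>x. P x = Some y"
  obtains T where "linear T" "\<And>x y. P x = Some y \<longleftrightarrow> x = T y" "\<And>x y. T x \<bullet> y = x \<bullet> T y"
proof -
  note sa = self_adjointD[OF P]
  have sub: "subspace (dom P)" using sa(1) by (simp add: linear_operator_def)
  have add: "P (x + x') = Some (y + y')" if "P x = Some y" "P x' = Some y'" for x x' y y'
  proof -
    have d: "x \<in> dom P" "x' \<in> dom P" using that by auto
    have "ap P (x + x') = y + y'"
      using sa(1) d that by (simp add: linear_operator_def)
    moreover have "x + x' \<in> dom P" using d sub by (simp add: subspace_add)
    ultimately show ?thesis by auto
  qed
  have scale: "P (c *\<^sub>R x) = Some (c *\<^sub>R y)" if "P x = Some y" for c x y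
  proof -
    have d: "x \<in> dom P" using that by auto
    have "ap P (c *\<^sub>R x) = c *\<^sub>R y"
      using sa(1) d that by (simp add: linear_operator_def)
    moreover have "c *\<^sub>R x \<in> dom P" using d sub by (simp add: subspace_scale)
    ultimately show ?thesis by auto
  qed
  have ker: "x = 0" if "P x = Some 0" for x
  proof -
    obtain u where u: "P u = Some x" using surj by blast
    have "ap P u \<bullet> x = u \<bullet> 0" using sa(3)[of x 0] that u by blast
    then show ?thesis using u by simp
  qed
  have inj: "x = x'" if "P x = Some y" "P x' = Some y" for x x' y
  proof -
    have "P (x + (-1) *\<^sub>R x') = Some (y + (-1) *\<^sub>R y)" using add scale that by blast
    then show ?thesis using ker[of "x - x'"] by simp
  qed
  obtain T where T: "\<And>y. P (T y) = Some y" using surj by metis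
  have iff: "P x = Some y \<longleftrightarrow> x = T y" for x y using T inj by blast
  show thesis
  proof (rule that[OF _ iff])
    show "linear T"
    proof (rule linearI)
      show "T (x + y) = T x + T y" for x y using add[OF T[of x] T[of y]] iff by auto
      show "T (c *\<^sub>R x) = c *\<^sub>R T x" for c x using scale[OF T[of x]] iff by metis
    qed
    show "T x \<bullet> y = x \<bullet> T y" for x y
    proof -
      have "\<forall>u\<in>dom P. ap P u \<bullet> T y = u \<bullet> y" using sa(3)[of "T y" y] T by blast
      moreover have "T x \<in> dom P" "ap P (T x) = x" using T by auto
      ultimately show ?thesis by metis
    qed
  qed
qed

text \<open>The lower bound makes the range closed, and a vector orthogonal to the range lies in the kernel of
  the adjoint, that is, of \<open>A\<close> itself.\<close>

lemma strictly_positive_surjective: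
  fixes A :: "'h::{real_inner,complete_space} \<rightharpoonup> 'h"
  assumes A: "self_adjoint A" and m: "m > 0" "\<And>x. x \<in> dom A \<Longrightarrow> m * (norm x)\<^sup>2 \<le> ap A x \<bullet> x"
  shows "\<exists>x. A x = Some y"
proof (rule ccontr)
  assume y: "\<nexists>x. A x = Some y"
  note sa = self_adjointD[OF A]
  have sub: "subspace (dom A)" using sa(1) by (simp add: linear_operator_def)
  let ?S = "ap A ` dom A"
  have S: "subspace ?S"
    unfolding subspace_def
  proof (intro conjI ballI allI)
    have "ap A (0 *\<^sub>R 0) = 0 *\<^sub>R ap A 0" "0 \<in> dom A"
      using sa(1) subspace_0[OF sub] unfolding linear_operator_def by blast+
    then show "0 \<in> ?S" by force
    show "x + y \<in> ?S" if xy: "x \<in> ?S" "y \<in> ?S" for x y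
    proof -
      obtain u v where "u \<in> dom A" "v \<in> dom A" "x = ap A u" "y = ap A v" using xy by blast
      then have "x + y = ap A (u + v)" "u + v \<in> dom A"
        using sa(1) subspace_add[OF sub] unfolding linear_operator_def by auto
      then show ?thesis by blast
    qed
    show "c *\<^sub>R x \<in> ?S" if "x \<in> ?S" for c x
    proof -
      obtain u where "u \<in> dom A" "x = ap A u" using \<open>x \<in> ?S\<close> by blast
      then have "c *\<^sub>R x = ap A (c *\<^sub>R u)" "c *\<^sub>R u \<in> dom A"
        using sa(1) subspace_scale[OF sub] unfolding linear_operator_def by auto
      then show ?thesis by blast
    qed
  qed
  have below: "m * norm x \<le> norm (ap A x)" if "x \<in> dom A" for x
  proof (cases "x = 0")
    case False
    have "m * (norm x)\<^sup>2 \<le> norm (ap A x) * norm x"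
      using m(2)[OF that] norm_cauchy_schwarz[of "ap A x" x] by linarith
    then show ?thesis using False by (simp add: power2_eq_square)
  qed simp
  have clS: "closed ?S"
    unfolding closed_sequential_limits
  proof (intro allI impI)
    fix f l assume "(\<forall>n. f n \<in> ?S) \<and> f \<longlonglongrightarrow> l"
    then have f: "\<And>n. f n \<in> ?S" "f \<longlonglongrightarrow> l" by auto
    obtain x where x: "\<And>n. x n \<in> dom A" "\<And>n. f n = ap A (x n)"
    proof -
      have "\<forall>n. \<exists>x. x \<in> dom A \<and> f n = ap A x" using f(1) by blast
      then show ?thesis using that by (auto dest!: choice)
    qed
    have "Cauchy x"
    proof (rule metric_CauchyI)
      fix e :: real assume e: "0 < e"
      have "Cauchy f" using f(2) LIMSEQ_imp_Cauchy by blast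
      then obtain M where M: "\<And>j k. M \<le> j \<Longrightarrow> M \<le> k \<Longrightarrow> norm (f j - f k) < m * e"
        using CauchyD[of f "m * e"] m(1) e by auto
      have "dist (x j) (x k) < e" if "M \<le> j" "M \<le> k" for j k
      proof -
        have "x j - x k \<in> dom A" using x sub by (simp add: subspace_diff)
        moreover have "ap A (x j - x k) = f j - f k"
        proof -
          have "ap A (x j + (-1) *\<^sub>R x k) = ap A (x j) + (-1) *\<^sub>R ap A (x k)"
            using sa(1) x(1) subspace_scale[OF sub] unfolding linear_operator_def by metis
          then show ?thesis by (simp add: x(2))
        qed
        ultimately have "m * norm (x j - x k) \<le> norm (f j - f k)" using below by metis
        then have "m * norm (x j - x k) < m * e" using M[OF that] by linarith
        then show ?thesis using m(1) by (simp add: dist_norm)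
      qed
      then show "\<exists>M. \<forall>j\<ge>M. \<forall>k\<ge>M. dist (x j) (x k) < e" by blast
    qed
    then obtain xl where xl: "x \<longlonglongrightarrow> xl" using Cauchy_convergent convergent_def by blast
    have "A xl = Some l"
      unfolding sa(3)
    proof
      fix u assume u: "u \<in> dom A"
      have "ap A u \<bullet> x n = u \<bullet> f n" for n
        using sa(3)[of "x n" "f n"] x u by (metis domIff option.collapse)
      moreover have "(\<lambda>n. ap A u \<bullet> x n) \<longlonglongrightarrow> ap A u \<bullet> xl" by (intro tendsto_intros xl)
      moreover have "(\<lambda>n. u \<bullet> f n) \<longlonglongrightarrow> u \<bullet> l" by (intro tendsto_intros f(2))
      ultimately show "ap A u \<bullet> xl = u \<bullet> l" using LIMSEQ_unique by fastforce
    qed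
    then show "l \<in> ?S" by (metis domI image_eqI option.sel)
  qed
  have yS: "y \<notin> ?S" using y by (auto simp: dom_def)
  obtain v where v: "v \<noteq> 0" "\<And>s. s \<in> ?S \<Longrightarrow> v \<bullet> s = 0"
    using closed_proper_subspace_orthogonal[OF S clS yS] by auto
  have "A v = Some 0" unfolding sa(3) by (simp add: inner_commute[of _ v] v(2))
  then have "m * (norm v)\<^sup>2 \<le> 0" using m(2)[of v] by (auto simp: dom_def)
  then show False using v(1) m(1) by (simp add: mult_le_0_iff)
qed

text \<open>This is the interface to the unbounded operators: \<open>R = A\<^sup>-\<^sup>1\<^sup>/\<^sup>2\<close> is defined everywhere, and domains
  become ranges of powers of \<open>R\<close>. The operator \<open>R\<close> is the bounded root of \<open>A\<^sup>-\<^sup>1\<close>. The definite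
  description in \<open>op_sqrt\<close> denotes its inverse, because any other nonnegative self-adjoint root of \<open>A\<close>
  has a bounded inverse which is a positive root of \<open>A\<^sup>-\<^sup>1\<close> too.\<close>

lemma op_sqrt_inverse:
  fixes A :: "'h::{real_inner,complete_space} \<rightharpoonup> 'h"
  assumes A: "self_adjoint A" "strictly_positive A"
  obtains R where "bounded_linear R" "\<And>x y. R x \<bullet> y = x \<bullet> R y" "inj R" "closure (range R) = UNIV"
    "\<And>x y. op_sqrt A x = Some y \<longleftrightarrow> x = R y" "\<And>x y. A x = Some y \<longleftrightarrow> x = R (R y)"
proof -
  obtain m where m: "m > 0" "\<And>x. x \<in> dom A \<Longrightarrow> m * (norm x)\<^sup>2 \<le> ap A x \<bullet> x"
    using A(2) by (auto simp: strictly_positive_def)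
  obtain T where T: "linear T" "\<And>x y. A x = Some y \<longleftrightarrow> x = T y" "\<And>x y. T x \<bullet> y = x \<bullet> T y"
    using inverse_of_surjective_self_adjoint[OF A(1) strictly_positive_surjective[OF A(1) m]] by blast
  have Tpos: "m * (norm (T y))\<^sup>2 \<le> T y \<bullet> y" for y
    using m(2)[of "T y"] T(2)[of "T y" y] by (auto simp: inner_commute dom_def)
  have Tb: "norm (T y) \<le> norm y * (1 / m)" for y
  proof (cases "T y = 0")
    case False
    have "m * (norm (T y))\<^sup>2 \<le> norm (T y) * norm y"
      using Tpos[of y] norm_cauchy_schwarz[of "T y" y] by linarith
    then show ?thesis using False m(1) by (simp add: power2_eq_square field_simps)
  qed (use m(1) in simp)
  have blT: "bounded_linear T"
    using T(1) Tb by (intro bounded_linear_intro[where K = "1/m"]) (auto simp: linear_add linear_scale)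
  obtain R where R: "bounded_linear R" "\<And>x y. R x \<bullet> y = x \<bullet> R y" "\<And>x. 0 \<le> R x \<bullet> x" "\<And>x. R (R x) = T x"
    "\<And>C x. \<lbrakk>bounded_linear C; \<And>x. C (T x) = T (C x)\<rbrakk> \<Longrightarrow> C (R x) = R (C x)"
    by (rule positive_square_root[OF blT T(3) m(1) Tpos]) blast
  interpret R: bounded_linear R by (rule R)
  have ker: "y = 0" if "R y = 0" for y
  proof -
    have "T y = 0" using that R(4) R.zero by metis
    moreover have "T 0 = 0" using T(1) by (rule linear_0)
    ultimately have "A 0 = Some y" "A 0 = Some 0" using T(2) by auto
    then show ?thesis by simp
  qed
  have injR: "inj R"
    by (rule injI) (metis R.diff ker right_minus_eq)
  have "dom A = range T" using T(2) by (auto simp: dom_def)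
  then have "dom A \<subseteq> range R" using R(4) by (metis image_subsetI rangeI)
  then have cl: "closure (range R) = UNIV"
    using self_adjointD(2)[OF A(1)] closure_mono[of "dom A" "range R"] by auto
  define B where "B x = (if x \<in> range R then Some (inv R x) else None)" for x
  have B: "B x = Some y \<longleftrightarrow> x = R y" for x y
    using injR by (auto simp: B_def inv_f_f f_inv_into_f)
  have domB: "dom B = range R" by (auto simp: B_def dom_def)
  have apB: "ap B (R y) = y" for y using B[of "R y" y] by simp
  have lB: "linear_operator B"
    unfolding linear_operator_def domB
  proof (intro conjI ballI allI)
    show "subspace (range R)" 
      by (auto simp: subspace_def R.add[symmetric] R.scaleR[symmetric] intro: range_eqI[of _ _ 0] simp: R.zero)
    show "ap B (x + y) = ap B x + ap B y" if xy: "x \<in> range R" "y \<in> range R" for x y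
    proof -
      obtain u v where "x = R u" "y = R v" using xy by blast
      then show ?thesis using apB[of "u + v"] by (simp add: R.add apB)
    qed
    show "ap B (c *\<^sub>R x) = c *\<^sub>R ap B x" if x: "x \<in> range R" for c x
    proof -
      obtain u where "x = R u" using x by blast
      then show ?thesis using apB[of "c *\<^sub>R u"] by (simp add: R.scaleR apB)
    qed
  qed
  have saB: "self_adjoint B"
    unfolding self_adjoint_def
  proof (intro conjI allI)
    show "linear_operator B" by fact
    show "closure (dom B) = UNIV" using cl domB by simp
    show "B y = Some z \<longleftrightarrow> (\<forall>x\<in>dom B. ap B x \<bullet> y = x \<bullet> z)" for y z
    proof -
      have "(\<forall>x\<in>dom B. ap B x \<bullet> y = x \<bullet> z) \<longleftrightarrow> (\<forall>u. u \<bullet> y = u \<bullet> R z)"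
        by (auto simp: domB apB R(2))
      also have "\<dots> \<longleftrightarrow> y = R z" by (rule vector_eq_ldot)
      finally show ?thesis by (simp add: B)
    qed
  qed
  have nnB: "nonneg_operator B"
    using R(3) by (auto simp: nonneg_operator_def domB apB inner_commute)
  have BB: "B \<circ>\<^sub>m B = A"
  proof
    fix x show "(B \<circ>\<^sub>m B) x = A x"
    proof (rule option.expand)
      fix y
    next
      have iff: "(B \<circ>\<^sub>m B) x = Some y \<longleftrightarrow> A x = Some y" for y
        by (simp add: map_comp_Some_iff B T(2) R(4)[symmetric])
      show "((B \<circ>\<^sub>m B) x = None) = (A x = None)" using iff by (metis not_None_eq)
      show "ap (B \<circ>\<^sub>m B) x = ap A x" if "(B \<circ>\<^sub>m B) x \<noteq> None" using iff that by (metis not_None_eq)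
    qed
  qed
  have uniq: "B' = B" if B': "self_adjoint B'" "nonneg_operator B'" "B' \<circ>\<^sub>m B' = A" for B'
  proof -
    have surj: "\<exists>x. B' x = Some y" for y
    proof -
      have "(B' \<circ>\<^sub>m B') (T y) = Some y" using T(2) B'(3) by simp
      then show ?thesis by (auto simp: map_comp_Some_iff)
    qed
    obtain S where S: "linear S" "\<And>x y. B' x = Some y \<longleftrightarrow> x = S y" "\<And>x y. S x \<bullet> y = x \<bullet> S y"
      using inverse_of_surjective_self_adjoint[OF B'(1) surj] by blast
    have SS: "S (S y) = T y" for y
    proof -
      have "(B' \<circ>\<^sub>m B') (S (S y)) = Some y" using S(2) by (auto simp: map_comp_Some_iff)
      then show ?thesis using T(2) B'(3) by simp
    qed
    have Spos: "0 \<le> S y \<bullet> y" for y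
      using B'(2) S(2)[of "S y" y] by (auto simp: nonneg_operator_def dom_def inner_commute)
    have "norm (S y) \<le> norm y * sqrt (1 / m)" for y
    proof (rule power2_le_imp_le)
      have "(norm (S y))\<^sup>2 = T y \<bullet> y" by (simp add: power2_norm_eq_inner S(3) SS inner_commute)
      also have "\<dots> \<le> norm (T y) * norm y" by (rule norm_cauchy_schwarz)
      also have "\<dots> \<le> norm y * (1 / m) * norm y" by (intro mult_right_mono Tb) auto
      also have "\<dots> = (norm y * sqrt (1 / m))\<^sup>2"
        using m(1) by (simp add: power_mult_distrib power2_eq_square real_sqrt_divide)
      finally show "(norm (S y))\<^sup>2 \<le> (norm y * sqrt (1 / m))\<^sup>2" .
    qed (use m(1) in auto)
    then have blS: "bounded_linear S"
      using S(1) by (intro bounded_linear_intro[where K = "sqrt (1/m)"]) (auto simp: linear_add linear_scale)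
    have "S (T x) = T (S x)" for x by (simp add: SS[symmetric])
    then have com: "S (R x) = R (S x)" for x using R(5)[OF blS] by blast
    have "R y = S y" for y
      by (rule positive_square_root_unique[OF R.linear_axioms S(1) R(2) S(3) R(3) Spos _ com])
        (simp add: R(4) SS)
    then have "B' x = Some y \<longleftrightarrow> B x = Some y" for x y using S(2) B by simp
    then show ?thesis by (metis ext not_None_eq)
  qed
  have "op_sqrt A = B"
    unfolding op_sqrt_def by (rule the_equality) (use saB nnB BB uniq in blast)+
  then show thesis
    using that[of R] R injR cl B T(2) by simp
qed


section \<open>Differential inequalities\<close>

lemma norm_square_has_derivative:
  fixes d :: "real \<Rightarrow> 'a::real_inner"
  assumes "(d has_vector_derivative d') (at t within S)"
  shows "((\<lambda>t. (norm (d t))\<^sup>2) has_real_derivative 2 * (d t \<bullet> d')) (at t within S)"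
proof -
  have "((\<lambda>t. d t \<bullet> d t) has_derivative (\<lambda>h. d t \<bullet> (h *\<^sub>R d') + (h *\<^sub>R d') \<bullet> d t)) (at t within S)"
    using assms unfolding has_vector_derivative_def by (intro has_derivative_inner)
  moreover have "(\<lambda>h. d t \<bullet> (h *\<^sub>R d') + (h *\<^sub>R d') \<bullet> d t) = (*) (2 * (d t \<bullet> d'))"
    by (rule ext) (simp add: inner_commute)
  ultimately show ?thesis by (simp add: has_field_derivative_def power2_norm_eq_inner)
qed

lemma nonincreasing_on_interval:
  fixes f f' :: "real \<Rightarrow> real"
  assumes ab: "a \<le> b" and d: "\<And>t. t \<in> {a..b} \<Longrightarrow> (f has_real_derivative f' t) (at t within {a..b})"
    and neg: "\<And>t. t \<in> {a..b} \<Longrightarrow> f' t \<le> 0"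
  shows "f b \<le> f a"
proof -
  obtain x where x: "x \<in> {a..b}" "f b - f a = (b - a) * f' x"
    using mvt_very_simple[of a b f "\<lambda>x h. h * f' x"] ab d
    by (auto simp: has_field_derivative_def mult.commute[of _ "f' _"])
  have "(b - a) * f' x \<le> 0" using ab neg[OF x(1)] by (simp add: mult_nonneg_nonpos)
  then show ?thesis using x(2) by simp
qed

text \<open>The norm is not differentiable at 0, so the estimate is made for \<open>sqrt (\<parallel>d\<parallel>\<^sup>2 + r\<^sup>2)\<close> and \<open>r\<close> tends to 0.\<close>

lemma norm_growth_bound:
  fixes d :: "real \<Rightarrow> 'a::real_inner"
  assumes ab: "a \<le> b"
    and der: "\<And>t. t \<in> {a..b} \<Longrightarrow> (d has_vector_derivative d' t) (at t within {a..b})"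
    and est: "\<And>t. t \<in> {a..b} \<Longrightarrow> d t \<bullet> d' t \<le> e * norm (d t)" and e: "0 \<le> e"
  shows "norm (d b) \<le> norm (d a) + e * (b - a)"
proof (rule field_le_epsilon)
  fix r :: real assume r: "0 < r"
  define s where "s t = sqrt ((norm (d t))\<^sup>2 + r\<^sup>2)" for t
  have pos: "(norm (d t))\<^sup>2 + r\<^sup>2 > 0" for t using r by (simp add: add_nonneg_pos)
  have spos: "s t > 0" for t unfolding s_def using pos by simp
  have le: "norm (d t) \<le> s t" for t unfolding s_def by (simp add: real_le_rsqrt)
  have "s b - e * b \<le> s a - e * a"
  proof (rule nonincreasing_on_interval[OF ab])
    fix t assume t: "t \<in> {a..b}"
    show "((\<lambda>t. s t - e * t) has_real_derivative (d t \<bullet> d' t) / s t - e) (at t within {a..b})"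
    proof -
      have "((\<lambda>t. sqrt ((norm (d t))\<^sup>2 + r\<^sup>2)) has_real_derivative
          inverse (sqrt ((norm (d t))\<^sup>2 + r\<^sup>2)) / 2 * (2 * (d t \<bullet> d' t) + 0)) (at t within {a..b})"
        by (rule DERIV_chain2[OF DERIV_real_sqrt[OF pos]
              DERIV_add[OF norm_square_has_derivative[OF der[OF t]] DERIV_const]])
      moreover have "inverse (sqrt ((norm (d t))\<^sup>2 + r\<^sup>2)) / 2 * (2 * (d t \<bullet> d' t) + 0) = (d t \<bullet> d' t) / s t"
        unfolding s_def divide_inverse by simp
      ultimately have "(s has_real_derivative (d t \<bullet> d' t) / s t) (at t within {a..b})"
        unfolding s_def by simp
      from DERIV_diff[OF this DERIV_cmult_Id[of e]] show ?thesis .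
    qed
    have "d t \<bullet> d' t \<le> e * s t" using est[OF t] mult_left_mono[OF le e] by (rule order_trans)
    then show "(d t \<bullet> d' t) / s t - e \<le> 0" using spos[of t] by (simp add: field_simps)
  qed
  moreover have "s a \<le> norm (d a) + r"
    unfolding s_def using r by (intro real_le_lsqrt) (auto simp: power2_sum)
  ultimately show "norm (d b) \<le> norm (d a) + e * (b - a) + r" using le[of b] by (simp add: algebra_simps)
qed

lemma vector_mean_value_bound:
  fixes f :: "real \<Rightarrow> 'a::real_normed_vector"
  assumes S: "closed_segment a b \<subseteq> S"
    and d: "\<And>t. t \<in> S \<Longrightarrow> (f has_vector_derivative f' t) (at t within S)"
    and B: "\<And>t. t \<in> S \<Longrightarrow> norm (f' t) \<le> B"
  shows "norm (f b - f a) \<le> B * \<bar>b - a\<bar>"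
proof -
  have "norm (f b - f a) \<le> B * norm (b - a)"
  proof (rule differentiable_bound[of "closed_segment a b" f "\<lambda>t h. h *\<^sub>R f' t"])
    show "(f has_derivative (\<lambda>h. h *\<^sub>R f' x)) (at x within closed_segment a b)"
      if "x \<in> closed_segment a b" for x
      using d[of x] that S has_derivative_subset unfolding has_vector_derivative_def by blast
    show "onorm (\<lambda>h. h *\<^sub>R f' x) \<le> B" if "x \<in> closed_segment a b" for x
    proof -
      have "norm (f' x) \<le> B" using B that S by blast
      then show ?thesis
        by (intro onorm_le) (simp add: mult.commute[of B] mult_left_mono)
    qed
  qed auto
  then show ?thesis by simp
qed

lemma has_vector_derivative_epsilon:
  fixes f :: "real \<Rightarrow> 'a::real_normed_vector"
  assumes "\<And>e. 0 < e \<Longrightarrow> \<exists>\<delta>>0. \<forall>s\<in>S. \<bar>s - t\<bar> < \<delta> \<longrightarrow> norm (f s - f t - (s - t) *\<^sub>R g) \<le> e * \<bar>s - t\<bar>"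
  shows "(f has_vector_derivative g) (at t within S)"
  unfolding has_vector_derivative_def has_derivative_within_alt
  using assms by (simp add: bounded_linear_scaleR_left)

section \<open>Flows of bounded operators\<close>

lemma summable_norm_complete:
  fixes f :: "nat \<Rightarrow> 'a::{real_normed_vector,complete_space}"
  assumes "summable (\<lambda>n. norm (f n))"
  shows "summable f"
proof -
  have C: "Cauchy (\<lambda>n. \<Sum>k<n. norm (f k))"
    using assms by (simp add: summable_iff_convergent convergent_Cauchy)
  have "Cauchy (\<lambda>n. \<Sum>k<n. f k)"
  proof (rule CauchyI')
    fix e :: real assume "0 < e"
    then obtain M where M: "\<And>m n. M \<le> m \<Longrightarrow> M \<le> n \<Longrightarrow>
        norm ((\<Sum>k<m. norm (f k)) - (\<Sum>k<n. norm (f k))) < e"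
      using CauchyD[OF C] by blast
    have "dist (\<Sum>k<m. f k) (\<Sum>k<n. f k) < e" if "M \<le> m" "m < n" for m n
    proof -
      have split: "(\<Sum>k<n. g k) - (\<Sum>k<m. g k) = sum g {m..<n}" for g :: "nat \<Rightarrow> 'b::ab_group_add"
        using that sum_diff_nat_ivl[of 0 m n g] by (simp add: atLeast0LessThan)
      have "dist (\<Sum>k<m. f k) (\<Sum>k<n. f k) = norm (sum f {m..<n})"
        by (metis dist_commute dist_norm split)
      also have "\<dots> \<le> sum (\<lambda>k. norm (f k)) {m..<n}" by (rule norm_sum)
      also have "\<dots> = (\<Sum>k<n. norm (f k)) - (\<Sum>k<m. norm (f k))" by (simp add: split)
      also have "\<dots> < e" using M[of n m] that by simp
      finally show ?thesis .
    qed
    then show "\<exists>M. \<forall>m\<ge>M. \<forall>n>m. dist (\<Sum>k<m. f k) (\<Sum>k<n. f k) < e" by blast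
  qed
  then show ?thesis by (simp add: summable_iff_convergent Cauchy_convergent)
qed

text \<open>The partial sums of the exponential series have quadratic Taylor remainders with a constant that is
  independent of the number of summands. The bound survives the passage to the limit, where it gives
  the derivative.\<close>

lemma exp_flow:
  fixes M :: "'a::{real_normed_vector,complete_space} \<Rightarrow> 'a"
  assumes M: "bounded_linear M"
  obtains E :: "real \<Rightarrow> 'a \<Rightarrow> 'a" where
    "\<And>t. linear (E t)" "\<And>x. E 0 x = x"
    "\<And>t x. ((\<lambda>t. E t x) has_vector_derivative M (E t x)) (at t)"
    "\<And>C t x. \<lbrakk>bounded_linear C; \<And>x. C (M x) = M (C x)\<rbrakk> \<Longrightarrow> C (E t x) = E t (C x)"
proof -
  interpret M: bounded_linear M by (rule M)
  obtain K where K: "K > 0" "\<And>x. norm (M x) \<le> norm x * K" using M.pos_bounded by blast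
  have pow: "norm ((M ^^ k) x) \<le> K ^ k * norm x" for k x
  proof (induction k)
    case (Suc k)
    have "norm ((M ^^ Suc k) x) \<le> norm ((M ^^ k) x) * K" using K(2) by simp
    also have "\<dots> \<le> (K ^ k * norm x) * K" using Suc K(1) by simp
    finally show ?case by (simp add: mult_ac)
  qed simp
  define c where "c t x k = (t ^ k / fact k) *\<^sub>R (M ^^ k) x" for t :: real and x k
  define s where "s n t x = (\<Sum>k<n. c t x k)" for n t x
  have cb: "norm (c t x k) \<le> (K * \<bar>t\<bar>) ^ k /\<^sub>R fact k * norm x" for t x k
  proof -
    have "norm (c t x k) = \<bar>t\<bar> ^ k / fact k * norm ((M ^^ k) x)" by (simp add: c_def power_abs)
    also have "\<dots> \<le> \<bar>t\<bar> ^ k / fact k * (K ^ k * norm x)" by (intro mult_left_mono pow) auto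
    finally show ?thesis by (simp add: power_mult_distrib field_simps)
  qed
  have ssum: "summable (\<lambda>k. (K * \<bar>t\<bar>) ^ k /\<^sub>R fact k * norm x)" for t and x :: 'a
    by (intro summable_mult2 summable_exp_generic)
  have sn: "summable (\<lambda>k. norm (c t x k))" for t x
    by (rule summable_comparison_test'[OF ssum[of t x]]) (use cb in simp)
  define E where "E t x = suminf (c t x)" for t x
  have lim: "(\<lambda>n. s n t x) \<longlonglongrightarrow> E t x" for t x
    unfolding s_def E_def by (rule summable_LIMSEQ[OF summable_norm_complete[OF sn]])
  have sb: "norm (s n t x) \<le> exp (K * \<bar>t\<bar>) * norm x" for n t x
  proof -
    have "norm (s n t x) \<le> (\<Sum>k<n. norm (c t x k))" unfolding s_def by (rule norm_sum)
    also have "\<dots> \<le> (\<Sum>k<n. (K * \<bar>t\<bar>) ^ k /\<^sub>R fact k * norm x)" by (intro sum_mono cb)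
    also have "\<dots> \<le> (\<Sum>k. (K * \<bar>t\<bar>) ^ k /\<^sub>R fact k * norm x)"
      using K(1) by (intro sum_le_suminf ssum) auto
    also have "\<dots> = (\<Sum>k. (K * \<bar>t\<bar>) ^ k /\<^sub>R fact k) * norm x"
      by (rule suminf_mult2[symmetric]) (rule summable_exp_generic)
    also have "(\<Sum>k. (K * \<bar>t\<bar>) ^ k /\<^sub>R fact k) = exp (K * \<bar>t\<bar>)" by (simp only: exp_def)
    finally show ?thesis .
  qed
  have sder: "((\<lambda>t. s (Suc n) t x) has_vector_derivative M (s n t x)) (at t within S)" for n t x S
  proof (induction n)
    case 0
    show ?case by (simp add: s_def c_def M.zero)
  next
    case (Suc n)
    have "((\<lambda>t. c t x (Suc n)) has_vector_derivative M (c t x n)) (at t within S)"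
    proof -
      have "((\<lambda>t. t ^ Suc n / fact (Suc n)) has_real_derivative (real (Suc n) * t ^ n) / fact (Suc n)) (at t within S)"
        by (intro derivative_eq_intros) (auto intro!: derivative_eq_intros)
      moreover have "(real (Suc n) * t ^ n) / fact (Suc n) = t ^ n / fact n"
        by (simp add: fact_Suc del: of_nat_Suc)
      ultimately have "((\<lambda>t. t ^ Suc n / fact (Suc n)) has_real_derivative t ^ n / fact n) (at t within S)"
        by simp
      from has_vector_derivative_scaleR[OF this has_vector_derivative_const[of "(M ^^ Suc n) x"]]
      show ?thesis unfolding c_def by (simp add: M.scaleR)
    qed
    from has_vector_derivative_add[OF Suc this] show ?case by (simp add: s_def M.add)
  qed
  have lin: "linear (s n t)" for n t
  proof -
    have "linear (M ^^ k)" for k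
    proof (induction k)
      case (Suc k)
      show ?case using linear_compose[OF Suc M.linear_axioms] by (simp add: o_def comp_def)
    qed (simp add: linear_id[unfolded id_def] id_def)
    then show ?thesis
      by (intro linearI) (simp_all add: s_def c_def linear_add linear_scale sum.distrib
          scaleR_right_distrib scaleR_sum_right mult.commute)
  qed
  show thesis
  proof (rule that[of E])
    show "linear (E t)" for t
    proof (rule linearI)
      show "E t (x + y) = E t x + E t y" for x y
        using LIMSEQ_unique[OF lim[of t "x + y"]] tendsto_add[OF lim[of t x] lim[of t y]]
        by (simp add: linear_add[OF lin])
      show "E t (r *\<^sub>R x) = r *\<^sub>R E t x" for r x
        using LIMSEQ_unique[OF lim[of t "r *\<^sub>R x"]] tendsto_scaleR[OF tendsto_const lim[of t x], of r]
        by (simp add: linear_scale[OF lin])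
    qed
    show "E 0 x = x" for x
    proof -
      have "s (Suc n) 0 x = x" for n
        by (induction n) (simp_all add: s_def c_def)
      then show ?thesis using LIMSEQ_Suc[OF lim[of 0 x]] by (simp add: LIMSEQ_const_iff)
    qed
    show "((\<lambda>t. E t x) has_vector_derivative M (E t x)) (at t)" for t x
    proof (rule has_vector_derivative_epsilon)
      fix e :: real assume e: "0 < e"
      define B where "B = K * K * (exp (K * (\<bar>t\<bar> + 1)) * norm x) + 1"
      have B: "B > 0" using K(1) by (simp add: B_def add_nonneg_pos)
      have main: "norm (E r x - E t x - (r - t) *\<^sub>R M (E t x)) \<le> B * \<bar>r - t\<bar> * \<bar>r - t\<bar>"
        if r: "\<bar>r - t\<bar> < 1" for r
      proof -
        have bound: "norm (M (s (Suc n) q x) - M (s (Suc n) t x)) \<le> B * \<bar>r - t\<bar>"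
          if q: "q \<in> closed_segment t r" for n q
        proof -
          have "norm (s (Suc n) q x - s (Suc n) t x) \<le> (K * (exp (K * (\<bar>t\<bar> + 1)) * norm x)) * \<bar>q - t\<bar>"
          proof (rule vector_mean_value_bound[where S = "closed_segment t q" and f' = "\<lambda>u. M (s n u x)"])
            fix u assume u: "u \<in> closed_segment t q"
            have "\<bar>u\<bar> \<le> \<bar>t\<bar> + 1" using u q r by (auto simp: closed_segment_eq_real_ivl split: if_splits)
            then have "exp (K * \<bar>u\<bar>) * norm x \<le> exp (K * (\<bar>t\<bar> + 1)) * norm x"
              using K(1) by (intro mult_right_mono) auto
            then have "norm (s n u x) \<le> exp (K * (\<bar>t\<bar> + 1)) * norm x" using sb[of n u x] by linarith
            then have "norm (s n u x) * K \<le> exp (K * (\<bar>t\<bar> + 1)) * norm x * K"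
              using K(1) by (intro mult_right_mono) auto
            then show "norm (M (s n u x)) \<le> K * (exp (K * (\<bar>t\<bar> + 1)) * norm x)"
              using K(2)[of "s n u x"] by (simp add: mult.commute)
          qed (auto intro: sder)
          then have "norm (s (Suc n) q x - s (Suc n) t x) * K
              \<le> (K * (exp (K * (\<bar>t\<bar> + 1)) * norm x)) * \<bar>q - t\<bar> * K"
            using K(1) by (intro mult_right_mono) auto
          then have "norm (M (s (Suc n) q x) - M (s (Suc n) t x)) \<le> (B - 1) * \<bar>q - t\<bar>"
            using K(2)[of "s (Suc n) q x - s (Suc n) t x"] by (simp add: M.diff B_def mult_ac)
          also have "\<dots> \<le> B * \<bar>r - t\<bar>"
            using B q K(1) by (intro mult_mono) (auto simp: closed_segment_eq_real_ivl split: if_splits)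
          finally show ?thesis .
        qed
        have "norm (s (Suc (Suc n)) r x - s (Suc (Suc n)) t x - (r - t) *\<^sub>R M (s (Suc n) t x))
            \<le> B * \<bar>r - t\<bar> * \<bar>r - t\<bar>" for n
          using vector_differentiable_bound_linearization[where S = "closed_segment t r"
              and f' = "\<lambda>u. M (s (Suc n) u x)" and ?x0.0 = t and a = t and b = r
              and f = "\<lambda>u. s (Suc (Suc n)) u x" and B = "B * \<bar>r - t\<bar>"] sder bound
          by (simp add: mult.commute)
        moreover have "(\<lambda>n. norm (s (Suc (Suc n)) r x - s (Suc (Suc n)) t x - (r - t) *\<^sub>R M (s (Suc n) t x)))
            \<longlonglongrightarrow> norm (E r x - E t x - (r - t) *\<^sub>R M (E t x))"
          by (intro tendsto_intros M.tendsto LIMSEQ_Suc lim)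
        ultimately show ?thesis by (intro LIMSEQ_le_const2) auto
      qed
      show "\<exists>\<delta>>0. \<forall>r\<in>UNIV. \<bar>r - t\<bar> < \<delta> \<longrightarrow> norm (E r x - E t x - (r - t) *\<^sub>R M (E t x)) \<le> e * \<bar>r - t\<bar>"
      proof (intro exI[of _ "min 1 (e / B)"] conjI ballI impI)
        show "0 < min 1 (e / B)" using e B by simp
        fix r assume r: "\<bar>r - t\<bar> < min 1 (e / B)"
        then have "B * \<bar>r - t\<bar> \<le> e" using B by (simp add: field_simps)
        then have "B * \<bar>r - t\<bar> * \<bar>r - t\<bar> \<le> e * \<bar>r - t\<bar>" by (rule mult_right_mono) simp
        then show "norm (E r x - E t x - (r - t) *\<^sub>R M (E t x)) \<le> e * \<bar>r - t\<bar>"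
          using main[of r] r by simp
      qed
    qed
    show "C (E t x) = E t (C x)" if C: "bounded_linear C" and com: "\<And>x. C (M x) = M (C x)" for C t x
    proof -
      interpret C: bounded_linear C by (rule C)
      have "C ((M ^^ k) x) = (M ^^ k) (C x)" for k by (induction k) (simp_all add: com)
      then have "C (s n t x) = s n t (C x)" for n by (simp add: s_def c_def C.sum C.scaleR)
      then show ?thesis using LIMSEQ_unique[OF C.tendsto[OF lim[of t x]]] lim[of t "C x"] by simp
    qed
  qed
qed


section \<open>Contraction semigroups of dissipative operators\<close>

text \<open>Here \<open>K\<close> is the inverse of the generator. Its range is the domain of the generator, and
  \<open>u t = T t (K x)\<close> is the solution that starts at \<open>K x\<close>, with derivative \<open>T t x\<close>.\<close>

locale contraction_flow =
  fixes K :: "'x::real_inner \<Rightarrow> 'x" and T :: "real \<Rightarrow> 'x \<Rightarrow> 'x"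
  assumes bounded_linear_K: "bounded_linear K"
    and linear_T: "0 \<le> t \<Longrightarrow> linear (T t)"
    and T_0: "T 0 x = x"
    and T_contraction: "0 \<le> t \<Longrightarrow> norm (T t x) \<le> norm x"
    and T_commute: "0 \<le> t \<Longrightarrow> T t (K x) = K (T t x)"
    and T_derivative: "0 \<le> t \<Longrightarrow> ((\<lambda>t. T t (K x)) has_vector_derivative T t x) (at t within {0..})"

text \<open>Dissipativity makes \<open>I - l J\<close> bounded below. The equation \<open>x - l J x = f\<close> is the fixed point equation of
  \<open>x \<mapsto> x - \<rho> (x - l J x - f)\<close>, a contraction for small \<open>\<rho>\<close>.\<close>

lemma dissipative_resolvent:
  fixes J :: "'x::{real_inner,complete_space} \<Rightarrow> 'x"
  assumes J: "bounded_linear J" and dis: "\<And>x. x \<bullet> J x \<le> 0" and l: "0 < (l::real)"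
  obtains P where "bounded_linear P" "\<And>x. norm (P x) \<le> norm x"
    "\<And>x. P x - l *\<^sub>R J (P x) = x"
    "\<And>C x. \<lbrakk>linear C; \<And>x. C (J x) = J (C x)\<rbrakk> \<Longrightarrow> C (P x) = P (C x)"
proof -
  interpret J: bounded_linear J by (rule J)
  obtain k where k: "k > 0" "\<And>x. norm (J x) \<le> norm x * k" using J.pos_bounded by blast
  have below: "norm x \<le> norm (x - l *\<^sub>R J x)" for x
  proof (cases "x = 0")
    case False
    have "(norm x)\<^sup>2 \<le> (norm x)\<^sup>2 - l * (x \<bullet> J x)" using dis[of x] l by (simp add: mult_nonneg_nonpos)
    also have "\<dots> = x \<bullet> (x - l *\<^sub>R J x)" by (simp add: inner_diff_right power2_norm_eq_inner)
    also have "\<dots> \<le> norm x * norm (x - l *\<^sub>R J x)" by (rule norm_cauchy_schwarz)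
    finally show ?thesis using False by (simp add: power2_eq_square)
  qed simp
  have inj: "x = y" if "x - l *\<^sub>R J x = y - l *\<^sub>R J y" for x y
  proof -
    have "(x - y) - l *\<^sub>R J (x - y) = 0" using that by (simp add: J.diff algebra_simps)
    then show ?thesis using below[of "x - y"] by simp
  qed
  \<comment> \<open>for \<open>\<parallel>J\<parallel> \<le> k\<close>, \<open>(1 - \<rho>)\<^sup>2 + \<rho>\<^sup>2 l\<^sup>2 k\<^sup>2 = 1 - 2 \<rho> + \<rho>\<^sup>2 a\<close>, which is \<open>1 - \<rho>\<close> if \<open>\<rho> a = 1\<close>\<close>
  define a where "a = 1 + l\<^sup>2 * k\<^sup>2"
  define \<rho> where "\<rho> = 1 / a"
  have a: "a > 1" using l k by (simp add: a_def)
  have \<rho>: "0 < \<rho>" "\<rho> < 1" "\<rho> * a = 1" using a by (simp_all add: \<rho>_def)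
  have step: "norm ((1 - \<rho>) *\<^sub>R x + (\<rho> * l) *\<^sub>R J x) \<le> sqrt (1 - \<rho>) * norm x" for x
  proof (rule power2_le_imp_le)
    have "(norm ((1 - \<rho>) *\<^sub>R x + (\<rho> * l) *\<^sub>R J x))\<^sup>2
        = (1 - \<rho>)\<^sup>2 * (norm x)\<^sup>2 + 2 * (\<rho> * l) * (1 - \<rho>) * (x \<bullet> J x) + (\<rho> * l)\<^sup>2 * (norm (J x))\<^sup>2"
      by (simp add: norm_add_scaleR_square power_mult_distrib)
    also have "\<dots> \<le> (1 - \<rho>)\<^sup>2 * (norm x)\<^sup>2 + 0 + (\<rho> * l)\<^sup>2 * (k\<^sup>2 * (norm x)\<^sup>2)"
    proof (intro add_mono order_refl mult_left_mono)
      show "2 * (\<rho> * l) * (1 - \<rho>) * (x \<bullet> J x) \<le> 0"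
        using \<rho> l dis[of x] by (intro mult_nonneg_nonpos) auto
      have "(norm (J x))\<^sup>2 \<le> (norm x * k)\<^sup>2" by (intro power_mono k) auto
      then show "(norm (J x))\<^sup>2 \<le> k\<^sup>2 * (norm x)\<^sup>2" by (simp add: power_mult_distrib mult.commute)
    qed auto
    also have "\<dots> = (1 - 2 * \<rho> + \<rho> * (\<rho> * a)) * (norm x)\<^sup>2"
      by (simp add: a_def power2_eq_square algebra_simps)
    also have "\<dots> = (1 - \<rho>) * (norm x)\<^sup>2" unfolding \<rho>(3) by simp
    also have "\<dots> = (sqrt (1 - \<rho>) * norm x)\<^sup>2" using \<rho> by (simp add: power_mult_distrib)
    finally show "(norm ((1 - \<rho>) *\<^sub>R x + (\<rho> * l) *\<^sub>R J x))\<^sup>2 \<le> (sqrt (1 - \<rho>) * norm x)\<^sup>2" .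
    show "0 \<le> sqrt (1 - \<rho>) * norm x" using \<rho> by simp
  qed
  have ex: "\<exists>x. x - l *\<^sub>R J x = f" for f
  proof -
    define g where "g x = (1 - \<rho>) *\<^sub>R x + (\<rho> * l) *\<^sub>R J x + \<rho> *\<^sub>R f" for x
    have "dist (g x) (g y) \<le> sqrt (1 - \<rho>) * dist x y" for x y
    proof -
      have "g x - g y = (1 - \<rho>) *\<^sub>R (x - y) + (\<rho> * l) *\<^sub>R J (x - y)"
        by (simp add: g_def J.diff scaleR_right_diff_distrib)
      then show ?thesis using step[of "x - y"] by (simp add: dist_norm)
    qed
    then have "\<exists>!x. g x = x" using \<rho> by (intro banach_fix_type[of "sqrt (1 - \<rho>)"]) auto
    then obtain x where "g x = x" by blast
    then have "\<rho> *\<^sub>R (x - l *\<^sub>R J x) = \<rho> *\<^sub>R f" by (simp add: g_def algebra_simps)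
    then show ?thesis using \<rho>(1) by (intro exI[of _ x]) simp
  qed
  then obtain P where P: "\<And>x. P x - l *\<^sub>R J (P x) = x" by metis
  have Pc: "norm (P x) \<le> norm x" for x using below[of "P x"] P[of x] by simp
  have bl: "bounded_linear P"
  proof (rule bounded_linear_intro[where K = 1])
    show "P (x + y) = P x + P y" for x y
    proof (rule inj)
      have "(P x + P y) - l *\<^sub>R J (P x + P y) = (P x - l *\<^sub>R J (P x)) + (P y - l *\<^sub>R J (P y))"
        by (simp add: J.add algebra_simps)
      then show "P (x + y) - l *\<^sub>R J (P (x + y)) = (P x + P y) - l *\<^sub>R J (P x + P y)" by (simp add: P)
    qed
    show "P (r *\<^sub>R x) = r *\<^sub>R P x" for r x
    proof (rule inj)
      have "r *\<^sub>R P x - l *\<^sub>R J (r *\<^sub>R P x) = r *\<^sub>R (P x - l *\<^sub>R J (P x))"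
        by (simp add: J.scaleR algebra_simps)
      then show "P (r *\<^sub>R x) - l *\<^sub>R J (P (r *\<^sub>R x)) = r *\<^sub>R P x - l *\<^sub>R J (r *\<^sub>R P x)" by (simp add: P)
    qed
  qed (use Pc in simp)
  show thesis
  proof (rule that[OF bl Pc P])
    fix C x assume C: "linear C" and com: "\<And>x. C (J x) = J (C x)"
    have "C (P x) - l *\<^sub>R J (C (P x)) = P (C x) - l *\<^sub>R J (P (C x))"
      using C P[of x] by (simp add: P linear_diff[symmetric] linear_scale[symmetric] com[symmetric])
    then show "C (P x) = P (C x)" by (rule inj)
  qed
qed

text \<open>Yosida approximation. With \<open>l = n + 1\<close> and \<open>P\<^sub>n = (I - l J)\<^sup>-\<^sup>1\<close>, the bounded dissipative operators
  \<open>A\<^sub>n = - l P\<^sub>n\<close> satisfy \<open>A\<^sub>n J = I - P\<^sub>n\<close>, and \<open>P\<^sub>n\<close> tends to 0 strongly: on the range of \<open>J\<close> because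
  \<open>l P\<^sub>n J = P\<^sub>n - I\<close> is bounded, and everywhere by density. So \<open>A\<^sub>n\<close> approximates the inverse of \<open>J\<close>, and the
  flows of \<open>A\<^sub>n\<close> converge.\<close>

lemma dissipative_generates_flow:
  fixes J :: "'x::{real_inner,complete_space} \<Rightarrow> 'x"
  assumes J: "bounded_linear J" and dis: "\<And>x. x \<bullet> J x \<le> 0" and dense: "closure (range J) = UNIV"
  obtains S where "contraction_flow J S"
proof -
  interpret J: bounded_linear J by (rule J)
  have dns: "\<exists>y. dist (J y) x < e" if "0 < e" for x e
    using dense closure_approachable[of x "range J"] that by auto
  have "\<exists>P. bounded_linear P \<and> (\<forall>x. norm (P x) \<le> norm x) \<and>
    (\<forall>x. P x - real (Suc n) *\<^sub>R J (P x) = x) \<and>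
    (\<forall>C x. linear C \<longrightarrow> (\<forall>x. C (J x) = J (C x)) \<longrightarrow> C (P x) = P (C x))" for n
  proof -
    have l: "0 < real (Suc n)" by simp
    show ?thesis
    proof (rule dissipative_resolvent[OF J dis l])
      fix Q assume Q: "bounded_linear Q" "\<And>x. norm (Q x) \<le> norm x"
        "\<And>x. Q x - real (Suc n) *\<^sub>R J (Q x) = x"
        "\<And>C x. \<lbrakk>linear C; \<And>x. C (J x) = J (C x)\<rbrakk> \<Longrightarrow> C (Q x) = Q (C x)"
      show ?thesis by (intro exI[of _ Q] conjI allI impI Q) simp_all
    qed
  qed
  then obtain P where P: "\<And>n. bounded_linear (P n)" "\<And>n x. norm (P n x) \<le> norm x"
    "\<And>n x. P n x - real (Suc n) *\<^sub>R J (P n x) = x"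
    "\<And>n C x. linear C \<Longrightarrow> (\<And>x. C (J x) = J (C x)) \<Longrightarrow> C (P n x) = P n (C x)"
    by metis
  have PJ: "P n (J x) = J (P n x)" for n x
    using P(4)[of J n x] J.linear_axioms by simp
  have PP: "P n (P m x) = P m (P n x)" for n m x
    using P(4)[of "P n" m x] P(1)[of n] PJ by (simp add: bounded_linear.linear)
  define A where "A n x = - real (Suc n) *\<^sub>R P n x" for n x
  have blA: "bounded_linear (A n)" for n
    unfolding A_def by (intro bounded_linear_compose[OF bounded_linear_scaleR_right] P)
  have AJ: "A n (J x) = x - P n x" for n x
    using P(3)[of n x] by (simp add: A_def PJ algebra_simps)
  have Adis: "x \<bullet> A n x \<le> 0" for n x
  proof -
    have "x \<bullet> P n x = (norm (P n x))\<^sup>2 - real (Suc n) * (P n x \<bullet> J (P n x))"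
    proof -
      have "x \<bullet> P n x = (P n x - real (Suc n) *\<^sub>R J (P n x)) \<bullet> P n x" by (simp only: P(3))
      also have "\<dots> = P n x \<bullet> P n x - real (Suc n) * (P n x \<bullet> J (P n x))"
        by (simp only: inner_diff_left inner_scaleR_left inner_commute[of "J (P n x)"])
      finally show ?thesis by (simp only: power2_norm_eq_inner)
    qed
    moreover have "real (Suc n) * (P n x \<bullet> J (P n x)) \<le> 0"
      by (intro mult_nonneg_nonpos dis) simp
    ultimately have "0 \<le> x \<bullet> P n x" by (smt (verit) zero_le_power2)
    then have "0 \<le> real (Suc n) * (x \<bullet> P n x)" by (intro mult_nonneg_nonneg) auto
    then show ?thesis by (simp only: A_def inner_scaleR_right mult_minus_left neg_le_0_iff_le)
  qed
  have "\<exists>E. (\<forall>t. linear (E t)) \<and> (\<forall>x. E 0 x = x) \<and>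
    (\<forall>t x. ((\<lambda>t. E t x) has_vector_derivative A n (E t x)) (at t)) \<and>
    (\<forall>C t x. bounded_linear C \<longrightarrow> (\<forall>x. C (A n x) = A n (C x)) \<longrightarrow> C (E t x) = E t (C x))" for n
  proof (rule exp_flow[OF blA[of n]])
    fix F :: "real \<Rightarrow> 'x \<Rightarrow> 'x"
    assume F: "\<And>t. linear (F t)" "\<And>x. F 0 x = x"
      "\<And>t x. ((\<lambda>t. F t x) has_vector_derivative A n (F t x)) (at t)"
      "\<And>C t x. \<lbrakk>bounded_linear C; \<And>x. C (A n x) = A n (C x)\<rbrakk> \<Longrightarrow> C (F t x) = F t (C x)"
    show ?thesis by (intro exI[of _ F] conjI allI impI F) simp_all
  qed
  then obtain E :: "nat \<Rightarrow> real \<Rightarrow> 'x \<Rightarrow> 'x" where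
    E: "\<And>n t. linear (E n t)" "\<And>n x. E n 0 x = x"
    "\<And>n t x. ((\<lambda>t. E n t x) has_vector_derivative A n (E n t x)) (at t)"
    "\<And>n C t x. bounded_linear C \<Longrightarrow> (\<And>x. C (A n x) = A n (C x)) \<Longrightarrow> C (E n t x) = E n t (C x)"
    by metis
  have AA: "A m (E n t x) = E n t (A m x)" for m n t x
    using E(4)[OF blA[of m]] P(1) by (simp add: A_def PP bounded_linear.linear linear_scale)
  have JE: "J (E n t x) = E n t (J x)" for n t x
    using E(4)[OF J] by (simp add: A_def PJ J.scaleR)
  have Ec: "norm (E n t x) \<le> norm x" if t: "0 \<le> t" for n t x
  proof -
    have "norm (E n t x) \<le> norm (E n 0 x) + 0 * (t - 0)"
    proof (rule norm_growth_bound[OF t])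
      show "((\<lambda>t. E n t x) has_vector_derivative A n (E n s x)) (at s within {0..t})" for s
        using E(3) has_vector_derivative_at_within by blast
      show "E n s x \<bullet> A n (E n s x) \<le> 0 * norm (E n s x)" for s using Adis by simp
    qed simp
    then show ?thesis by (simp add: E(2))
  qed
  have Pzero: "(\<lambda>n. P n x) \<longlonglongrightarrow> 0" for x
  proof (rule LIMSEQ_I)
    fix r :: real assume r: "0 < r"
    obtain y where y: "dist (J y) x < r / 2"
      using dns[of "r / 2" x] r by auto
    obtain N where N: "real N > 4 * norm y / r" using reals_Archimedean2 by blast
    show "\<exists>N. \<forall>n\<ge>N. norm (P n x - 0) < r"
    proof (intro exI allI impI)
      fix n assume n: "N \<le> n"
      have "real (Suc n) *\<^sub>R P n (J y) = P n y - y" using P(3)[of n y] by (simp add: PJ algebra_simps)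
      then have "real (Suc n) * norm (P n (J y)) = norm (P n y - y)"
        by (metis abs_of_nat norm_scaleR)
      also have "\<dots> \<le> 2 * norm y" using P(2)[of n y] norm_triangle_ineq4[of "P n y" y] by linarith
      also have "\<dots> < real (Suc n) * (r / 2)"
      proof -
        have "4 * norm y / r < real (Suc n)" using N n by linarith
        then show ?thesis using r by (simp add: field_simps)
      qed
      finally have 1: "norm (P n (J y)) < r / 2" by (simp only: mult_less_cancel_left_pos of_nat_0_less_iff zero_less_Suc)
      have "norm (P n (x - J y)) < r / 2" using P(2)[of n "x - J y"] y by (simp add: dist_norm norm_minus_commute)
      moreover have "P n x = P n (x - J y) + P n (J y)"
        using P(1)[of n] by (simp add: bounded_linear.linear linear_diff)
      ultimately show "norm (P n x - 0) < r" using 1 norm_triangle_ineq[of "P n (x - J y)" "P n (J y)"]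
        by simp
    qed
  qed
  \<comment> \<open>the flows differ on \<open>J w\<close> by at most \<open>t\<close> times the difference of their generators there\<close>
  have diff: "norm (E n t (J w) - E m t (J w)) \<le> (norm (P n w) + norm (P m w)) * t" if t: "0 \<le> t" for n m t w
  proof -
    let ?d = "\<lambda>t. E n t (J w) - E m t (J w)"
    have "norm (?d t) \<le> norm (?d 0) + (norm (P n w) + norm (P m w)) * (t - 0)"
    proof (rule norm_growth_bound[OF t, where d' = "\<lambda>s. A n (E n s (J w)) - A m (E m s (J w))"])
      fix s assume s: "s \<in> {0..t}"
      show "(?d has_vector_derivative A n (E n s (J w)) - A m (E m s (J w))) (at s within {0..t})"
        by (intro has_vector_derivative_diff) (use E(3) has_vector_derivative_at_within in blast)+
      have "A n (E n s (J w)) - A m (E m s (J w)) = A n (?d s) + E m s (P m w - P n w)"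
        by (simp add: AA AJ bounded_linear.linear[OF blA] linear_diff E(1))
      then have "?d s \<bullet> (A n (E n s (J w)) - A m (E m s (J w)))
          = ?d s \<bullet> A n (?d s) + ?d s \<bullet> E m s (P m w - P n w)" by (simp add: inner_add_right)
      also have "\<dots> \<le> 0 + norm (?d s) * norm (E m s (P m w - P n w))"
        by (intro add_mono Adis norm_cauchy_schwarz)
      also have "\<dots> \<le> norm (?d s) * (norm (P n w) + norm (P m w))"
      proof -
        have "norm (E m s (P m w - P n w)) \<le> norm (P m w - P n w)" using s by (intro Ec) auto
        also have "\<dots> \<le> norm (P n w) + norm (P m w)" using norm_triangle_ineq4[of "P m w" "P n w"] by linarith
        finally show ?thesis by (simp add: mult_left_mono)
      qed
      finally show "?d s \<bullet> (A n (E n s (J w)) - A m (E m s (J w))) \<le> (norm (P n w) + norm (P m w)) * norm (?d s)"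
        by (simp only: mult.commute)
    qed simp
    then show ?thesis by (simp add: E(2))
  qed
  have "Cauchy (\<lambda>n. E n t x)" if t: "0 \<le> t" for t x
  proof (rule metric_CauchyI)
    fix e :: real assume e: "0 < e"
    obtain w where w: "dist (J w) x < e / 4"
      using dns[of "e / 4" x] e by auto
    define d where "d = e / (4 * (t + 1))"
    have d: "d > 0" using e t by (simp add: d_def)
    have dt: "d * t \<le> e / 4" using e t by (simp add: d_def field_simps)
    obtain N where N: "\<And>n. n \<ge> N \<Longrightarrow> norm (P n w) < d"
      using LIMSEQ_D[OF Pzero[of w] d] by auto
    have "dist (E n t x) (E m t x) < e" if nm: "N \<le> n" "N \<le> m" for n m
    proof -
      have "norm (E n t (J w) - E m t (J w)) \<le> (d + d) * t"
        using diff[OF t, of n w m] N[OF nm(1)] N[OF nm(2)] t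
        by (intro order_trans[OF diff[OF t] mult_right_mono]) auto
      then have 1: "norm (E n t (J w) - E m t (J w)) \<le> e / 2" using dt by (simp add: algebra_simps)
      have 2: "norm (E k t (x - J w)) < e / 4" for k
        using Ec[OF t, of k "x - J w"] w by (simp add: dist_norm norm_minus_commute)
      have "E n t x - E m t x = E n t (x - J w) + (E n t (J w) - E m t (J w)) - E m t (x - J w)"
        by (simp add: linear_diff E(1))
      then show ?thesis
        using 1 2[of n] 2[of m] norm_triangle_ineq4[of "E n t (x - J w) + (E n t (J w) - E m t (J w))" "E m t (x - J w)"]
          norm_triangle_ineq[of "E n t (x - J w)" "E n t (J w) - E m t (J w)"]
        by (simp add: dist_norm)
    qed
    then show "\<exists>N. \<forall>n\<ge>N. \<forall>m\<ge>N. dist (E n t x) (E m t x) < e" by blast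
  qed
  then have "\<exists>l. 0 \<le> t \<longrightarrow> (\<lambda>n. E n t x) \<longlonglongrightarrow> l" for t x
    using Cauchy_convergent convergent_def by blast
  then obtain S where S: "\<And>t x. 0 \<le> t \<Longrightarrow> (\<lambda>n. E n t x) \<longlonglongrightarrow> S t x" by metis
  show thesis
  proof (rule that[of S], rule contraction_flow.intro)
    show "bounded_linear J" by fact
    show "linear (S t)" if t: "0 \<le> t" for t
    proof (rule linearI)
      show "S t (x + y) = S t x + S t y" for x y
        using LIMSEQ_unique[OF S[OF t, of "x + y"]] tendsto_add[OF S[OF t, of x] S[OF t, of y]]
        by (simp add: linear_add[OF E(1)])
      show "S t (r *\<^sub>R x) = r *\<^sub>R S t x" for r x
        using LIMSEQ_unique[OF S[OF t, of "r *\<^sub>R x"]] tendsto_scaleR[OF tendsto_const S[OF t, of x], of r]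
        by (simp add: linear_scale[OF E(1)])
    qed
    show "S 0 x = x" for x using S[of 0 x] by (simp add: E(2) LIMSEQ_const_iff)
    show "norm (S t x) \<le> norm x" if t: "0 \<le> t" for t x
      by (rule LIMSEQ_le_const2[OF tendsto_norm[OF S[OF t]]]) (use Ec[OF t] in blast)
    show "S t (J x) = J (S t x)" if t: "0 \<le> t" for t x
      using LIMSEQ_unique[OF S[OF t, of "J x"]] J.tendsto[OF S[OF t, of x]] by (simp add: JE)
    fix t :: real and x assume t: "0 \<le> t"
    show "((\<lambda>t. S t (J x)) has_vector_derivative S t x) (at t within {0..})"
    proof (rule has_vector_derivative_epsilon)
      fix e :: real assume e: "0 < e"
      obtain w where w: "dist (J w) x < e / 4"
        using dns[of "e / 4" x] e by auto
      \<comment> \<open>\<open>x\<close> is replaced by \<open>J w\<close>, where the flows are Lipschitz in time uniformly in \<open>n\<close>\<close>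
      have main: "norm (S s (J x) - S t (J x) - (s - t) *\<^sub>R S t x) \<le> \<bar>s - t\<bar> * (e / 2 + 2 * norm w * \<bar>s - t\<bar>)"
        if s: "0 \<le> s" for s
      proof -
        have seg: "0 \<le> q \<and> \<bar>q - t\<bar> \<le> \<bar>s - t\<bar>" if "q \<in> closed_segment t s" for q
          using that s t by (auto simp: closed_segment_eq_real_ivl split: if_splits)
        have mv: "norm (E n q (J w) - E n t (J w)) \<le> (2 * norm w) * \<bar>q - t\<bar>"
          if q: "q \<in> closed_segment t s" for n q
        proof (rule vector_mean_value_bound[where S = "closed_segment t s" and f' = "\<lambda>u. E n u (w - P n w)"])
          show "closed_segment t q \<subseteq> closed_segment t s" using q by (simp add: subset_closed_segment)
          fix u assume u: "u \<in> closed_segment t s"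
          show "((\<lambda>u. E n u (J w)) has_vector_derivative E n u (w - P n w)) (at u within closed_segment t s)"
            using E(3)[of n "J w" u] by (simp add: AA AJ has_vector_derivative_at_within)
          show "norm (E n u (w - P n w)) \<le> 2 * norm w"
            using Ec[of u n "w - P n w"] seg[OF u] norm_triangle_ineq4[of w "P n w"] P(2)[of n w] by linarith
        qed
        have "norm (E n s (J x) - E n t (J x) - (s - t) *\<^sub>R E n t (x - P n x))
            \<le> norm (s - t) * (e / 2 + 2 * norm w * \<bar>s - t\<bar> + 2 * norm (P n x))" for n
        proof (rule vector_differentiable_bound_linearization[where S = "closed_segment t s"
              and f' = "\<lambda>u. E n u (x - P n x)"])
          fix u assume u: "u \<in> closed_segment t s"
          show "((\<lambda>u. E n u (J x)) has_vector_derivative E n u (x - P n x)) (at u within closed_segment t s)"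
            using E(3)[of n "J x" u] by (simp add: AA AJ has_vector_derivative_at_within)
          have 1: "norm (E n q (x - J w)) \<le> e / 4" "norm (E n q (P n x)) \<le> norm (P n x)"
            if "q \<in> closed_segment t s" for q
            using Ec[of q n "x - J w"] Ec[of q n "P n x"] w seg[OF that]
            by (auto simp: dist_norm norm_minus_commute)
          have split: "E n u (x - P n x) - E n t (x - P n x)
              = (E n u (x - J w) - E n t (x - J w)) + (E n u (J w) - E n t (J w)) - (E n u (P n x) - E n t (P n x))"
            by (simp add: linear_diff E(1))
          have "norm (E n u (x - P n x) - E n t (x - P n x))
              \<le> norm (E n u (x - J w)) + norm (E n t (x - J w)) + norm (E n u (J w) - E n t (J w))
                + (norm (E n u (P n x)) + norm (E n t (P n x)))"
            unfolding split
            using norm_triangle_ineq4[of "(E n u (x - J w) - E n t (x - J w)) + (E n u (J w) - E n t (J w))"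
                "E n u (P n x) - E n t (P n x)"]
              norm_triangle_ineq[of "E n u (x - J w) - E n t (x - J w)" "E n u (J w) - E n t (J w)"]
              norm_triangle_ineq4[of "E n u (x - J w)" "E n t (x - J w)"]
              norm_triangle_ineq4[of "E n u (P n x)" "E n t (P n x)"]
            by linarith
          also have "\<dots> \<le> e / 4 + e / 4 + 2 * norm w * \<bar>s - t\<bar> + (norm (P n x) + norm (P n x))"
          proof (intro add_mono 1 u)
            have "2 * norm w * \<bar>u - t\<bar> \<le> 2 * norm w * \<bar>s - t\<bar>" using seg[OF u] by (intro mult_left_mono) auto
            then show "norm (E n u (J w) - E n t (J w)) \<le> 2 * norm w * \<bar>s - t\<bar>" using mv[OF u, of n] by linarith
          qed auto
          finally show "norm (E n u (x - P n x) - E n t (x - P n x)) \<le> e / 2 + 2 * norm w * \<bar>s - t\<bar> + 2 * norm (P n x)"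
            by simp
        qed auto
        moreover have "(\<lambda>n. norm (E n s (J x) - E n t (J x) - (s - t) *\<^sub>R E n t (x - P n x)))
            \<longlonglongrightarrow> norm (S s (J x) - S t (J x) - (s - t) *\<^sub>R S t x)"
        proof (intro tendsto_intros S s t)
          have "(\<lambda>n. E n t (P n x)) \<longlonglongrightarrow> 0"
            by (rule Lim_null_comparison[OF always_eventually tendsto_norm_zero[OF Pzero[of x]]])
              (use Ec[OF t] in blast)
          then show "(\<lambda>n. E n t (x - P n x)) \<longlonglongrightarrow> S t x"
            using tendsto_diff[OF S[OF t, of x]] by (fastforce simp: linear_diff[OF E(1)])
        qed
        moreover have "(\<lambda>n. norm (s - t) * (e / 2 + 2 * norm w * \<bar>s - t\<bar> + 2 * norm (P n x)))
            \<longlonglongrightarrow> norm (s - t) * (e / 2 + 2 * norm w * \<bar>s - t\<bar> + 2 * 0)"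
          by (intro tendsto_intros tendsto_norm_zero Pzero)
        ultimately show ?thesis using LIMSEQ_le by fastforce
      qed
      show "\<exists>\<delta>>0. \<forall>s\<in>{0..}. \<bar>s - t\<bar> < \<delta> \<longrightarrow> norm (S s (J x) - S t (J x) - (s - t) *\<^sub>R S t x) \<le> e * \<bar>s - t\<bar>"
      proof (intro exI[of _ "e / (4 * (norm w + 1))"] conjI ballI impI)
        show "0 < e / (4 * (norm w + 1))" using e by (simp add: add_nonneg_pos)
        fix s assume s: "s \<in> {0..}" "\<bar>s - t\<bar> < e / (4 * (norm w + 1))"
        have p: "4 * (norm w + 1) > 0" by (smt (verit) norm_ge_zero)
        have "\<bar>s - t\<bar> * (4 * (norm w + 1)) < e" using s(2) by (simp only: pos_less_divide_eq[OF p])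
        then have "4 * \<bar>s - t\<bar> + 4 * (norm w * \<bar>s - t\<bar>) < e" by (simp add: algebra_simps)
        then have "e / 2 + 2 * (norm w * \<bar>s - t\<bar>) \<le> e"
        proof -
          have "e / 2 + 2 * b \<le> e" if "4 * a + 4 * b < e" "0 \<le> a" for a b :: real using that by linarith
          then show ?thesis using \<open>4 * \<bar>s - t\<bar> + 4 * (norm w * \<bar>s - t\<bar>) < e\<close> abs_ge_zero by blast
        qed
        then have "e / 2 + 2 * norm w * \<bar>s - t\<bar> \<le> e" by (simp only: mult.assoc)
        then have "\<bar>s - t\<bar> * (e / 2 + 2 * norm w * \<bar>s - t\<bar>) \<le> \<bar>s - t\<bar> * e" by (rule mult_left_mono) simp
        then show "norm (S s (J x) - S t (J x) - (s - t) *\<^sub>R S t x) \<le> e * \<bar>s - t\<bar>"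
          using main[of s] s(1) by (simp add: mult.commute)
      qed
    qed
  qed
qed


text \<open>Otherwise there are times tending to 0 at which the operator norms are unbounded, although the
  operators converge strongly to the identity along them.\<close>

lemma semigroup_locally_bounded:
  fixes T :: "real \<Rightarrow> 'x::{real_normed_vector,complete_space} \<Rightarrow> 'x"
  assumes lin: "\<And>t. 0 \<le> t \<Longrightarrow> bounded_linear (T t)" and T0: "\<And>x. T 0 x = x"
    and cont: "\<And>x. ((\<lambda>h. T h x) \<longlongrightarrow> x) (at_right 0)"
  obtains d B where "d > 0" "B \<ge> 1" "\<And>t x. 0 \<le> t \<Longrightarrow> t \<le> d \<Longrightarrow> norm (T t x) \<le> B * norm x"
proof -
  have "\<exists>n::nat. \<forall>t x. 0 \<le> t \<longrightarrow> t \<le> 1 / real (Suc n) \<longrightarrow> norm (T t x) \<le> real n * norm x"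
  proof (rule ccontr)
    assume "\<not> ?thesis"
    then have "\<forall>n::nat. \<exists>t x. 0 \<le> t \<and> t \<le> 1 / real (Suc n) \<and> real n * norm x < norm (T t x)"
      by (meson not_le)
    then obtain t y where t: "\<And>n::nat. 0 \<le> t n" "\<And>n. t n \<le> 1 / real (Suc n)"
      "\<And>n. real n * norm (y n) < norm (T (t n) (y n))" by metis
    have conv: "(\<lambda>n. T (t n) x) \<longlonglongrightarrow> x" for x
    proof (rule metric_LIMSEQ_I)
      fix r :: real assume r: "0 < r"
      have "\<forall>\<^sub>F h in at_right 0. dist (T h x) x < r" using cont[of x] r by (rule tendstoD)
      then obtain b where b: "b > 0" "\<And>h. 0 < h \<Longrightarrow> h < b \<Longrightarrow> dist (T h x) x < r"
        by (auto simp: eventually_at_right_field)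
      obtain N where N: "1 / b < real N" using reals_Archimedean2 by blast
      have "dist (T (t n) x) x < r" if n: "N \<le> n" for n
      proof (cases "t n = 0")
        case False
        have "1 / b < real (Suc n)" using N n by linarith
        then have "1 / real (Suc n) < b" using b(1) by (simp add: field_simps)
        then have "t n < b" using t(2)[of n] by linarith
        then show ?thesis using b(2) False t(1)[of n] by simp
      qed (simp add: T0 r)
      then show "\<exists>N. \<forall>n\<ge>N. dist (T (t n) x) x < r" by blast
    qed
    have "\<exists>K. \<forall>n. norm (T (t n) x) \<le> K" for x
      using convergent_imp_Bseq[of "\<lambda>n. T (t n) x"] conv[of x] by (auto simp: convergent_def Bseq_def)
    then obtain K where K: "\<And>n x. norm (T (t n) x) \<le> K * norm x"
      using banach_steinhaus_sequence[of "\<lambda>n. T (t n)"] lin t(1) by blast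
    obtain n where n: "K \<le> real n" using real_arch_simple by blast
    have "K * norm (y n) \<le> real n * norm (y n)" using n by (rule mult_right_mono) simp
    then show False using K[of n "y n"] t(3)[of n] by linarith
  qed
  then obtain n :: nat where n: "\<And>t x. 0 \<le> t \<Longrightarrow> t \<le> 1 / real (Suc n) \<Longrightarrow> norm (T t x) \<le> real n * norm x"
    by blast
  show thesis
  proof (rule that[of "1 / real (Suc n)" "real n + 1"])
    fix t x assume "0 \<le> t" "t \<le> 1 / real (Suc n)"
    then have "norm (T t x) \<le> real n * norm x" by (rule n)
    then show "norm (T t x) \<le> (real n + 1) * norm x" by (simp add: distrib_right add_increasing2)
  qed auto
qed

text \<open>Local boundedness makes the right derivative at the origin a two sided derivative at later times.
  The energy of a differentiable orbit decreases, and these orbits are dense.\<close>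

lemma contraction_flow_of_semigroup:
  fixes T :: "real \<Rightarrow> 'x::{real_inner,complete_space} \<Rightarrow> 'x"
  assumes lin: "\<And>t. 0 \<le> t \<Longrightarrow> bounded_linear (T t)" and T0: "\<And>x. T 0 x = x"
    and semi: "\<And>s t x. 0 \<le> s \<Longrightarrow> 0 \<le> t \<Longrightarrow> T (s + t) x = T s (T t x)"
    and cont: "\<And>x. ((\<lambda>h. T h x) \<longlongrightarrow> x) (at_right 0)"
    and gen: "\<And>x y. x = K y \<longleftrightarrow> ((\<lambda>h. (1 / h) *\<^sub>R (T h x - x)) \<longlongrightarrow> y) (at_right 0)"
    and K: "bounded_linear K" and dis: "\<And>x. x \<bullet> K x \<le> 0" and dense: "closure (range K) = UNIV"
  shows "contraction_flow K T"
proof -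
  obtain d B where dB: "d > 0" "B \<ge> 1" "\<And>t x. 0 \<le> t \<Longrightarrow> t \<le> d \<Longrightarrow> norm (T t x) \<le> B * norm x"
    using semigroup_locally_bounded[OF lin T0 cont] by blast
  have pow: "norm (T t x) \<le> B ^ Suc n * norm x" if "0 \<le> t" "t \<le> real (Suc n) * d" for t x n
    using that
  proof (induction n arbitrary: t x)
    case 0 then show ?case using dB(3) by simp
  next
    case (Suc n)
    show ?case
    proof (cases "t \<le> d")
      case True
      have "norm (T t x) \<le> B * norm x" using dB(3) Suc.prems True by blast
      also have "\<dots> \<le> B ^ Suc (Suc n) * norm x"
        using dB(2) one_le_power[OF dB(2), of "Suc n"] by (intro mult_right_mono) auto
      finally show ?thesis .
    next
      case False
      have "T t x = T (t - d) (T d x)" using semi[of "t - d" d x] False dB(1) by simp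
      also have "norm \<dots> \<le> B ^ Suc n * norm (T d x)"
        using False Suc.prems by (intro Suc.IH) (auto simp: algebra_simps)
      also have "\<dots> \<le> B ^ Suc n * (B * norm x)" using dB by (intro mult_left_mono) auto
      finally show ?thesis by (simp add: mult_ac)
    qed
  qed
  have bound: "\<exists>C>0. \<forall>s x. 0 \<le> s \<longrightarrow> s \<le> t \<longrightarrow> norm (T s x) \<le> C * norm x" for t
  proof -
    obtain n where n: "t / d < real n" using reals_Archimedean2 by blast
    then have "t \<le> real (Suc n) * d" using dB(1) by (simp add: field_simps)
    then show ?thesis using pow[of _ n] dB(2)
      by (intro exI[of _ "B ^ Suc n"]) (auto intro: order_trans)
  qed
  have commute: "T t (K y) = K (T t y)" if t: "0 \<le> t" for t y
  proof -
    interpret Tt: bounded_linear "T t" by (rule lin[OF t])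
    have "((\<lambda>h. (1 / h) *\<^sub>R (T h (K y) - K y)) \<longlongrightarrow> y) (at_right 0)" using gen by blast
    then have "((\<lambda>h. T t ((1 / h) *\<^sub>R (T h (K y) - K y))) \<longlongrightarrow> T t y) (at_right 0)" by (rule Tt.tendsto)
    moreover have "\<forall>\<^sub>F h in at_right 0. T t ((1 / h) *\<^sub>R (T h (K y) - K y))
        = (1 / h) *\<^sub>R (T h (T t (K y)) - T t (K y))"
      unfolding eventually_at_right_field
    proof (intro exI[of _ 1] conjI allI impI)
      fix h :: real assume "0 < h"
      then have "T t (T h (K y)) = T h (T t (K y))" using semi[of t h "K y"] semi[of h t "K y"] t
        by (simp add: add.commute)
      then show "T t ((1 / h) *\<^sub>R (T h (K y) - K y)) = (1 / h) *\<^sub>R (T h (T t (K y)) - T t (K y))"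
        by (simp only: Tt.scaleR Tt.diff)
    qed simp
    ultimately have "((\<lambda>h. (1 / h) *\<^sub>R (T h (T t (K y)) - T t (K y))) \<longlongrightarrow> T t y) (at_right 0)"
      by (rule Lim_transform_eventually)
    then show ?thesis using gen by blast
  qed
  have deriv: "((\<lambda>t. T t (K y)) has_vector_derivative T t y) (at t within {0..})" if t: "0 \<le> t" for t y
  proof (rule has_vector_derivative_epsilon)
    fix e :: real assume e: "0 < e"
    obtain C where C: "C > 0" "\<And>s x. 0 \<le> s \<Longrightarrow> s \<le> t \<Longrightarrow> norm (T s x) \<le> C * norm x" using bound by blast
    define q where "q h = (1 / h) *\<^sub>R (T h (K y) - K y) - y" for h
    have "((\<lambda>h. (1 / h) *\<^sub>R (T h (K y) - K y)) \<longlongrightarrow> y) (at_right 0)" using gen by blast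
    then have "((\<lambda>h. norm (q h) + norm (T h y - y)) \<longlongrightarrow> norm (y - y) + norm (y - y)) (at_right 0)"
      unfolding q_def by (intro tendsto_intros cont)
    then have "\<forall>\<^sub>F h in at_right 0. norm (q h) + norm (T h y - y) < e / C"
      using e C(1) by (intro order_tendstoD(2)) auto
    then obtain b where b: "b > 0" "\<And>h. 0 < h \<Longrightarrow> h < b \<Longrightarrow> norm (q h) + norm (T h y - y) < e / C"
      by (auto simp: eventually_at_right_field)
    have Tq: "T h (K y) - K y = h *\<^sub>R (y + q h)" if "0 < h" for h
      using that by (simp add: q_def)
    show "\<exists>\<delta>>0. \<forall>s\<in>{0..}. \<bar>s - t\<bar> < \<delta> \<longrightarrow> norm (T s (K y) - T t (K y) - (s - t) *\<^sub>R T t y) \<le> e * \<bar>s - t\<bar>"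
    proof (intro exI[of _ b] conjI ballI impI b(1))
      fix s assume s: "s \<in> {0..}" "\<bar>s - t\<bar> < b"
      have final: "norm (h *\<^sub>R T r v) \<le> e * h" if h: "0 < h" "h < b" and r: "0 \<le> r" "r \<le> t"
        and v: "norm v \<le> norm (q h) + norm (T h y - y)" for h r v
      proof -
        have "norm (T r v) \<le> C * norm v" using C(2) r by blast
        also have "\<dots> \<le> C * (e / C)" using b(2)[OF h] v C(1) by (intro mult_left_mono) auto
        also have "\<dots> = e" using C(1) by simp
        finally show ?thesis using h(1) by (simp add: mult.commute[of e])
      qed
      consider "s = t" | "t < s" | "s < t" by linarith
      then show "norm (T s (K y) - T t (K y) - (s - t) *\<^sub>R T t y) \<le> e * \<bar>s - t\<bar>"
      proof cases
        case 2
        interpret Tt: bounded_linear "T t" by (rule lin[OF t])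
        have "T s (K y) = T t (T (s - t) (K y))" using semi[of t "s - t" "K y"] 2 t by simp
        also have "\<dots> - T t (K y) = T t (T (s - t) (K y) - K y)" by (simp add: Tt.diff)
        also have "\<dots> - (s - t) *\<^sub>R T t y = (s - t) *\<^sub>R T t (q (s - t))"
          using 2 by (simp add: Tq Tt.scaleR Tt.add scaleR_right_distrib)
        finally show ?thesis using final[of "s - t" t "q (s - t)"] 2 s t by simp
      next
        case 3
        have s0: "0 \<le> s" using s(1) by simp
        interpret Ts: bounded_linear "T s" by (rule lin[OF s0])
        define h where "h = t - s"
        have h: "0 < h" "h < b" using 3 s(2) by (auto simp: h_def)
        have tt: "T t x = T s (T h x)" for x using semi[of s h x] s0 h by (simp add: h_def)
        have "T s (K y) - T t (K y) - (s - t) *\<^sub>R T t y = T s (K y) - T s (T h (K y)) + h *\<^sub>R T s (T h y)"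
          by (simp add: tt h_def[symmetric]) (simp add: h_def algebra_simps)
        also have "\<dots> = T s (h *\<^sub>R T h y - (T h (K y) - K y))"
          by (simp add: Ts.diff Ts.scaleR)
        also have "\<dots> = h *\<^sub>R T s ((T h y - y) - q h)"
          using h(1) by (simp add: Tq Ts.scaleR[symmetric] algebra_simps)
        finally show ?thesis
          using final[of h s "(T h y - y) - q h"] h 3 s0 norm_triangle_ineq4[of "T h y - y" "q h"]
          by (simp add: h_def abs_if)
      qed simp
    qed
  qed
  have contr: "norm (T t x) \<le> norm x" if t: "0 \<le> t" for t x
  proof -
    interpret Tt: bounded_linear "T t" by (rule lin[OF t])
    have "norm (T t (K y)) \<le> norm (K y)" for y
    proof -
      have "norm (T t (K y)) \<le> norm (T 0 (K y)) + 0 * (t - 0)"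
      proof (rule norm_growth_bound[OF t])
        fix s assume s: "s \<in> {0..t}"
        show "((\<lambda>t. T t (K y)) has_vector_derivative T s y) (at s within {0..t})"
          by (rule has_vector_derivative_within_subset[OF deriv]) (use s in auto)
        show "T s (K y) \<bullet> T s y \<le> 0 * norm (T s (K y))"
          using s dis[of "T s y"] by (simp add: commute inner_commute)
      qed simp
      then show ?thesis by (simp add: T0)
    qed
    moreover have "closed {x. norm (T t x) \<le> norm x}"
      by (intro closed_Collect_le continuous_intros Tt.continuous_on)
    ultimately have "closure (range K) \<subseteq> {x. norm (T t x) \<le> norm x}" by (intro closure_minimal) auto
    then show ?thesis using dense by auto
  qed
  show ?thesis
    by (rule contraction_flow.intro) (use K lin T0 contr commute deriv in \<open>auto simp: bounded_linear.linear\<close>)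
qed

text \<open>The difference of the two flows at \<open>K x\<close> starts at 0, and its norm does not grow.\<close>

lemma contraction_flow_unique:
  fixes K :: "'x::real_inner \<Rightarrow> 'x"
  assumes "contraction_flow K T" "contraction_flow K T'" and dis: "\<And>x. x \<bullet> K x \<le> 0"
    and inj: "inj K" and t: "0 \<le> t"
  shows "T t x = T' t x"
proof -
  interpret T: contraction_flow K T by fact
  interpret T': contraction_flow K T' by fact
  interpret K: bounded_linear K by (rule T.bounded_linear_K)
  have "norm (T t (K x) - T' t (K x)) \<le> norm (T 0 (K x) - T' 0 (K x)) + 0 * (t - 0)"
  proof (rule norm_growth_bound[OF t])
    fix s assume s: "s \<in> {0..t}"
    show "((\<lambda>t. T t (K x) - T' t (K x)) has_vector_derivative (T s x - T' s x)) (at s within {0..t})"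
      by (intro has_vector_derivative_diff has_vector_derivative_within_subset[OF T.T_derivative]
          has_vector_derivative_within_subset[OF T'.T_derivative]) (use s in auto)
    show "(T s (K x) - T' s (K x)) \<bullet> (T s x - T' s x) \<le> 0 * norm (T s (K x) - T' s (K x))"
      using s dis[of "T s x - T' s x"] by (simp add: T.T_commute T'.T_commute K.diff[symmetric] inner_commute)
  qed simp
  then have "K (T t x) = K (T' t x)" using t by (simp add: T.T_0 T'.T_0 T.T_commute T'.T_commute)
  then show ?thesis using inj by (simp add: inj_eq)
qed

section \<open>The damped wave equation\<close>

text \<open>In the coordinates \<open>(a, b)\<close> of the state \<open>(R a, b)\<close> the damped wave equation reads \<open>a' = R\<^sup>-\<^sup>1 b\<close>,
  \<open>b' = - R\<^sup>-\<^sup>1 a - Q b\<close>. This is the inverse of its generator; \<open>Q = 0\<close> gives the undamped equation.\<close>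

definition damped_inverse :: "('h::real_inner \<Rightarrow> 'h) \<Rightarrow> ('h \<Rightarrow> 'h) \<Rightarrow> 'h \<times> 'h \<Rightarrow> 'h \<times> 'h"
  where "damped_inverse R Q = (\<lambda>(f, g). (- R (g + Q (R f)), R f))"

lemma damped_inverse_simps [simp]:
  "fst (damped_inverse R Q z) = - R (snd z + Q (R (fst z)))"
  "snd (damped_inverse R Q z) = R (fst z)"
  by (simp_all add: damped_inverse_def split_beta)

text \<open>The operator \<open>Q' = R\<^sup>-\<^sup>1 Q R\<close> expresses that \<open>Q\<close> is bounded on the domain of \<open>R\<^sup>-\<^sup>1\<close>.\<close>

locale damped_wave =
  fixes R Q Q' :: "'h::{real_inner,complete_space} \<Rightarrow> 'h"
  assumes bounded_linear_R: "bounded_linear R" and sym_R: "R x \<bullet> y = x \<bullet> R y"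
    and inj_R: "inj R" and dense_R: "closure (range R) = UNIV"
    and bounded_linear_Q: "bounded_linear Q" and nonneg_Q: "0 \<le> Q x \<bullet> x"
    and bounded_linear_Q': "bounded_linear Q'" and Q_R: "Q (R x) = R (Q' x)"
begin

sublocale R: bounded_linear R by (rule bounded_linear_R)
sublocale Q: bounded_linear Q by (rule bounded_linear_Q)
sublocale Q': bounded_linear Q' by (rule bounded_linear_Q')

abbreviation "K \<equiv> damped_inverse R Q"

lemma bounded_linear_damped_inverse: "bounded_linear K"
  unfolding damped_inverse_def split_beta
  by (intro bounded_linear_Pair bounded_linear_minus bounded_linear_compose[OF bounded_linear_R]
      bounded_linear_add bounded_linear_compose[OF bounded_linear_Q] bounded_linear_fst bounded_linear_snd)

lemma damped_inverse_inner: "z \<bullet> K z = - (Q (snd (K z)) \<bullet> snd (K z))"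
proof -
  have "z \<bullet> K z = - (fst z \<bullet> R (snd z + Q (R (fst z)))) + snd z \<bullet> R (fst z)"
    by (simp add: inner_prod_def)
  also have "\<dots> = - (R (fst z) \<bullet> (snd z + Q (R (fst z)))) + R (fst z) \<bullet> snd z"
    using sym_R[of "fst z" "snd z + Q (R (fst z))"] inner_commute[of "snd z" "R (fst z)"] by simp
  also have "\<dots> = - (R (fst z) \<bullet> Q (R (fst z)))" by (simp add: inner_add_right)
  finally show ?thesis by (simp only: damped_inverse_simps inner_commute[of "Q _"])
qed

lemma damped_inverse_dissipative: "z \<bullet> K z \<le> 0"
  unfolding damped_inverse_inner using nonneg_Q by simp

lemma R_eq_0: "R x = 0 \<longleftrightarrow> x = 0"
  using inj_R R.zero by (metis injD)

lemma inj_damped_inverse: "inj K"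
proof (rule injI)
  interpret K: bounded_linear K by (rule bounded_linear_damped_inverse)
  fix x y assume "K x = K y"
  then have "K (x - y) = 0" by (simp add: K.diff)
  then have 1: "R (fst (x - y)) = 0" and 2: "R (snd (x - y) + Q (R (fst (x - y)))) = 0"
  proof -
    have "fst (K (x - y)) = 0" "snd (K (x - y)) = 0" by (simp_all only: \<open>K (x - y) = 0\<close> fst_zero snd_zero)
    then show "R (fst (x - y)) = 0" "R (snd (x - y) + Q (R (fst (x - y)))) = 0"
      by (simp_all only: damped_inverse_simps neg_equal_0_iff_equal)
  qed
  have "snd (x - y) = 0" using 2 unfolding 1 by (simp only: Q.zero add_0_right R_eq_0)
  moreover have "fst (x - y) = 0" using 1 by (simp only: R_eq_0)
  ultimately have "x - y = 0" by (simp only: prod_eq_iff fst_zero snd_zero)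
  then show "x = y" by simp
qed

lemma range_damped_inverse: "range K = range R \<times> range R"
proof -
  have "(R a, R b) = K (b, - a - Q (R b))" for a b
    by (simp add: prod_eq_iff R.neg)
  then have "(R a, R b) \<in> range K" for a b by (metis rangeI)
  moreover have "K z = (R (- (snd z + Q (R (fst z)))), R (fst z))" for z
    by (simp only: prod_eq_iff damped_inverse_simps fst_conv snd_conv R.neg)
  ultimately show ?thesis by auto
qed

lemma dense_damped_inverse: "closure (range K) = UNIV"
  by (simp add: range_damped_inverse closure_Times dense_R)

end

text \<open>For \<open>s = 1\<close> this is the isometry from the coordinates onto the state space, and for \<open>s = -1\<close> it also
  reverses the velocity. The reversal turns the generator \<open>- A - C\<^sup>* C\<close> into \<open>A - C\<^sup>* C\<close>, so that both
  semigroups have the same form in coordinates.\<close>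

definition state_of :: "('h::real_inner \<Rightarrow> 'h) \<Rightarrow> real \<Rightarrow> 'h \<times> 'h \<Rightarrow> 'h \<times> 'h"
  where "state_of R s z = (R (fst z), s *\<^sub>R snd z)"

definition energy_coords :: "('h::real_inner \<rightharpoonup> 'h) \<Rightarrow> real \<Rightarrow> 'h \<times> 'h \<Rightarrow> 'h \<times> 'h"
  where "energy_coords A s z = (ap (op_sqrt A) (fst z), s *\<^sub>R snd z)"

text \<open>The description of \<open>A\<close> and of its square root by \<open>R\<close> that \<open>op_sqrt_inverse\<close> provides.\<close>

locale sqrt_inverse =
  fixes A :: "'h::{real_inner,complete_space} \<rightharpoonup> 'h" and R :: "'h \<Rightarrow> 'h"
  assumes op_sqrt_iff: "op_sqrt A x = Some y \<longleftrightarrow> x = R y"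
    and op_iff: "A x = Some y \<longleftrightarrow> x = R (R y)"
    and bl_R: "bounded_linear R"
begin

lemma ap_sqrt [simp]: "ap (op_sqrt A) (R y) = y"
  using op_sqrt_iff[of "R y" y] by simp

lemma ap_op [simp]: "ap A (R (R y)) = y"
  using op_iff[of "R (R y)" y] by simp

lemma dom_sqrt: "dom (op_sqrt A) = range R"
  using op_sqrt_iff by (auto simp: dom_def)

lemma dom_op: "dom A = range (\<lambda>y. R (R y))"
  using op_iff by (auto simp: dom_def)

lemma state_norm_R: "state_norm A (R a, b) = norm (a, b)"
  by (simp add: state_norm_def norm_half_def norm_Pair)

lemma state_of_in: "state_of R s z \<in> state_space A"
  by (simp add: state_of_def state_space_def dom_sqrt)

lemma state_norm_state_of: "\<bar>s\<bar> = 1 \<Longrightarrow> state_norm A (state_of R s z) = norm z"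
  by (simp add: state_of_def state_norm_R norm_Pair norm_prod_def)

lemma state_of_energy_coords:
  assumes "s * s = 1" "x \<in> state_space A"
  shows "state_of R s (energy_coords A s x) = x"
proof -
  obtain a b where "x = (R a, b)" using assms(2) by (auto simp: state_space_def dom_sqrt)
  then show ?thesis using assms(1) by (simp add: state_of_def energy_coords_def)
qed

lemma energy_coords_state_of: "s * s = 1 \<Longrightarrow> energy_coords A s (state_of R s z) = z"
  by (simp add: state_of_def energy_coords_def)

lemma wave_operator_state_of:
  "wave_operator A (state_of R 1 (damped_inverse R (\<lambda>_. 0) z)) = Some (state_of R 1 z)"
proof -
  interpret R: bounded_linear R by (rule bl_R)
  have 1: "R (- R x) = R (R (- x))" for x by (simp add: R.neg)
  have 2: "R (- R x) \<in> dom A" for x unfolding 1 by (auto simp: dom_op)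
  have 3: "ap A (R (- R x)) = - x" for x unfolding 1 by simp
  show ?thesis
    by (simp add: wave_operator_def state_of_def 2 3 dom_sqrt)
qed

end

lemma damped_operator_iff:
  assumes "sqrt_inverse A R" "damped_wave R Q Q'" and Q: "Q = adjoint C \<circ> C" and s: "s * s = 1"
  shows "damped_operator s A C (state_of R s x) = Some (state_of R s y) \<longleftrightarrow> x = damped_inverse R Q y"
proof -
  interpret sqrt_inverse A R by fact
  interpret damped_wave R Q Q' by fact
  have Qe: "adjoint C (C v) = Q v" for v by (simp add: Q)
  have s0: "s \<noteq> 0" using s by auto
  obtain a b where x: "x = (a, b)" by (cases x)
  obtain f g where y: "y = (f, g)" by (cases y)
  have "damped_operator s A C (R a, s *\<^sub>R b) = Some (R f, s *\<^sub>R g)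
    \<longleftrightarrow> (\<exists>c d. a = R c \<and> b = R d \<and> b = R f \<and> s *\<^sub>R g = - s *\<^sub>R c - s *\<^sub>R Q b)"
  proof
    assume "damped_operator s A C (R a, s *\<^sub>R b) = Some (R f, s *\<^sub>R g)"
    then obtain u where u: "wave_operator A (R a, s *\<^sub>R b) = Some u"
      and eq: "(R f, s *\<^sub>R g) = s *\<^sub>R u - (0, Q (s *\<^sub>R b))"
      by (auto simp: damped_operator_def Qe)
    then have d: "R a \<in> dom A" "s *\<^sub>R b \<in> range R" "u = (s *\<^sub>R b, - ap A (R a))"
      by (auto simp: wave_operator_def dom_sqrt split: if_splits)
    obtain c where c: "R a = R (R c)" using d(1) by (auto simp: dom_op)
    then have ac: "a = R c" using inj_R by (simp add: inj_eq)
    obtain d' where d': "s *\<^sub>R b = R d'" using d(2) by blast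
    have "b = s *\<^sub>R (s *\<^sub>R b)" by (simp add: s)
    then have "b = R (s *\<^sub>R d')" by (simp add: d' R.scaleR)
    moreover have "b = R f" "s *\<^sub>R g = - s *\<^sub>R c - s *\<^sub>R Q b"
      using eq by (simp_all add: d(3) ac s Q.scaleR)
    ultimately show "\<exists>c d. a = R c \<and> b = R d \<and> b = R f \<and> s *\<^sub>R g = - s *\<^sub>R c - s *\<^sub>R Q b"
      using ac by blast
  next
    assume "\<exists>c d. a = R c \<and> b = R d \<and> b = R f \<and> s *\<^sub>R g = - s *\<^sub>R c - s *\<^sub>R Q b"
    then obtain c where c: "a = R c" "b = R f" "s *\<^sub>R g = - s *\<^sub>R c - s *\<^sub>R Q b" by blast
    have "R a \<in> dom A" "s *\<^sub>R b \<in> dom (op_sqrt A)" "ap A (R a) = c"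
      by (auto simp: c dom_op dom_sqrt R.scaleR[symmetric])
    then show "damped_operator s A C (R a, s *\<^sub>R b) = Some (R f, s *\<^sub>R g)"
      by (simp add: damped_operator_def wave_operator_def Qe s c(2,3) Q.scaleR)
  qed
  also have "\<dots> \<longleftrightarrow> (\<exists>c. a = R c \<and> b = R f \<and> s *\<^sub>R g = s *\<^sub>R (- c - Q b))"
    by (auto simp: scaleR_right_diff_distrib)
  also have "\<dots> \<longleftrightarrow> (\<exists>c. a = R c \<and> b = R f \<and> g = - c - Q b)" using s0 by simp
  also have "\<dots> \<longleftrightarrow> a = - R (g + Q (R f)) \<and> b = R f"
  proof
    assume "a = - R (g + Q (R f)) \<and> b = R f"
    then show "\<exists>c. a = R c \<and> b = R f \<and> g = - c - Q b"
      by (intro exI[of _ "- (g + Q (R f))"]) (simp only: R.neg, simp)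
  next
    assume "\<exists>c. a = R c \<and> b = R f \<and> g = - c - Q b"
    then show "a = - R (g + Q (R f)) \<and> b = R f" by (auto simp: R.neg)
  qed
  finally show ?thesis by (simp add: x y state_of_def damped_inverse_def)
qed

lemma damped_semigroup_flow:
  assumes "sqrt_inverse A R" "damped_wave R Q Q'" and Q: "Q = adjoint C \<circ> C" and s: "s * s = 1"
    and gen: "C0_semigroup_generated_by (state_space A) (state_norm A) T (damped_operator s A C)"
  shows "contraction_flow (damped_inverse R Q) (\<lambda>t z. energy_coords A s (T t (state_of R s z)))"
    and "0 \<le> t \<Longrightarrow> T t (state_of R s z) = state_of R s (energy_coords A s (T t (state_of R s z)))"
proof -
  interpret sqrt_inverse A R by fact
  interpret damped_wave R Q Q' by fact
  have s1: "\<bar>s\<bar> = 1" using s square_eq_1_iff[of s] by auto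
  let ?W = "state_of R s" and ?U = "energy_coords A s"
  define V where "V t z = ?U (T t (?W z))" for t z
  have sg: "C0_semigroup (state_space A) (state_norm A) T"
    and ge: "\<And>x y. damped_operator s A C x = Some y \<longleftrightarrow> x \<in> state_space A \<and> y \<in> state_space A \<and>
      ((\<lambda>t. state_norm A ((1 / t) *\<^sub>R (T t x - x) - y)) \<longlongrightarrow> 0) (at_right 0)"
    using gen by (auto simp: C0_semigroup_generated_by_def)
  note d = sg[unfolded C0_semigroup_def, THEN conjunct1, rule_format]
  have Tadd: "T t (x + y) = T t x + T t y" if "0 \<le> t" "x \<in> state_space A" "y \<in> state_space A" for t x y
    using d[of t] that by simp
  have Tscale: "T t (c *\<^sub>R x) = c *\<^sub>R T t x" if "0 \<le> t" "x \<in> state_space A" for t x c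
    using d[of t] that by simp
  have Tbound: "\<exists>B. \<forall>x\<in>state_space A. state_norm A (T t x) \<le> B * state_norm A x" if "0 \<le> t" for t
    using d[of t] that by simp
  have Tin: "T t x \<in> state_space A" if "0 \<le> t" "x \<in> state_space A" for t x
    using sg that by (auto simp: C0_semigroup_def)
  have WV: "T t (?W z) = ?W (V t z)" if "0 \<le> t" for t z
    unfolding V_def using Tin[OF that state_of_in] s by (simp add: state_of_energy_coords)
  have Wlin: "?W (x + y) = ?W x + ?W y" "?W (c *\<^sub>R x) = c *\<^sub>R ?W x" "?W (x - y) = ?W x - ?W y" for x y c
    by (simp_all add: state_of_def prod_eq_iff R.add R.scaleR R.diff scaleR_right_distrib scaleR_right_diff_distrib)
  have Winj: "x = y" if "?W x = ?W y" for x y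
    using that energy_coords_state_of[OF s] by metis
  have flow: "contraction_flow K V"
  proof (rule contraction_flow_of_semigroup)
    show "bounded_linear (V t)" if t: "0 \<le> t" for t
    proof -
      obtain B where B: "\<And>x. x \<in> state_space A \<Longrightarrow> state_norm A (T t x) \<le> B * state_norm A x"
        using Tbound[OF t] by blast
      show ?thesis
      proof (rule bounded_linear_intro[where K = B])
        show "V t (x + y) = V t x + V t y" for x y
        proof (rule Winj)
          have "T t (?W x + ?W y) = T t (?W x) + T t (?W y)"
            by (intro Tadd t state_of_in)
          then show "?W (V t (x + y)) = ?W (V t x + V t y)" by (simp add: WV[OF t, symmetric] Wlin)
        qed
        show "V t (c *\<^sub>R x) = c *\<^sub>R V t x" for c x
        proof (rule Winj)
          have "T t (c *\<^sub>R ?W x) = c *\<^sub>R T t (?W x)"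
            by (intro Tscale t state_of_in)
          then show "?W (V t (c *\<^sub>R x)) = ?W (c *\<^sub>R V t x)" by (simp add: WV[OF t, symmetric] Wlin)
        qed
        show "norm (V t x) \<le> norm x * B" for x
          using B[OF state_of_in[of s x]] by (simp add: WV[OF t] state_norm_state_of[OF s1] mult.commute)
      qed
    qed
    show "V 0 x = x" for x
    proof -
      have "T 0 (?W x) = ?W x" using sg state_of_in by (auto simp: C0_semigroup_def)
      then show ?thesis by (simp add: V_def energy_coords_state_of[OF s])
    qed
    show "V (a + b) x = V a (V b x)" if "0 \<le> a" "0 \<le> b" for a b x
    proof (rule Winj)
      have "T (a + b) (?W x) = T a (T b (?W x))" using sg state_of_in that by (auto simp: C0_semigroup_def)
      then show "?W (V (a + b) x) = ?W (V a (V b x))" using that by (simp add: WV)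
    qed
    have nonneg: "\<forall>\<^sub>F h in at_right (0::real). 0 \<le> h"
      unfolding eventually_at_right_field by (intro exI[of _ 1]) auto
    show "((\<lambda>h. V h x) \<longlongrightarrow> x) (at_right 0)" for x
    proof -
      have "((\<lambda>t. state_norm A (T t (?W x) - ?W x)) \<longlongrightarrow> 0) (at_right 0)"
        using sg state_of_in by (auto simp: C0_semigroup_def)
      moreover have "\<forall>\<^sub>F h in at_right 0. state_norm A (T h (?W x) - ?W x) = norm (V h x - x)"
        using nonneg by eventually_elim (simp add: WV Wlin[symmetric] state_norm_state_of[OF s1])
      ultimately have "((\<lambda>h. norm (V h x - x)) \<longlongrightarrow> 0) (at_right 0)" by (rule Lim_transform_eventually)
      then show ?thesis by (simp add: tendsto_norm_zero_iff LIM_zero_iff)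
    qed
    show "x = K y \<longleftrightarrow> ((\<lambda>h. (1 / h) *\<^sub>R (V h x - x)) \<longlongrightarrow> y) (at_right 0)" for x y
    proof -
      have eq: "\<forall>\<^sub>F h in at_right 0. state_norm A ((1 / h) *\<^sub>R (T h (?W x) - ?W x) - ?W y)
          = norm ((1 / h) *\<^sub>R (V h x - x) - y)"
        using nonneg
        by eventually_elim (simp add: WV Wlin[symmetric] state_norm_state_of[OF s1] del: scaleR_right_diff_distrib)
      have "x = K y \<longleftrightarrow> damped_operator s A C (?W x) = Some (?W y)"
        using damped_operator_iff[OF assms(1-4)] by blast
      also have "\<dots> \<longleftrightarrow> ((\<lambda>t. state_norm A ((1 / t) *\<^sub>R (T t (?W x) - ?W x) - ?W y)) \<longlongrightarrow> 0) (at_right 0)"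
        using ge state_of_in by blast
      also have "\<dots> \<longleftrightarrow> ((\<lambda>h. norm ((1 / h) *\<^sub>R (V h x - x) - y)) \<longlongrightarrow> 0) (at_right 0)"
        using eq by (rule tendsto_cong)
      also have "\<dots> \<longleftrightarrow> ((\<lambda>h. (1 / h) *\<^sub>R (V h x - x)) \<longlongrightarrow> y) (at_right 0)"
        by (simp add: tendsto_norm_zero_iff LIM_zero_iff)
      finally show ?thesis .
    qed
  qed (fact bounded_linear_damped_inverse damped_inverse_dissipative dense_damped_inverse)+
  then show "contraction_flow K (\<lambda>t z. ?U (T t (?W z)))" unfolding V_def .
  show "0 \<le> t \<Longrightarrow> T t (?W z) = ?W (?U (T t (?W z)))" using WV[of t z] by (simp add: V_def)
qed


section \<open>Observability and decay\<close>

definition velocity_flip :: "'h::real_inner \<times> 'h \<Rightarrow> 'h \<times> 'h"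
  where "velocity_flip z = (fst z, - snd z)"

lemma velocity_flip_simps [simp]: "fst (velocity_flip z) = fst z" "snd (velocity_flip z) = - snd z"
  by (simp_all add: velocity_flip_def)

lemma norm_velocity_flip [simp]: "norm (velocity_flip z) = norm z"
  by (simp add: velocity_flip_def norm_Pair norm_prod_def)

lemma linear_velocity_flip: "linear velocity_flip"
  by (intro linearI) (simp_all add: velocity_flip_def prod_eq_iff)

context damped_wave
begin

abbreviation "J \<equiv> damped_inverse R (\<lambda>_. 0)"

lemma undamped: "damped_wave R (\<lambda>_. 0) (\<lambda>_. 0)"
  by (rule damped_wave.intro)
    (simp_all add: bounded_linear_R sym_R inj_R dense_R bounded_linear_zero R.zero)

lemma undamped_inverse_inner: "z \<bullet> J z = 0"
  using damped_wave.damped_inverse_inner[OF undamped, of z] by simp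

lemma damped_via_undamped: "K y = J (y + (0, Q (snd (K y))))"
  by (simp add: prod_eq_iff)

text \<open>Such a solution is differentiable in \<open>H\<close> only, which is too weak for the energy. Its image under \<open>J\<close>
  is differentiable in the energy norm, and conservation of energy identifies it with the flow.\<close>

lemma wave_solution_flow:
  assumes "sqrt_inverse A R" and flow: "contraction_flow J S"
    and w: "wave_solution A w0 w1 w w'" and z0: "(w0, w1) = state_of R 1 z0" and t: "0 \<le> t"
  shows "(w t, w' t) = state_of R 1 (S t z0)"
proof -
  interpret sqrt_inverse A R by fact
  interpret S: contraction_flow J S by fact
  interpret J: bounded_linear J by (rule S.bounded_linear_K)
  have w_dom: "w s \<in> dom A"
    and w_der: "(w has_vector_derivative w' s) (at s within {0..})"
    and w'_der: "(w' has_vector_derivative - ap A (w s)) (at s within {0..})" if "0 \<le> s" for s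
    using w that by (auto simp: wave_solution_def)
  have "\<exists>p. \<forall>s\<ge>0. w s = R (R (p s))" using w_dom by (intro choice) (auto simp: dom_op)
  then obtain p where p: "\<And>s. 0 \<le> s \<Longrightarrow> w s = R (R (p s))" by blast
  define u where "u s = (R (p s), w' s)" for s
  have Ju: "J (u s) = (- R (w' s), w s)" if "0 \<le> s" for s using p[OF that] by (simp add: prod_eq_iff u_def)
  have st: "state_of R 1 (u s) = (w s, w' s)" if "0 \<le> s" for s using p[OF that] by (simp add: state_of_def u_def)
  have u0: "u 0 = z0"
  proof -
    have "state_of R 1 (u 0) = state_of R 1 z0" using st[of 0] z0 w by (simp add: wave_solution_def)
    then show ?thesis using inj_R by (simp add: state_of_def prod_eq_iff inj_eq)
  qed
  have der: "((\<lambda>s. (- R (w' s), w s)) has_vector_derivative u s) (at s within {0..})" if s: "0 \<le> s" for s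
  proof -
    have "((\<lambda>s. - R (w' s)) has_vector_derivative - R (- ap A (w s))) (at s within {0..})"
      by (intro has_vector_derivative_minus R.has_vector_derivative w'_der s)
    moreover have "- R (- ap A (w s)) = R (p s)" using p[OF s] by (simp add: R.neg)
    ultimately show ?thesis unfolding u_def using w_der[OF s] by (simp add: has_vector_derivative_Pair)
  qed
  let ?d = "\<lambda>s. (- R (w' s), w s) - S s (J z0)"
  have "norm (?d t) \<le> norm (?d 0) + 0 * (t - 0)"
  proof (rule norm_growth_bound[OF t])
    fix s assume s: "s \<in> {0..t}"
    show "(?d has_vector_derivative (u s - S s z0)) (at s within {0..t})"
      by (intro has_vector_derivative_diff has_vector_derivative_within_subset[OF der]
          has_vector_derivative_within_subset[OF S.T_derivative]) (use s in auto)
    have "?d s = J (u s - S s z0)" using s by (simp only: J.diff S.T_commute atLeastAtMost_iff Ju)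
    then have "?d s \<bullet> (u s - S s z0) = (u s - S s z0) \<bullet> J (u s - S s z0)" by (simp only: inner_commute)
    then show "?d s \<bullet> (u s - S s z0) \<le> 0 * norm (?d s)" by (simp only: undamped_inverse_inner)
  qed simp
  also have "?d 0 = 0" using Ju[of 0] by (simp only: S.T_0 u0) simp
  finally have "?d t = 0" by simp
  then have "J (u t) = J (S t z0)" using t by (simp add: Ju S.T_commute)
  then have "u t = S t z0" using damped_wave.inj_damped_inverse[OF undamped] by (simp only: inj_eq)
  then show ?thesis using st[OF t] by simp
qed

text \<open>The flow \<open>S\<close> provides the classical solutions to which the observability inequality applies.\<close>

lemma observability_coords:
  assumes "sqrt_inverse A R" and flow: "contraction_flow J S" and obs: "exactly_observable A C \<tau>"
  obtains k where "k > 0"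
    "\<And>y. k * (norm (J y))\<^sup>2 \<le> integral {0..\<tau>} (\<lambda>t. (norm (C (snd (S t (J y)))))\<^sup>2)"
proof -
  interpret sqrt_inverse A R by fact
  interpret S: contraction_flow J S by fact
  obtain k where k: "k > 0" "\<And>z0 z. \<lbrakk>z0 \<in> dom (wave_operator A);
      classical_solution (state_norm A) (wave_operator A) z; z 0 = z0\<rbrakk> \<Longrightarrow>
      k\<^sup>2 * (state_norm A z0)\<^sup>2 \<le> integral {0..\<tau>} (\<lambda>t. (norm (C (snd (z t))))\<^sup>2)"
    using obs unfolding exactly_observable_def by blast
  show thesis
  proof (rule that[of "k\<^sup>2"])
    show "0 < k\<^sup>2" using k(1) by simp
    fix y
    let ?z = "\<lambda>t. state_of R 1 (S t (J y))"
    have cs: "classical_solution (state_norm A) (wave_operator A) ?z"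
      unfolding classical_solution_def
    proof (intro allI impI conjI)
      fix t :: real assume t: "0 \<le> t"
      have wo: "wave_operator A (?z t) = Some (state_of R 1 (S t y))"
        using t by (simp only: S.T_commute wave_operator_state_of)
      then show "?z t \<in> dom (wave_operator A)" by blast
      have lim: "((\<lambda>s. norm (S s (J y) - S t (J y) - (s - t) *\<^sub>R S t y) / norm (s - t)) \<longlongrightarrow> 0) (at t within {0..})"
        using S.T_derivative[OF t, of y] unfolding has_vector_derivative_def has_derivative_iff_norm by blast
      have eq: "state_norm A ((1 / (s - t)) *\<^sub>R (?z s - ?z t) - state_of R 1 (S t y))
          = norm (S s (J y) - S t (J y) - (s - t) *\<^sub>R S t y) / norm (s - t)" if "s \<noteq> t" for s
      proof -
        have "(1 / (s - t)) *\<^sub>R (?z s - ?z t) - state_of R 1 (S t y)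
            = state_of R 1 ((1 / (s - t)) *\<^sub>R (S s (J y) - S t (J y)) - S t y)"
          by (simp only: state_of_def prod_eq_iff fst_diff snd_diff fst_scaleR snd_scaleR R.diff R.scaleR
              scaleR_one fst_conv snd_conv)
        moreover have "norm ((1 / (s - t)) *\<^sub>R (S s (J y) - S t (J y)) - S t y)
            = norm ((1 / (s - t)) *\<^sub>R (S s (J y) - S t (J y) - (s - t) *\<^sub>R S t y))"
          using that by (simp add: scaleR_right_diff_distrib)
        ultimately show ?thesis
          by (simp only: state_norm_state_of abs_one) (simp add: divide_inverse abs_inverse mult.commute)
      qed
      show "((\<lambda>s. state_norm A ((1 / (s - t)) *\<^sub>R (?z s - ?z t) - ap (wave_operator A) (?z t))) \<longlongrightarrow> 0)
          (at t within {0..})"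
        unfolding wo option.sel
        by (rule Lim_transform_eventually[OF lim])
          (auto simp: eq eventually_at_filter)
    qed
    have "?z 0 \<in> dom (wave_operator A)" using cs by (auto simp: classical_solution_def)
    from k(2)[OF this cs refl]
    show "k\<^sup>2 * (norm (J y))\<^sup>2 \<le> integral {0..\<tau>} (\<lambda>t. (norm (C (snd (S t (J y)))))\<^sup>2)"
      by (simp only: S.T_0 state_norm_state_of abs_one) (simp add: state_of_def)
  qed
qed

text \<open>Let \<open>d\<close> be the difference of the undamped and the damped solution with the same initial value. It
  is driven by the damping, whose square is controlled by the output of the damped solution, that is,
  by the rate at which that solution loses energy \<open>E\<close>. Hence \<open>e\<^sup>-\<^sup>t \<parallel>d\<parallel>\<^sup>2 + \<kappa>\<^sup>2 E / 2\<close> decreases, the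
  output of the undamped solution is bounded by the total loss, and observability bounds the loss from
  below.\<close>

lemma observability_decay:
  fixes C :: "'h \<Rightarrow> 'y::real_inner"
  assumes S: "contraction_flow J S" and T: "contraction_flow K T"
    and C: "bounded_linear C" and Q: "Q = adjoint C \<circ> C" and \<tau>: "0 < \<tau>" and k: "0 < k"
    and obs: "\<And>y. k * (norm (J y))\<^sup>2 \<le> integral {0..\<tau>} (\<lambda>t. (norm (C (snd (S t (J y)))))\<^sup>2)"
  obtains \<gamma> where "0 < \<gamma>" "\<gamma> < 1" "\<And>x. norm (T \<tau> x) \<le> \<gamma> * norm x"
proof -
  interpret S: contraction_flow J S by fact
  interpret T: contraction_flow K T by fact
  interpret J: bounded_linear J by (rule S.bounded_linear_K)
  interpret K: bounded_linear K by (rule T.bounded_linear_K)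
  interpret C: bounded_linear C by (rule C)
  obtain c where c: "c > 0" "\<And>x. norm (C x) \<le> norm x * c" using C.pos_bounded by blast
  interpret Cs: bounded_linear "adjoint C" by (rule bounded_linear_adjoint[OF C])
  obtain \<kappa> where \<kappa>: "\<kappa> > 0" "\<And>x. norm (adjoint C x) \<le> norm x * \<kappa>" using Cs.pos_bounded by blast
  have Qe: "Q v = adjoint C (C v)" for v by (simp add: Q)
  have Qn: "Q v \<bullet> v = (norm (C v))\<^sup>2" for v
    by (simp add: Qe inner_commute[of "adjoint C _"] adjoint_inner[OF C, symmetric] power2_norm_eq_inner)
  have Qb: "(norm (Q v))\<^sup>2 \<le> \<kappa>\<^sup>2 * (norm (C v))\<^sup>2" for v
  proof -
    have "(norm (Q v))\<^sup>2 \<le> (norm (C v) * \<kappa>)\<^sup>2" unfolding Qe by (intro power_mono \<kappa>) auto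
    then show ?thesis by (simp add: power_mult_distrib mult.commute)
  qed
  define c1 where "c1 = 1 + c\<^sup>2 * \<kappa>\<^sup>2 * exp \<tau> * \<tau>"
  have c1: "c1 > 0" using \<tau> by (simp add: c1_def add_pos_nonneg)
  have main: "(norm (T \<tau> (K y)))\<^sup>2 \<le> (1 - k / c1) * (norm (K y))\<^sup>2" for y
  proof -
    define q where "q t = snd (T t (K y))" for t
    define y' where "y' = y + (0, Q (snd (K y)))"
    have y': "K y = J y'" unfolding y'_def by (rule damped_via_undamped)
    define E where "E t = (norm (T t (K y)))\<^sup>2" for t
    define d where "d t = S t (J y') - T t (K y)" for t
    define B where "B t = ((0, Q (q t)) :: 'h \<times> 'h)" for t
    have nB: "norm (B t) = norm (Q (q t))" for t by (simp add: B_def norm_Pair)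
    have Eder: "(E has_real_derivative - 2 * (norm (C (q t)))\<^sup>2) (at t within {0..})" if t: "0 \<le> t" for t
    proof -
      have "(E has_real_derivative 2 * (T t (K y) \<bullet> T t y)) (at t within {0..})"
        unfolding E_def by (intro norm_square_has_derivative T.T_derivative t)
      moreover have "T t (K y) \<bullet> T t y = - (norm (C (q t)))\<^sup>2"
      proof -
        have "T t y \<bullet> K (T t y) = - (norm (C (snd (K (T t y)))))\<^sup>2" by (simp only: damped_inverse_inner Qn)
        then show ?thesis using t by (simp only: T.T_commute q_def inner_commute[of "K (T t y)"])
      qed
      ultimately show ?thesis by simp
    qed
    have dder: "(d has_vector_derivative (S t y' - T t y)) (at t within {0..})" if t: "0 \<le> t" for t
      unfolding d_def by (intro has_vector_derivative_diff S.T_derivative T.T_derivative t)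
    have dinner: "d t \<bullet> (S t y' - T t y) = d t \<bullet> B t" if t: "0 \<le> t" for t
    proof -
      define \<delta> where "\<delta> = S t y' - T t y - B t"
      have "T t (K y) = J (T t y + B t)"
        using t damped_via_undamped[of "T t y"] by (simp only: T.T_commute B_def q_def)
      then have "d t = J \<delta>"
        using t by (simp only: d_def S.T_commute \<delta>_def J.diff J.add) (simp add: algebra_simps)
      then have "d t \<bullet> \<delta> = 0" using undamped_inverse_inner[of \<delta>] by (simp only: inner_commute)
      then show ?thesis by (simp add: \<delta>_def inner_diff_right)
    qed
    have sub: "(f has_real_derivative D) (at t within {a..b})"
      if "(f has_real_derivative D) (at t within {0..})" "0 \<le> a" for f :: "real \<Rightarrow> real" and D t a b
      using that by (rule_tac DERIV_subset) auto
    have Emono: "E b \<le> E a" if "0 \<le> a" "a \<le> b" for a b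
      by (rule nonincreasing_on_interval[OF that(2), where f' = "\<lambda>t. - 2 * (norm (C (q t)))\<^sup>2"])
        (use that sub Eder in auto)
    define \<Delta> where "\<Delta> = E 0 - E \<tau>"
    have dbound: "(norm (d t))\<^sup>2 \<le> exp \<tau> * (\<kappa>\<^sup>2 / 2 * \<Delta>)" if t: "0 \<le> t" "t \<le> \<tau>" for t
    proof -
      let ?\<Phi> = "\<lambda>t. exp (- t) * (norm (d t))\<^sup>2 + \<kappa>\<^sup>2 / 2 * E t"
      have "?\<Phi> t \<le> ?\<Phi> 0"
      proof (rule nonincreasing_on_interval[OF t(1)])
        fix s assume s: "s \<in> {0..t}"
        then have s0: "0 \<le> s" by simp
        let ?D = "exp (- s) * (2 * (d s \<bullet> B s)) + (exp (- s) * (- 1)) * (norm (d s))\<^sup>2 + \<kappa>\<^sup>2 / 2 * (- 2 * (norm (C (q s)))\<^sup>2)"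
        have e: "((\<lambda>t. exp (- t)) has_real_derivative exp (- s) * (- 1)) (at s within {0..})"
          by (auto intro!: derivative_eq_intros)
        have n: "((\<lambda>t. (norm (d t))\<^sup>2) has_real_derivative 2 * (d s \<bullet> B s)) (at s within {0..})"
          using norm_square_has_derivative[OF dder[OF s0]] dinner[OF s0] by simp
        have "(?\<Phi> has_real_derivative ?D) (at s within {0..})"
          using DERIV_add[OF DERIV_mult[OF e n] DERIV_cmult[OF Eder[OF s0], of "\<kappa>\<^sup>2 / 2"]]
          by (simp only: add.commute[of "exp (- s) * (- 1) * _"] mult.commute[of "2 * (d s \<bullet> B s)"])
        then show "(?\<Phi> has_real_derivative ?D) (at s within {0..t})" by (rule sub) simp
        have "(norm (d s - B s))\<^sup>2 = (norm (d s))\<^sup>2 - 2 * (d s \<bullet> B s) + (norm (Q (q s)))\<^sup>2"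
          using norm_add_scaleR_square[of "d s" "- 1" "B s"] by (simp add: nB)
        then have "2 * (d s \<bullet> B s) \<le> (norm (d s))\<^sup>2 + (norm (Q (q s)))\<^sup>2"
          using zero_le_power2[of "norm (d s - B s)"] by linarith
        then have "2 * (d s \<bullet> B s) - (norm (d s))\<^sup>2 \<le> \<kappa>\<^sup>2 * (norm (C (q s)))\<^sup>2" using Qb[of "q s"] by linarith
        then have "exp (- s) * (2 * (d s \<bullet> B s) - (norm (d s))\<^sup>2) \<le> exp (- s) * (\<kappa>\<^sup>2 * (norm (C (q s)))\<^sup>2)"
          by (rule mult_left_mono) simp
        also have "\<dots> \<le> 1 * (\<kappa>\<^sup>2 * (norm (C (q s)))\<^sup>2)" using s0 by (intro mult_right_mono) auto
        finally show "?D \<le> 0" by (simp add: algebra_simps)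
      qed
      also have "?\<Phi> 0 = \<kappa>\<^sup>2 / 2 * E 0" by (simp add: d_def S.T_0 T.T_0 y')
      finally have "exp (- t) * (norm (d t))\<^sup>2 \<le> \<kappa>\<^sup>2 / 2 * (E 0 - E t)" by (simp add: algebra_simps)
      also have "\<dots> \<le> \<kappa>\<^sup>2 / 2 * \<Delta>"
        unfolding \<Delta>_def using Emono[OF t] by (intro mult_left_mono) auto
      finally have "exp t * (exp (- t) * (norm (d t))\<^sup>2) \<le> exp t * (\<kappa>\<^sup>2 / 2 * \<Delta>)" by (rule mult_left_mono) simp
      then have "(norm (d t))\<^sup>2 \<le> exp t * (\<kappa>\<^sup>2 / 2 * \<Delta>)" by (simp add: mult.assoc[symmetric] exp_add[symmetric])
      also have "\<dots> \<le> exp \<tau> * (\<kappa>\<^sup>2 / 2 * \<Delta>)"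
        using t Emono[of 0 \<tau>] \<tau> by (intro mult_right_mono) (auto simp: \<Delta>_def)
      finally show ?thesis .
    qed
    let ?g = "\<lambda>t. (norm (C (snd (S t (J y')))))\<^sup>2"
    define m where "m = c\<^sup>2 * (exp \<tau> * (\<kappa>\<^sup>2 * \<Delta>))"
    have gle: "?g t \<le> 2 * (norm (C (q t)))\<^sup>2 + m" if t: "t \<in> {0..\<tau>}" for t
    proof -
      have "snd (S t (J y')) = q t + snd (d t)" by (simp add: d_def q_def)
      then have "?g t = (norm (C (q t) + C (snd (d t))))\<^sup>2" by (simp add: C.add)
      also have "\<dots> \<le> 2 * (norm (C (q t)))\<^sup>2 + 2 * (norm (C (snd (d t))))\<^sup>2"
        using parallelogram_law[of "C (q t)" "C (snd (d t))"] by (smt (verit) zero_le_power2)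
      also have "(norm (C (snd (d t))))\<^sup>2 \<le> c\<^sup>2 * (exp \<tau> * (\<kappa>\<^sup>2 / 2 * \<Delta>))"
      proof -
        have "norm (C (snd (d t))) \<le> norm (d t) * c"
        proof -
          have "norm (snd (d t)) \<le> norm (fst (d t), snd (d t))" by (rule norm_snd_le)
          then have "norm (snd (d t)) * c \<le> norm (d t) * c" using c(1) by (intro mult_right_mono) auto
          then show ?thesis using c(2)[of "snd (d t)"] by linarith
        qed
        then have "(norm (C (snd (d t))))\<^sup>2 \<le> (norm (d t) * c)\<^sup>2" by (intro power_mono) auto
        also have "\<dots> = c\<^sup>2 * (norm (d t))\<^sup>2" by (simp add: power_mult_distrib mult.commute)
        also have "\<dots> \<le> c\<^sup>2 * (exp \<tau> * (\<kappa>\<^sup>2 / 2 * \<Delta>))" using t by (intro mult_left_mono dbound) auto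
        finally show ?thesis .
      qed
      finally show ?thesis by (simp add: m_def)
    qed
    have int: "((\<lambda>t. 2 * (norm (C (q t)))\<^sup>2 + m) has_integral (- E \<tau> + m * \<tau>) - (- E 0 + m * 0)) {0..\<tau>}"
    proof (rule fundamental_theorem_of_calculus)
      fix t assume t: "t \<in> {0..\<tau>}"
      have "((\<lambda>t. - E t + m * t) has_real_derivative - (- 2 * (norm (C (q t)))\<^sup>2) + m) (at t within {0..})"
        using t by (intro DERIV_add DERIV_minus Eder DERIV_cmult_Id) auto
      then have "((\<lambda>t. - E t + m * t) has_real_derivative - (- 2 * (norm (C (q t)))\<^sup>2) + m) (at t within {0..\<tau>})"
        by (rule sub) simp
      then show "((\<lambda>t. - E t + m * t) has_vector_derivative 2 * (norm (C (q t)))\<^sup>2 + m) (at t within {0..\<tau>})"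
        by (simp add: has_real_derivative_iff_has_vector_derivative)
    qed (use \<tau> in simp)
    have gint: "?g integrable_on {0..\<tau>}"
    proof (rule integrable_continuous_real)
      have "continuous_on {0..\<tau>} (\<lambda>t. S t (J y'))"
        unfolding continuous_on_eq_continuous_within
      proof
        fix t assume "t \<in> {0..\<tau>}"
        then have "((\<lambda>t. S t (J y')) has_vector_derivative S t y') (at t within {0..\<tau>})"
          by (intro has_vector_derivative_within_subset[OF S.T_derivative]) auto
        then show "continuous (at t within {0..\<tau>}) (\<lambda>t. S t (J y'))"
          by (rule has_vector_derivative_continuous)
      qed
      then show "continuous_on {0..\<tau>} ?g"
        by (intro continuous_on_power continuous_on_norm C.continuous_on continuous_on_snd)
    qed
    have "k * (norm (K y))\<^sup>2 \<le> integral {0..\<tau>} ?g" unfolding y' by (rule obs)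
    also have "\<dots> \<le> integral {0..\<tau>} (\<lambda>t. 2 * (norm (C (q t)))\<^sup>2 + m)"
      by (rule integral_le[OF gint _ gle]) (use int in blast)
    also have "\<dots> = \<Delta> + m * \<tau>" using int by (simp add: integral_unique \<Delta>_def)
    also have "\<dots> = c1 * \<Delta>" by (simp add: m_def c1_def algebra_simps)
    finally have "k / c1 * (norm (K y))\<^sup>2 \<le> \<Delta>" using c1 by (simp add: field_simps)
    moreover have "\<Delta> = (norm (K y))\<^sup>2 - (norm (T \<tau> (K y)))\<^sup>2" by (simp add: \<Delta>_def E_def T.T_0)
    ultimately show ?thesis by (simp add: algebra_simps)
  qed
  define a where "a = max (1 / 2) (1 - k / c1)"
  have a: "0 < a" "a < 1" using k c1 by (auto simp: a_def)
  show thesis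
  proof (rule that[of "sqrt a"])
    show "0 < sqrt a" "sqrt a < 1" using a by auto
    interpret Tt: bounded_linear "T \<tau>"
      using T.linear_T[of \<tau>] T.T_contraction[of \<tau>] \<tau>
      by (intro bounded_linear_intro[where K = 1]) (auto simp: linear_add linear_scale)
    have le: "norm (T \<tau> (K y)) \<le> sqrt a * norm (K y)" for y
    proof (rule power2_le_imp_le)
      have "(norm (T \<tau> (K y)))\<^sup>2 \<le> a * (norm (K y))\<^sup>2"
        using main[of y] mult_right_mono[of "1 - k / c1" a "(norm (K y))\<^sup>2"] by (simp add: a_def)
      then show "(norm (T \<tau> (K y)))\<^sup>2 \<le> (sqrt a * norm (K y))\<^sup>2" using a by (simp add: power_mult_distrib)
    qed (use a in simp)
    have "closed {x. norm (T \<tau> x) \<le> sqrt a * norm x}"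
      by (intro closed_Collect_le continuous_intros Tt.continuous_on)
    then have "closure (range K) \<subseteq> {x. norm (T \<tau> x) \<le> sqrt a * norm x}"
      using le by (intro closure_minimal) auto
    then show "norm (T \<tau> x) \<le> sqrt a * norm x" for x using dense_damped_inverse by auto
  qed
qed

section \<open>Regularity under iteration\<close>

text \<open>Velocity reversal anticommutes with the undamped generator, but only nearly commutes with the
  square of the damped one. This is the commutator, a bounded operator applied to \<open>K y\<close> instead of
  \<open>y\<close>, hence a term of lower order.\<close>

definition flip_correction :: "'h \<times> 'h \<Rightarrow> 'h \<times> 'h"
  where "flip_correction v =
    (2 *\<^sub>R Q' (fst v), - (2 *\<^sub>R Q (snd v) + 2 *\<^sub>R Q (R (Q' (fst v)))))"

lemma velocity_flip_domain:
  "velocity_flip (K (K y)) = K (K (velocity_flip y + flip_correction (K y)))"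
  by (simp add: prod_eq_iff flip_correction_def Q_R R.add R.diff R.neg R.scaleR Q.add Q.diff Q.neg Q.scaleR
      Q'.add Q'.diff Q'.neg Q'.scaleR algebra_simps scaleR_2)

lemma flip_correction_bound: "\<exists>c>0. \<forall>v. norm (flip_correction v) \<le> c * norm v"
proof -
  have "bounded_linear flip_correction"
    unfolding flip_correction_def
    by (intro bounded_linear_Pair bounded_linear_minus bounded_linear_add
        bounded_linear_compose[OF bounded_linear_scaleR_right]
        bounded_linear_compose[OF bounded_linear_Q] bounded_linear_compose[OF bounded_linear_R]
        bounded_linear_compose[OF bounded_linear_Q'] bounded_linear_fst bounded_linear_snd)
  then obtain c where "c > 0" "\<And>v. norm (flip_correction v) \<le> norm v * c"
    using bounded_linear.pos_bounded by blast
  then show ?thesis by (auto simp: mult.commute)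
qed

text \<open>Landau's inequality: expand \<open>T t (K (K x))\<close> to first order at time 0.\<close>

lemma flow_interpolation:
  assumes T: "contraction_flow K T" and t: "0 < t"
  shows "norm (K x) \<le> 2 * norm (K (K x)) / t + t * norm x"
proof -
  interpret T: contraction_flow K T by fact
  have der: "((\<lambda>s. T s (K u)) has_vector_derivative T s u) (at s within {0..t})" if "s \<in> {0..t}" for s u
    by (rule has_vector_derivative_within_subset[OF T.T_derivative]) (use that in auto)
  have mv: "norm (T s (K x) - T 0 (K x)) \<le> t * norm x" if s: "s \<in> {0..t}" for s
  proof -
    have "norm (T s (K x) - T 0 (K x)) \<le> norm x * \<bar>s - 0\<bar>"
      by (rule vector_mean_value_bound[where S = "{0..t}" and f' = "\<lambda>s. T s x"])
        (use s t der in \<open>auto simp: closed_segment_eq_real_ivl intro: T.T_contraction\<close>)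
    also have "\<dots> \<le> norm x * t" using s by (intro mult_left_mono) auto
    finally show ?thesis by (simp add: mult.commute)
  qed
  have "norm (T t (K (K x)) - T 0 (K (K x)) - (t - 0) *\<^sub>R T 0 (K x)) \<le> norm (t - 0) * (t * norm x)"
    by (rule vector_differentiable_bound_linearization[where S = "{0..t}" and f' = "\<lambda>s. T s (K x)"])
      (use t der mv in \<open>auto simp: closed_segment_eq_real_ivl\<close>)
  then have lin: "norm (T t (K (K x)) - K (K x) - t *\<^sub>R K x) \<le> t * (t * norm x)" using t by (simp add: T.T_0)
  have "norm (t *\<^sub>R K x) = norm (T t (K (K x)) - K (K x) - (T t (K (K x)) - K (K x) - t *\<^sub>R K x))" by simp
  then have "norm (t *\<^sub>R K x) \<le> norm (T t (K (K x))) + norm (K (K x)) + t * (t * norm x)"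
    using lin norm_triangle_ineq4[of "T t (K (K x)) - K (K x)" "T t (K (K x)) - K (K x) - t *\<^sub>R K x"]
      norm_triangle_ineq4[of "T t (K (K x))" "K (K x)"] by linarith
  then have "t * norm (K x) \<le> 2 * norm (K (K x)) + t * (t * norm x)"
    using T.T_contraction[of t "K (K x)"] t by simp
  then show ?thesis using t by (simp add: field_simps)
qed

text \<open>The norm of \<open>x n\<close> is that of the \<open>n\<close>-th iterate in the domain of the square of the generator. A
  half cycle increases it at most by a multiple of \<open>\<parallel>K (x n)\<parallel>\<close>. The iterates \<open>K (K (x n))\<close> decay like
  \<open>\<gamma>\<^sup>n\<close>, so by interpolation \<open>\<parallel>K (x n)\<parallel>\<close> is at most \<open>\<gamma>\<^sup>n\<^sup>/\<^sup>2\<close> times the sum of \<open>\<parallel>x n\<parallel>\<close> and a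
  constant, and the product of the growth factors converges.\<close>

lemma iterates_regular:
  assumes T: "contraction_flow K T" and \<tau>: "0 \<le> \<tau>"
    and \<gamma>: "0 < \<gamma>" "\<gamma> < 1" "\<And>x. norm (T \<tau> x) \<le> \<gamma> * norm x"
  obtains M where "0 < M"
    "\<And>x0. \<exists>x. x 0 = x0 \<and> (\<forall>n. velocity_flip (T \<tau> (K (K (x n)))) = K (K (x (Suc n))) \<and> norm (x n) \<le> M * norm x0)"
proof -
  interpret T: contraction_flow K T by fact
  interpret K: bounded_linear K by (rule T.bounded_linear_K)
  obtain c where c: "c > 0" "\<And>v. norm (flip_correction v) \<le> c * norm v" using flip_correction_bound by blast
  obtain b where b: "b > 0" "\<And>v. norm (K v) \<le> norm v * b" using K.pos_bounded by blast
  define \<beta> where "\<beta> = sqrt \<gamma>"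
  have \<beta>: "0 < \<beta>" "\<beta> < 1" "\<beta> * \<beta> = \<gamma>" using \<gamma> by (auto simp: \<beta>_def)
  define M where "M = exp (c / (1 - \<beta>)) * (1 + 2 * b\<^sup>2)"
  show thesis
  proof (rule that[of M])
    show "0 < M" using b by (simp add: M_def add_pos_nonneg)
    fix x0
    define next_x where "next_x y = velocity_flip (T \<tau> y) + flip_correction (K (T \<tau> y))" for y
    define x where "x n = (next_x ^^ n) x0" for n
    have step: "velocity_flip (T \<tau> (K (K (x n)))) = K (K (x (Suc n)))" for n
      using \<tau> velocity_flip_domain[of "T \<tau> (x n)"] by (simp add: x_def next_x_def T.T_commute)
    define s where "s = 2 * norm (K (K x0))"
    have decay: "norm (K (K (x n))) \<le> \<gamma> ^ n * norm (K (K x0))" for n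
    proof (induction n)
      case 0 show ?case by (simp add: x_def)
    next
      case (Suc n)
      have "norm (K (K (x (Suc n)))) = norm (T \<tau> (K (K (x n))))" by (simp only: step[symmetric] norm_velocity_flip)
      also have "\<dots> \<le> \<gamma> * norm (K (K (x n)))" by (rule \<gamma>)
      also have "\<dots> \<le> \<gamma> * (\<gamma> ^ n * norm (K (K x0)))" using Suc \<gamma> by (intro mult_left_mono) auto
      finally show ?case by simp
    qed
    \<comment> \<open>interpolation at time \<open>\<beta> ^ n\<close> balances its two terms\<close>
    have grow: "norm (x (Suc n)) + s \<le> (1 + c * \<beta> ^ n) * (norm (x n) + s)" for n
    proof -
      have "2 * norm (K (K (x n))) / \<beta> ^ n \<le> \<beta> ^ n * s"
      proof -
        have "2 * norm (K (K (x n))) \<le> (\<beta> * \<beta>) ^ n * s" using decay[of n] by (simp add: s_def \<beta>(3))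
        then show ?thesis using \<beta>(1) by (simp add: power_mult_distrib field_simps)
      qed
      then have Kx: "norm (K (x n)) \<le> \<beta> ^ n * (norm (x n) + s)"
        using flow_interpolation[OF T, of "\<beta> ^ n" "x n"] \<beta>(1) by (simp add: algebra_simps)
      have "norm (x (Suc n)) \<le> norm (T \<tau> (x n)) + norm (flip_correction (K (T \<tau> (x n))))"
        using norm_triangle_ineq[of "velocity_flip (T \<tau> (x n))" "flip_correction (K (T \<tau> (x n)))"]
        by (simp add: x_def next_x_def)
      also have "\<dots> \<le> norm (x n) + c * norm (T \<tau> (K (x n)))"
        using T.T_contraction[OF \<tau>, of "x n"] c(2)[of "K (T \<tau> (x n))"] by (simp only: T.T_commute[OF \<tau>] add_mono)
      also have "\<dots> \<le> norm (x n) + c * norm (K (x n))"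
        using T.T_contraction[OF \<tau>, of "K (x n)"] c(1) by (simp add: mult_left_mono)
      also have "\<dots> \<le> norm (x n) + c * (\<beta> ^ n * (norm (x n) + s))" using Kx c(1) by (simp add: mult_left_mono)
      finally show ?thesis by (simp add: algebra_simps)
    qed
    have s0: "0 \<le> s" by (simp add: s_def)
    have prodb: "norm (x n) + s \<le> exp (c * (\<Sum>k<n. \<beta> ^ k)) * (norm x0 + s)" for n
    proof (induction n)
      case 0 show ?case by (simp add: x_def)
    next
      case (Suc n)
      have "norm (x (Suc n)) + s \<le> (1 + c * \<beta> ^ n) * (norm (x n) + s)" by (rule grow)
      also have "\<dots> \<le> exp (c * \<beta> ^ n) * (norm (x n) + s)"
        using s0 by (intro mult_right_mono exp_ge_add_one_self) (auto simp: add_nonneg_nonneg)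
      also have "\<dots> \<le> exp (c * \<beta> ^ n) * (exp (c * (\<Sum>k<n. \<beta> ^ k)) * (norm x0 + s))"
        by (intro mult_left_mono Suc) auto
      finally show ?case by (simp add: distrib_left exp_add mult_ac)
    qed
    have "norm (x n) \<le> M * norm x0" for n
    proof -
      have geo: "(\<Sum>k<n. \<beta> ^ k) \<le> 1 / (1 - \<beta>)"
      proof -
        have "(\<Sum>k<n. \<beta> ^ k) = (1 - \<beta> ^ n) / (1 - \<beta>)" using \<beta> by (simp add: sum_gp_strict)
        also have "\<dots> \<le> 1 / (1 - \<beta>)" using \<beta> by (intro divide_right_mono) auto
        finally show ?thesis .
      qed
      have "norm (x n) \<le> exp (c * (\<Sum>k<n. \<beta> ^ k)) * (norm x0 + s)" using prodb[of n] s0 by linarith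
      also have "\<dots> \<le> exp (c / (1 - \<beta>)) * (norm x0 + s)"
        using mult_left_mono[OF geo, of c] c(1) s0 by (intro mult_right_mono) (auto simp: add_nonneg_nonneg)
      also have "\<dots> \<le> exp (c / (1 - \<beta>)) * ((1 + 2 * b\<^sup>2) * norm x0)"
      proof (intro mult_left_mono)
        have "norm (K (K x0)) \<le> norm (K x0) * b" by (rule b)
        also have "\<dots> \<le> norm x0 * b * b" using b by (intro mult_right_mono) auto
        finally show "norm x0 + s \<le> (1 + 2 * b\<^sup>2) * norm x0"
          by (simp add: s_def power2_eq_square algebra_simps)
      qed simp
      finally show ?thesis by (simp add: M_def mult_ac)
    qed
    then show "\<exists>x. x 0 = x0 \<and> (\<forall>n. velocity_flip (T \<tau> (K (K (x n)))) = K (K (x (Suc n))) \<and> norm (x n) \<le> M * norm x0)"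
      using step by (intro exI[of _ x]) (simp add: x_def)
  qed
qed

text \<open>The vectors \<open>u\<close> and \<open>v\<close> stand for \<open>A\<^sup>3\<^sup>/\<^sup>2 w\<^sub>0\<close> and \<open>A w\<^sub>1\<close>, so the data lie in the domain of the square
  of the damped generator.\<close>

lemma regular_data:
  obtains M where "0 < M" "\<And>u v. \<exists>x. (R (R u), R (R v)) = K (K x) \<and> norm x \<le> M * (norm u + norm v)"
proof -
  define X where "X = (\<lambda>z. (- fst z - Q' (R (snd z)), - snd z - Q (R (- fst z - Q' (R (snd z))))))"
  have "bounded_linear X"
    unfolding X_def
    by (intro bounded_linear_Pair bounded_linear_minus bounded_linear_sub
        bounded_linear_compose[OF bounded_linear_Q] bounded_linear_compose[OF bounded_linear_R]
        bounded_linear_compose[OF bounded_linear_Q'] bounded_linear_fst bounded_linear_snd)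
  then obtain M where M: "M > 0" "\<And>v. norm (X v) \<le> norm v * M"
    using bounded_linear.pos_bounded by blast
  show thesis
  proof (rule that[OF M(1)])
    fix u v
    have "(R (R u), R (R v)) = K (K (X (u, v)))"
      by (simp add: X_def prod_eq_iff Q_R R.add R.diff R.neg Q.diff Q.neg algebra_simps)
    moreover have "norm (X (u, v)) \<le> M * (norm u + norm v)"
    proof -
      have "norm (X (u, v)) \<le> norm (u, v) * M" by (rule M)
      also have "\<dots> \<le> (norm u + norm v) * M" using M norm_Pair_le[of u v] by (intro mult_right_mono) auto
      finally show ?thesis by (simp add: mult.commute)
    qed
    ultimately show "\<exists>x. (R (R u), R (R v)) = K (K x) \<and> norm x \<le> M * (norm u + norm v)" by blast
  qed
qed

end


lemma has_integral_interval_difference: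
  fixes f F :: "real \<Rightarrow> real"
  assumes "(f has_integral F t) {0..t}" "(f has_integral F s) {0..s}" "0 \<le> s" "s \<le> t"
  shows "(f has_integral F t - F s) {s..t}"
proof -
  have i: "f integrable_on {0..t}" using assms(1) by blast
  have "integral {0..s} f + integral {s..t} f = integral {0..t} f"
    using assms(3,4) by (intro Henstock_Kurzweil_Integration.integral_combine i) auto
  then have "integral {s..t} f = F t - F s"
    using integral_unique[OF assms(1)] integral_unique[OF assms(2)] by simp
  moreover have "f integrable_on {s..t}"
    using assms(3,4) by (intro integrable_subinterval_real[OF i]) auto
  ultimately show ?thesis by (metis has_integral_integral)
qed

section \<open>Projections onto finite dimensional subspaces\<close>

lemma finite_dimensional_projection:
  fixes B :: "'a::real_inner set"
  assumes "finite B"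
  obtains E where "finite E" "E \<subseteq> span B"
    "\<And>x y. y \<in> span B \<Longrightarrow> (x - (\<Sum>e\<in>E. ((x \<bullet> e) / (e \<bullet> e)) *\<^sub>R e)) \<bullet> y = 0"
proof -
  obtain E where E: "finite E" "span E = span B" "pairwise orthogonal E"
    using basis_orthogonal[OF assms] by blast
  define P where "P x = (\<Sum>e\<in>E. ((x \<bullet> e) / (e \<bullet> e)) *\<^sub>R e)" for x
  have basis: "(x - P x) \<bullet> e = 0" if e: "e \<in> E" for x e
  proof -
    have "P x \<bullet> e = (\<Sum>f\<in>E. (x \<bullet> f) / (f \<bullet> f) * (f \<bullet> e))" by (simp add: P_def inner_sum_left)
    also have "\<dots> = (\<Sum>f\<in>E. if f = e then x \<bullet> e else 0)"
    proof (rule sum.cong)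
      fix f assume f: "f \<in> E"
      show "(x \<bullet> f) / (f \<bullet> f) * (f \<bullet> e) = (if f = e then x \<bullet> e else 0)"
      proof (cases "f = e")
        case True then show ?thesis by (cases "e = 0") auto
      next
        case False then show ?thesis using E(3) e f by (simp add: pairwise_def orthogonal_def)
      qed
    qed simp
    also have "\<dots> = x \<bullet> e" using e E(1) by simp
    finally show ?thesis by (simp add: inner_diff_left)
  qed
  have "(x - P x) \<bullet> y = 0" if "y \<in> span B" for x y
    using that unfolding E(2)[symmetric]
    by (induction rule: span_induct_alt) (simp_all add: inner_add_right basis)
  moreover have "E \<subseteq> span B" using E(2) span_superset by blast
  ultimately show thesis using that[of E] E(1) by (simp add: P_def)
qed

section \<open>Galerkin approximation\<close>

locale galerkin = damped_wave R Q Q' + sqrt_inverse A R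
  for A :: "'h::{real_inner,complete_space} \<rightharpoonup> 'h" and R Q Q' :: "'h \<Rightarrow> 'h" +
  fixes V :: "'h set" and \<tau> :: real
  assumes V_span: "\<exists>B. finite B \<and> V = span B" and V_dom: "V \<subseteq> range R" and \<tau>: "0 < \<tau>"
begin

abbreviation half :: "'h \<Rightarrow> 'h" where "half x \<equiv> ap (op_sqrt A) x"

lemma V_half: "v \<in> V \<Longrightarrow> R (half v) = v"
  using V_dom by auto

lemma subspace_V: "subspace V"
  using V_span by auto

lemma projection_exists:
  obtains P where "bounded_linear P" "\<And>y. R (P y) \<in> V" "\<And>y f. R f \<in> V \<Longrightarrow> (y - P y) \<bullet> f = 0"
proof -
  obtain B where B: "finite B" "V = span B" using V_span by blast
  have "R ` span (half ` B) = span (R ` half ` B)" by (rule linear_span_image[OF R.linear_axioms, symmetric])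
  also have "R ` half ` B = B" using V_half B(2) span_superset[of B] by (force simp: image_image)
  finally have RB: "R ` span (half ` B) = V" by (simp add: B(2))
  obtain E where E: "finite E" "E \<subseteq> span (half ` B)"
    "\<And>x y. y \<in> span (half ` B) \<Longrightarrow> (x - (\<Sum>e\<in>E. ((x \<bullet> e) / (e \<bullet> e)) *\<^sub>R e)) \<bullet> y = 0"
    using finite_dimensional_projection[of "half ` B"] B(1) by blast
  show thesis
  proof (rule that[of "\<lambda>x. \<Sum>e\<in>E. ((x \<bullet> e) / (e \<bullet> e)) *\<^sub>R e"])
    show "bounded_linear (\<lambda>x. \<Sum>e\<in>E. ((x \<bullet> e) / (e \<bullet> e)) *\<^sub>R e)"
      by (intro bounded_linear_sum bounded_linear_compose[OF bounded_linear_scaleR_left]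
          bounded_linear_compose[OF bounded_linear_divide] bounded_linear_inner_left)
    show "R (\<Sum>e\<in>E. ((y \<bullet> e) / (e \<bullet> e)) *\<^sub>R e) \<in> V" for y
    proof -
      have "(\<Sum>e\<in>E. ((y \<bullet> e) / (e \<bullet> e)) *\<^sub>R e) \<in> span (half ` B)"
        using E(2) by (intro span_sum span_scale) auto
      then show ?thesis using RB by blast
    qed
    show "(y - (\<Sum>e\<in>E. ((y \<bullet> e) / (e \<bullet> e)) *\<^sub>R e)) \<bullet> f = 0" if f: "R f \<in> V" for y f
    proof (rule E(3))
      obtain f' where "f' \<in> span (half ` B)" "R f = R f'" using f RB by (metis imageE)
      then show "f \<in> span (half ` B)" using inj_R by (simp add: inj_eq)
    qed
  qed
qed

text \<open>The Galerkin projection in coordinates: the orthogonal projection onto \<open>R\<^sup>-\<^sup>1 V\<close>.\<close>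

definition proj :: "'h \<Rightarrow> 'h" where "proj y = half (galerkin_projection A V (R y))"

lemma
  shows proj_linear: "bounded_linear proj" and proj_V: "R (proj y) \<in> V"
    and proj_orthogonal: "R f \<in> V \<Longrightarrow> (y - proj y) \<bullet> f = 0"
    and galerkin_projection_R: "galerkin_projection A V (R y) = R (proj y)"
proof -
  obtain P where P: "bounded_linear P" "\<And>y. R (P y) \<in> V" "\<And>y f. R f \<in> V \<Longrightarrow> (y - P y) \<bullet> f = 0"
    using projection_exists by blast
  have GP: "galerkin_projection A V (R y) = R (P y)" for y
    unfolding galerkin_projection_def
  proof (rule the_equality)
    have half_diff: "half (R y - R u) = y - u" for y u by (simp add: R.diff[symmetric])
    show "R (P y) \<in> V \<and> (\<forall>\<phi>\<in>V. inner_half A (R y - R (P y)) \<phi> = 0)"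
    proof (intro conjI P ballI)
      fix \<phi> assume "\<phi> \<in> V"
      then show "inner_half A (R y - R (P y)) \<phi> = 0"
        using P(3)[of "half \<phi>" y] by (simp add: inner_half_def half_diff V_half)
    qed
    fix v assume v: "v \<in> V \<and> (\<forall>\<phi>\<in>V. inner_half A (R y - v) \<phi> = 0)"
    define u where "u = half v"
    have vu: "v = R u" using v V_half by (simp add: u_def)
    have d: "R (u - P y) \<in> V" using v P(2)[of y] subspace_V by (simp add: R.diff vu subspace_diff)
    have "inner_half A (R y - v) (R (u - P y)) = 0" using v d by blast
    then have "(y - u) \<bullet> (u - P y) = 0" by (simp add: inner_half_def vu half_diff)
    moreover have "(y - P y) \<bullet> (u - P y) = 0" by (rule P(3)[OF d])
    ultimately have "((y - P y) - (y - u)) \<bullet> (u - P y) = 0" by (simp only: inner_diff_left[of "y - P y"])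
    then have "(u - P y) \<bullet> (u - P y) = 0" 
    proof -
      have "(y - P y) - (y - u) = u - P y" by simp
      then show ?thesis using \<open>((y - P y) - (y - u)) \<bullet> (u - P y) = 0\<close> by (simp only:)
    qed
    then show "v = R (P y)" by (simp add: vu)
  qed
  then have eq: "proj = P" by (simp add: proj_def fun_eq_iff)
  show "bounded_linear proj" "R (proj y) \<in> V" "R f \<in> V \<Longrightarrow> (y - proj y) \<bullet> f = 0"
    "galerkin_projection A V (R y) = R (proj y)"
    unfolding eq by (fact P GP)+
qed

sublocale proj: bounded_linear proj by (rule proj_linear)

lemma proj_id: "R y \<in> V \<Longrightarrow> proj y = y"
proof -
  assume "R y \<in> V"
  then have "R (y - proj y) \<in> V" using proj_V subspace_V by (simp add: R.diff subspace_diff)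
  then have "(y - proj y) \<bullet> (y - proj y) = 0" by (rule proj_orthogonal)
  then show ?thesis by simp
qed

lemma galerkin_projection_id: "v \<in> V \<Longrightarrow> galerkin_projection A V v = v"
  using galerkin_projection_R[of "half v"] proj_id[of "half v"] by (simp add: V_half)

lemma V_structure:
  "\<exists>E. finite E \<and> E \<subseteq> V \<and> (\<forall>v\<in>V. (\<Sum>e\<in>E. ((v \<bullet> e) / (e \<bullet> e)) *\<^sub>R e) = v) \<and>
    (\<forall>x. \<forall>v\<in>V. (x - (\<Sum>e\<in>E. ((x \<bullet> e) / (e \<bullet> e)) *\<^sub>R e)) \<bullet> v = 0)"
proof -
  obtain B where B: "finite B" "V = span B" using V_span by blast
  obtain E where E: "finite E" "E \<subseteq> span B"
    "\<And>x y. y \<in> span B \<Longrightarrow> (x - (\<Sum>e\<in>E. ((x \<bullet> e) / (e \<bullet> e)) *\<^sub>R e)) \<bullet> y = 0"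
    using finite_dimensional_projection[OF B(1)] by blast
  have "(\<Sum>e\<in>E. ((v \<bullet> e) / (e \<bullet> e)) *\<^sub>R e) = v" if v: "v \<in> V" for v
  proof -
    have "v - (\<Sum>e\<in>E. ((v \<bullet> e) / (e \<bullet> e)) *\<^sub>R e) \<in> span B"
      using v E(2) B(2) by (intro span_diff span_sum span_scale) auto
    then have "(v - (\<Sum>e\<in>E. ((v \<bullet> e) / (e \<bullet> e)) *\<^sub>R e)) \<bullet> (v - (\<Sum>e\<in>E. ((v \<bullet> e) / (e \<bullet> e)) *\<^sub>R e)) = 0"
      by (rule E(3))
    then show ?thesis by simp
  qed
  then show ?thesis using E B(2) by (intro exI[of _ E] conjI ballI allI) auto
qed

lemma orthogonal_projection_V:
  "\<exists>P. bounded_linear P \<and> (\<forall>x. P x \<in> V) \<and> (\<forall>v\<in>V. P v = v) \<and> (\<forall>x. \<forall>v\<in>V. P x \<bullet> v = x \<bullet> v)"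
proof -
  obtain E where E: "finite E" "E \<subseteq> V" "\<forall>v\<in>V. (\<Sum>e\<in>E. ((v \<bullet> e) / (e \<bullet> e)) *\<^sub>R e) = v"
    "\<forall>x. \<forall>v\<in>V. (x - (\<Sum>e\<in>E. ((x \<bullet> e) / (e \<bullet> e)) *\<^sub>R e)) \<bullet> v = 0"
    using V_structure by blast
  let ?P = "\<lambda>x. \<Sum>e\<in>E. ((x \<bullet> e) / (e \<bullet> e)) *\<^sub>R e"
  have "bounded_linear ?P"
    by (intro bounded_linear_sum bounded_linear_compose[OF bounded_linear_scaleR_left]
        bounded_linear_compose[OF bounded_linear_divide] bounded_linear_inner_left)
  moreover have "?P x \<in> V" for x
    using E(2) subspace_V by (intro subspace_sum subspace_scale) auto
  moreover have "?P x \<bullet> v = x \<bullet> v" if "v \<in> V" for x v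
  proof -
    have "(x - ?P x) \<bullet> v = 0" using E(4) that by blast
    then have "x \<bullet> v - ?P x \<bullet> v = 0" by (simp only: inner_diff_left)
    then show ?thesis by (rule eq_iff_diff_eq_0[THEN iffD2, symmetric])
  qed
  ultimately show ?thesis using E(3) by (intro exI[of _ ?P]) blast
qed

text \<open>An inverse inequality. Its constant may depend on \<open>V\<close>: it serves continuity arguments and
  does not enter any error bound.\<close>

lemma half_bounded_on_V:
  "\<exists>G. bounded_linear G \<and> (\<forall>v\<in>V. G v = half v)"
proof -
  obtain E where E: "finite E" "E \<subseteq> V" "\<forall>v\<in>V. (\<Sum>e\<in>E. ((v \<bullet> e) / (e \<bullet> e)) *\<^sub>R e) = v"
    using V_structure by blast
  let ?G = "\<lambda>x. \<Sum>e\<in>E. ((x \<bullet> e) / (e \<bullet> e)) *\<^sub>R half e"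
  have "bounded_linear ?G"
    by (intro bounded_linear_sum bounded_linear_compose[OF bounded_linear_scaleR_left]
        bounded_linear_compose[OF bounded_linear_divide] bounded_linear_inner_left)
  moreover have "?G v = half v" if v: "v \<in> V" for v
  proof -
    have "R (?G v) = (\<Sum>e\<in>E. ((v \<bullet> e) / (e \<bullet> e)) *\<^sub>R e)" unfolding R.sum R.scaleR
      by (rule sum.cong) (use E(2) V_half in auto)
    then have "R (?G v) = R (half v)" using E(3) v V_half[OF v] by simp
    then show ?thesis using inj_R by (simp add: inj_eq)
  qed
  ultimately show ?thesis by blast
qed

lemma continuous_on_V:
  fixes S :: "real set"
  assumes f: "\<And>t. t \<in> S \<Longrightarrow> f t \<in> V" "\<And>v. continuous_on S (\<lambda>t. f t \<bullet> v)"
  shows "continuous_on S f"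
proof -
  obtain E where E: "finite E" "E \<subseteq> V" "\<forall>v\<in>V. (\<Sum>e\<in>E. ((v \<bullet> e) / (e \<bullet> e)) *\<^sub>R e) = v"
    using V_structure by blast
  have "continuous_on S (\<lambda>t. \<Sum>e\<in>E. ((f t \<bullet> e) / (e \<bullet> e)) *\<^sub>R e)"
    unfolding divide_inverse by (intro continuous_on_sum continuous_on_scaleR continuous_on_mult f(2) continuous_on_const)
  moreover have "(\<Sum>e\<in>E. ((f t \<bullet> e) / (e \<bullet> e)) *\<^sub>R e) = f t" if "t \<in> S" for t using E(3) f(1) that by blast
  ultimately show ?thesis by (simp cong: continuous_on_cong)
qed

lemma derivative_in_V:
  assumes t: "t \<in> {0..\<tau>}" and der: "(e has_vector_derivative e') (at t within {0..\<tau>})"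
    and eV: "\<And>s. s \<in> {0..\<tau>} \<Longrightarrow> e s \<in> V"
  shows "e' \<in> V"
proof -
  obtain P where P: "bounded_linear P" "\<And>v. v \<in> V \<Longrightarrow> P v = v" "\<And>x. P x \<in> V"
    using orthogonal_projection_V by blast
  have "((\<lambda>t. P (e t)) has_vector_derivative P e') (at t within {0..\<tau>})"
    by (rule bounded_linear.has_vector_derivative[OF P(1) der])
  then have "(e has_vector_derivative P e') (at t within {0..\<tau>})"
    by (rule has_vector_derivative_transform[OF t, rotated]) (use eV P(2) in auto)
  then have "P e' = e'"
    using vector_derivative_unique_within_closed_interval[of 0 \<tau> t e] der t \<tau> by simp
  then show ?thesis using P(3) by metis
qed

section \<open>The energy estimate\<close>

text \<open>The function \<open>w\<close> is only integrable, so the energy norm \<open>n t\<close> is not differentiated. Testing the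
  increment from \<open>s\<close> to \<open>t\<close> with the solution at the later time \<open>t\<close>, the damping has the good sign and
  \<open>n t * n t \<le> n s * n t + n t * (integral {s..t} g + o (t - s))\<close>. Summation over a fine partition
  gives the claim.\<close>

lemma energy_estimate:
  assumes eV: "\<And>t. t \<in> {0..\<tau>} \<Longrightarrow> e t \<in> V"
    and e_der: "\<And>t. t \<in> {0..\<tau>} \<Longrightarrow> (e has_vector_derivative e' t) (at t within {0..\<tau>})"
    and e'_int: "\<And>t \<phi>. t \<in> {0..\<tau>} \<Longrightarrow> ((\<lambda>r. w r \<bullet> \<phi>) has_integral (e' t - e' 0) \<bullet> \<phi>) {0..t}"
    and N: "negligible N"
    and est: "\<And>t \<phi>. t \<in> {0..\<tau>} - N \<Longrightarrow> \<phi> \<in> V \<Longrightarrow>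
      w t \<bullet> \<phi> + inner_half A (e t) \<phi> + Q (e' t) \<bullet> \<phi> \<le> g t * norm \<phi>"
    and g: "g integrable_on {0..\<tau>}" and g0: "\<And>t. t \<in> {0..\<tau>} \<Longrightarrow> 0 \<le> g t"
  shows "state_norm A (e \<tau>, e' \<tau>) \<le> state_norm A (e 0, e' 0) + integral {0..\<tau>} g"
proof -
  obtain G where G: "bounded_linear G" "\<And>v. v \<in> V \<Longrightarrow> G v = half v"
    using half_bounded_on_V by blast
  interpret G: bounded_linear G by (rule G)
  have e'V: "e' t \<in> V" if t: "t \<in> {0..\<tau>}" for t
    by (rule derivative_in_V[OF t e_der[OF t] eV])
  define E F H where "E = (\<lambda>t. G (e t))" and "F = e'" and "H = (\<lambda>t. G (e' t))"
  have E_der: "(E has_vector_derivative H t) (at t within {0..\<tau>})" if "t \<in> {0..\<tau>}" for t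
    unfolding E_def H_def by (rule G.has_vector_derivative[OF e_der[OF that]])
  have contE: "continuous_on {0..\<tau>} E"
    unfolding continuous_on_eq_continuous_within
    using E_der has_vector_derivative_continuous by blast
  have contF: "continuous_on {0..\<tau>} F"
  proof (rule continuous_on_V)
    show "F t \<in> V" if "t \<in> {0..\<tau>}" for t using e'V that by (simp add: F_def)
    show "continuous_on {0..\<tau>} (\<lambda>t. F t \<bullet> v)" for v
    proof -
      have int: "(\<lambda>r. w r \<bullet> v) integrable_on {0..\<tau>}" using e'_int[of \<tau> v] \<tau> by auto
      have "continuous_on {0..\<tau>} (\<lambda>t. integral {0..t} (\<lambda>r. w r \<bullet> v) + e' 0 \<bullet> v)"
        by (intro continuous_on_add indefinite_integral_continuous_1[OF int] continuous_on_const)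
      moreover have "integral {0..t} (\<lambda>r. w r \<bullet> v) + e' 0 \<bullet> v = F t \<bullet> v" if "t \<in> {0..\<tau>}" for t
        using integral_unique[OF e'_int[OF that, of v]] by (simp add: F_def inner_diff_left)
      ultimately show ?thesis by (rule continuous_on_eq)
    qed
  qed
  have contH: "continuous_on {0..\<tau>} H"
    unfolding H_def using contF by (intro G.continuous_on) (simp add: F_def)
  have "uniformly_continuous_on {0..\<tau>} (\<lambda>t. (E t, F t, H t))"
    by (intro compact_uniformly_continuous continuous_on_Pair contE contF contH) simp
  then have uc: "\<exists>\<delta>>0. \<forall>s\<in>{0..\<tau>}. \<forall>t\<in>{0..\<tau>}. \<bar>s - t\<bar> < \<delta> \<longrightarrow>
      norm (E s - E t) \<le> \<epsilon> \<and> norm (F s - F t) \<le> \<epsilon> \<and> norm (H s - H t) \<le> \<epsilon>" if "0 < \<epsilon>" for \<epsilon>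
  proof -
    obtain \<delta> where \<delta>: "\<delta> > 0" "\<And>s t. s \<in> {0..\<tau>} \<Longrightarrow> t \<in> {0..\<tau>} \<Longrightarrow> dist s t < \<delta> \<Longrightarrow>
        dist (E s, F s, H s) (E t, F t, H t) < \<epsilon>"
      using \<open>uniformly_continuous_on _ _\<close> \<open>0 < \<epsilon>\<close> unfolding uniformly_continuous_on_def
      by (metis dist_commute)
    have le: "norm x \<le> norm (x, y, z)" "norm y \<le> norm (x, y, z)" "norm z \<le> norm (x, y, z)" for x y z :: 'h
      using norm_fst_le[of x "(y, z)"] norm_snd_le[of "(y, z)" x] norm_fst_le[of y z] norm_snd_le[of z y]
      by linarith+
    show ?thesis
    proof (intro exI[of _ \<delta>] conjI ballI impI \<delta>(1))
      fix s t assume "s \<in> {0..\<tau>}" "t \<in> {0..\<tau>}" "\<bar>s - t\<bar> < \<delta>"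
      then have "norm (E s - E t, F s - F t, H s - H t) < \<epsilon>" using \<delta>(2)[of s t] by (simp add: dist_norm)
      then show "norm (E s - E t) \<le> \<epsilon>" "norm (F s - F t) \<le> \<epsilon>" "norm (H s - H t) \<le> \<epsilon>"
        using le by (meson less_imp_le order_trans)+
    qed
  qed
  define n where "n t = norm (E t, F t)" for t
  have n_state: "state_norm A (e t, e' t) = n t" if "t \<in> {0..\<tau>}" for t
    using state_norm_R[of "half (e t)" "e' t"] eV[OF that] by (simp add: V_half n_def E_def F_def G)
  have nE: "norm (E t) \<le> n t" and nF: "norm (F t) \<le> n t" and n0: "0 \<le> n t"
    and nsq: "(n t)\<^sup>2 = E t \<bullet> E t + F t \<bullet> F t" for t
    unfolding n_def
    by (simp_all add: norm_fst_le norm_snd_le) (simp add: norm_Pair power2_norm_eq_inner)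
  obtain cg where cg: "cg > 0" "\<And>x. norm (G x) \<le> norm x * cg" using G.pos_bounded by blast
  obtain cq where cq: "cq > 0" "\<And>x. norm (Q x) \<le> norm x * cq" using Q.pos_bounded by blast
  define c where "c = 1 + cg + cq"
  have c: "c > 0" using cg cq by (simp add: c_def)
  have step: "n t \<le> n s + (\<epsilon> * c * (t - s) + integral {s..t} g)"
    if st: "0 \<le> s" "s < t" "t \<le> \<tau>" and close: "\<And>r. r \<in> {s..t} \<Longrightarrow>
      norm (E r - E t) \<le> \<epsilon> \<and> norm (F r - F t) \<le> \<epsilon> \<and> norm (H r - H t) \<le> \<epsilon>" and \<epsilon>: "0 < \<epsilon>" for s t \<epsilon>
  proof -
    have sub: "{s..t} \<subseteq> {0..\<tau>}" using st by auto
    have gst: "g integrable_on {s..t}" by (rule integrable_subinterval_real[OF g sub])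
    define k where "k r = H r \<bullet> E t + w r \<bullet> F t" for r
    have i1: "((\<lambda>r. H r \<bullet> E t) has_integral (E t \<bullet> E t - E s \<bullet> E t)) {s..t}"
    proof (rule fundamental_theorem_of_calculus)
      show "((\<lambda>r. E r \<bullet> E t) has_vector_derivative H r \<bullet> E t) (at r within {s..t})" if "r \<in> {s..t}" for r
        using has_vector_derivative_within_subset[OF E_der sub] that sub
        by (intro bounded_linear.has_vector_derivative[OF bounded_linear_inner_left]) auto
    qed (use st in simp)
    have i2: "((\<lambda>r. w r \<bullet> F t) has_integral (F t \<bullet> F t - F s \<bullet> F t)) {s..t}"
    proof -
      have "((\<lambda>r. w r \<bullet> F t) has_integral (F t - F 0) \<bullet> F t - (F s - F 0) \<bullet> F t) {s..t}"
        unfolding F_def using st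
        by (intro has_integral_interval_difference[where F = "\<lambda>r. (e' r - e' 0) \<bullet> e' t"] e'_int) auto
      then show ?thesis by (simp add: inner_diff_left)
    qed
    have k_int: "(k has_integral ((n t)\<^sup>2 - (E s \<bullet> E t + F s \<bullet> F t))) {s..t}"
    proof -
      have "(n t)\<^sup>2 - (E s \<bullet> E t + F s \<bullet> F t) = (E t \<bullet> E t - E s \<bullet> E t) + (F t \<bullet> F t - F s \<bullet> F t)"
        unfolding nsq by linarith
      then show ?thesis unfolding k_def using has_integral_add[OF i1 i2] by (simp only:)
    qed
    define m where "m r = (\<epsilon> * c + g r) * n t" for r
    have k_le: "k r \<le> m r" if r: "r \<in> {s..t} - N" for r
    proof -
      have r\<tau>: "r \<in> {0..\<tau>}" and t\<tau>: "t \<in> {0..\<tau>}" using r sub st by auto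
      have cl: "norm (E r - E t) \<le> \<epsilon>" "norm (F r - F t) \<le> \<epsilon>" "norm (H r - H t) \<le> \<epsilon>" using close r by auto
      have "w r \<bullet> F t + inner_half A (e r) (F t) + Q (F r) \<bullet> F t \<le> g r * norm (F t)"
        using est[of r "F t"] r r\<tau> e'V[OF t\<tau>] by (simp add: F_def)
      moreover have "inner_half A (e r) (F t) = E r \<bullet> H t"
        using eV[OF r\<tau>] e'V[OF t\<tau>] by (simp add: inner_half_def E_def H_def F_def G)
      ultimately have "k r \<le> H r \<bullet> E t - E r \<bullet> H t - Q (F r) \<bullet> F t + g r * norm (F t)"
        by (simp add: k_def)
      also have "\<dots> = (H r - H t) \<bullet> E t + (E t - E r) \<bullet> H t + Q (F t - F r) \<bullet> F t - Q (F t) \<bullet> F t + g r * norm (F t)"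
        by (simp add: inner_diff_left Q.diff inner_commute[of "H t" "E t"])
      also have "\<dots> \<le> \<epsilon> * n t + \<epsilon> * (n t * cg) + (\<epsilon> * cq) * n t - 0 + g r * n t"
      proof (intro add_mono diff_mono)
        have "(H r - H t) \<bullet> E t \<le> norm (H r - H t) * norm (E t)" by (rule norm_cauchy_schwarz)
        also have "\<dots> \<le> \<epsilon> * n t" using cl nE \<epsilon> by (intro mult_mono) auto
        finally show "(H r - H t) \<bullet> E t \<le> \<epsilon> * n t" .
        have "norm (E t - E r) * norm (H t) \<le> \<epsilon> * (n t * cg)" if "norm (H t) \<le> n t * cg"
          using cl(1) \<epsilon> that by (intro mult_mono) (auto simp: norm_minus_commute)
        moreover have "norm (H t) \<le> n t * cg"
          using cg(2)[of "F t"] mult_right_mono[OF nF[of t] less_imp_le[OF cg(1)]] by (simp add: H_def F_def)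
        moreover have "(E t - E r) \<bullet> H t \<le> norm (E t - E r) * norm (H t)" by (rule norm_cauchy_schwarz)
        ultimately show "(E t - E r) \<bullet> H t \<le> \<epsilon> * (n t * cg)"
          by linarith
        have "norm (Q (F t - F r)) \<le> norm (F t - F r) * cq" by (rule cq)
        also have "\<dots> \<le> \<epsilon> * cq" using cl(2) cq(1) by (intro mult_right_mono) (auto simp: norm_minus_commute)
        finally have "norm (Q (F t - F r)) * norm (F t) \<le> (\<epsilon> * cq) * n t"
          using nF[of t] \<epsilon> cq(1) by (intro mult_mono) auto
        then show "Q (F t - F r) \<bullet> F t \<le> (\<epsilon> * cq) * n t"
          using norm_cauchy_schwarz[of "Q (F t - F r)" "F t"] by linarith
        show "0 \<le> Q (F t) \<bullet> F t" by (rule nonneg_Q)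
        show "g r * norm (F t) \<le> g r * n t" using g0[OF r\<tau>] nF by (intro mult_left_mono) auto
      qed
      also have "\<dots> = m r" by (simp add: m_def c_def algebra_simps)
      finally show ?thesis .
    qed
    have m_int: "(m has_integral (\<epsilon> * c * (t - s) + integral {s..t} g) * n t) {s..t}"
    proof -
      have "((\<lambda>r. \<epsilon> * c) has_integral (t - s) *\<^sub>R (\<epsilon> * c)) {s..t}"
        using has_integral_const_real[of "\<epsilon> * c" s t] st by simp
      from has_integral_add[OF this integrable_integral[OF gst]]
      have "((\<lambda>r. \<epsilon> * c + g r) has_integral (\<epsilon> * c * (t - s) + integral {s..t} g)) {s..t}"
        by (simp add: mult.commute)
      then show ?thesis unfolding m_def by (rule has_integral_mult_left)
    qed
    have "((\<lambda>r. if r \<in> N then m r else k r) has_integral ((n t)\<^sup>2 - (E s \<bullet> E t + F s \<bullet> F t))) {s..t}"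
      by (rule has_integral_spike[OF N _ k_int]) simp
    then have "(n t)\<^sup>2 - (E s \<bullet> E t + F s \<bullet> F t) \<le> (\<epsilon> * c * (t - s) + integral {s..t} g) * n t"
      by (rule has_integral_le[OF _ m_int]) (use k_le in auto)
    moreover have "E s \<bullet> E t + F s \<bullet> F t \<le> n s * n t"
      using norm_cauchy_schwarz[of "(E s, F s)" "(E t, F t)"] by (simp add: n_def)
    ultimately have main: "n t * n t \<le> (n s + (\<epsilon> * c * (t - s) + integral {s..t} g)) * n t"
      by (simp add: power2_eq_square algebra_simps)
    have "0 \<le> integral {s..t} g" using gst g0 sub by (intro integral_nonneg) auto
    then have pos: "0 \<le> n s + (\<epsilon> * c * (t - s) + integral {s..t} g)"
      using n0[of s] \<epsilon> c st by simp
    show ?thesis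
    proof (cases "n t = 0")
      case False
      then show ?thesis using main n0[of t] by simp
    qed (use pos in simp)
  qed
  show ?thesis
  proof (rule field_le_epsilon)
    fix \<rho> :: real assume \<rho>: "0 < \<rho>"
    define \<epsilon> where "\<epsilon> = \<rho> / (c * \<tau>)"
    have \<epsilon>: "0 < \<epsilon>" using \<rho> c \<tau> by (simp add: \<epsilon>_def)
    obtain \<delta> where \<delta>: "\<delta> > 0" "\<And>s t. s \<in> {0..\<tau>} \<Longrightarrow> t \<in> {0..\<tau>} \<Longrightarrow> \<bar>s - t\<bar> < \<delta> \<Longrightarrow>
      norm (E s - E t) \<le> \<epsilon> \<and> norm (F s - F t) \<le> \<epsilon> \<and> norm (H s - H t) \<le> \<epsilon>" using uc[OF \<epsilon>] by blast
    have chain: "n t \<le> n 0 + (\<epsilon> * c * t + integral {0..t} g)"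
      if "0 \<le> t" "t \<le> \<tau>" "t \<le> real j * (\<delta> / 2)" for t and j :: nat
      using that
    proof (induction j arbitrary: t)
      case 0 then show ?case by simp
    next
      case (Suc j)
      show ?case
      proof (cases "t \<le> real j * (\<delta> / 2)")
        case True then show ?thesis using Suc by blast
      next
        case False
        define s where "s = real j * (\<delta> / 2)"
        have s: "0 \<le> s" "s < t" "t - s < \<delta>" using False Suc.prems \<delta>(1) by (auto simp: s_def algebra_simps)
        have "n t \<le> n s + (\<epsilon> * c * (t - s) + integral {s..t} g)"
        proof (rule step[OF s(1,2) Suc.prems(2) _ \<epsilon>])
          fix r assume "r \<in> {s..t}"
          then show "norm (E r - E t) \<le> \<epsilon> \<and> norm (F r - F t) \<le> \<epsilon> \<and> norm (H r - H t) \<le> \<epsilon>"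
            using s Suc.prems by (intro \<delta>(2)) auto
        qed
        also have "n s \<le> n 0 + (\<epsilon> * c * s + integral {0..s} g)"
          using s Suc.prems by (intro Suc.IH) (auto simp: s_def)
        finally have "n t \<le> n 0 + (\<epsilon> * c * t + (integral {0..s} g + integral {s..t} g))"
          by (simp add: algebra_simps)
        also have "integral {0..s} g + integral {s..t} g = integral {0..t} g"
          using s Suc.prems
          by (intro Henstock_Kurzweil_Integration.integral_combine integrable_subinterval_real[OF g]) auto
        finally show ?thesis .
      qed
    qed
    obtain j :: nat where "\<tau> / (\<delta> / 2) < real j" using reals_Archimedean2 by blast
    then have "\<tau> \<le> real j * (\<delta> / 2)" using \<delta>(1) by (simp add: field_simps)
    then have "n \<tau> \<le> n 0 + (\<epsilon> * c * \<tau> + integral {0..\<tau>} g)" using chain \<tau> by simp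
    moreover have "\<epsilon> * c * \<tau> = \<rho>" using c \<tau> by (simp add: \<epsilon>_def)
    ultimately show "state_norm A (e \<tau>, e' \<tau>) \<le> state_norm A (e 0, e' 0) + integral {0..\<tau>} g + \<rho>"
      using n_state[of \<tau>] n_state[of 0] \<tau> by simp
  qed
qed

end


section \<open>Comparison of weak and exact solutions\<close>

lemma AE_lebesgue_on_negligible:
  assumes "AE t in lebesgue_on {0..\<tau>::real}. P t"
  obtains N where "negligible N" "\<And>t. t \<in> {0..\<tau>} - N \<Longrightarrow> P t"
proof -
  have "AE t in lebesgue. t \<in> {0..\<tau>} \<longrightarrow> P t"
    using assms by (subst (asm) AE_restrict_space_iff) auto
  then obtain N where N: "N \<in> null_sets lebesgue" "{t \<in> space lebesgue. \<not> (t \<in> {0..\<tau>} \<longrightarrow> P t)} \<subseteq> N"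
    unfolding eventually_ae_filter by blast
  show thesis
  proof (rule that[of N])
    show "negligible N" using N(1) by (simp add: negligible_iff_null_sets)
    show "P t" if "t \<in> {0..\<tau>} - N" for t using N(2) that by auto
  qed
qed

lemma reflected_derivative:
  fixes f :: "real \<Rightarrow> 'a::real_normed_vector"
  assumes "(f has_vector_derivative f') (at (\<tau> - t) within {0..\<tau>})"
  shows "((\<lambda>t. f (\<tau> - t)) has_vector_derivative - f') (at t within {0..\<tau>})"
proof -
  have "((\<lambda>t. \<tau> - t) has_vector_derivative - 1) (at t within {0..\<tau>})"
    by (auto intro!: derivative_eq_intros)
  moreover have "(\<lambda>t. \<tau> - t) ` {0..\<tau>} = {0..\<tau>}" by simp
  ultimately show ?thesis
    using vector_diff_chain_within[of "\<lambda>t. \<tau> - t" "-1" t "{0..\<tau>}" f f'] assms by (simp add: o_def)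
qed

lemma reflected_integral:
  fixes f :: "real \<Rightarrow> real"
  assumes "(f has_integral i) {\<tau> - t..\<tau>}"
  shows "((\<lambda>r. f (\<tau> - r)) has_integral i) {0..t}"
  using has_integral_affinity[of f i "\<tau> - t" \<tau> "-1" \<tau>] assms by (simp add: image_affinity_cbox algebra_simps)

context galerkin
begin

text \<open>The Galerkin equation with source \<open>f\<close> on \<open>[0, \<tau>]\<close>. The second derivative enters only through real
  integrals of its inner products, so the notion covers the discrete semigroups and the observers.\<close>

definition weak_solution :: "(real \<Rightarrow> 'h) \<Rightarrow> (real \<Rightarrow> 'h) \<Rightarrow> (real \<Rightarrow> 'h) \<Rightarrow> bool" where
  "weak_solution f p p' \<longleftrightarrow> (\<exists>p''.
    (\<forall>t\<in>{0..\<tau>}. p t \<in> V \<and> (p has_vector_derivative p' t) (at t within {0..\<tau>}) \<and>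
      (\<forall>\<phi>. ((\<lambda>r. p'' r \<bullet> \<phi>) has_integral (p' t - p' 0) \<bullet> \<phi>) {0..t})) \<and>
    (\<exists>N. negligible N \<and> (\<forall>t\<in>{0..\<tau>} - N. \<forall>\<phi>\<in>V.
      p'' t \<bullet> \<phi> + inner_half A (p t) \<phi> + Q (p' t) \<bullet> \<phi> = f t \<bullet> \<phi>)))"

text \<open>The functions \<open>a\<close>, \<open>b\<close>, \<open>d\<close> represent \<open>p = R a\<close>, \<open>p' = R b\<close>, \<open>p'' = R d\<close>, with derivatives in the
  energy norm. The last equation is \<open>p'' + A p + Q p' = f\<close>, solved for \<open>A p = R\<^sup>-\<^sup>1 a\<close>.\<close>

definition exact_solution :: "(real \<Rightarrow> 'h) \<Rightarrow> (real \<Rightarrow> 'h) \<Rightarrow> (real \<Rightarrow> 'h) \<Rightarrow> (real \<Rightarrow> 'h) \<Rightarrow> bool" where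
  "exact_solution f a b d \<longleftrightarrow> (\<forall>t\<in>{0..\<tau>}.
    (a has_vector_derivative b t) (at t within {0..\<tau>}) \<and>
    (b has_vector_derivative d t) (at t within {0..\<tau>}) \<and>
    a t = R (f t - R (d t) - Q (R (b t))))"

lemma exact_solution_zero: "exact_solution (\<lambda>_. 0) (\<lambda>_. 0) (\<lambda>_. 0) (\<lambda>_. 0)"
  by (simp add: exact_solution_def R.zero Q.zero)

lemma exact_solution_diff:
  assumes "exact_solution f a b d" "exact_solution f' a' b' d'"
  shows "exact_solution (\<lambda>t. f t - f' t) (\<lambda>t. a t - a' t) (\<lambda>t. b t - b' t) (\<lambda>t. d t - d' t)"
  unfolding exact_solution_def
proof (intro ballI conjI)
  fix t assume t: "t \<in> {0..\<tau>}"
  show "((\<lambda>t. a t - a' t) has_vector_derivative b t - b' t) (at t within {0..\<tau>})"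
    "((\<lambda>t. b t - b' t) has_vector_derivative d t - d' t) (at t within {0..\<tau>})"
    using assms t unfolding exact_solution_def by (auto intro!: has_vector_derivative_diff)
  have "a t = R (f t - R (d t) - Q (R (b t)))" "a' t = R (f' t - R (d' t) - Q (R (b' t)))"
    using assms t unfolding exact_solution_def by auto
  then show "a t - a' t = R (f t - f' t - R (d t - d' t) - Q (R (b t - b' t)))"
    by (simp only: R.diff Q.diff) (simp add: algebra_simps)
qed

text \<open>Reversing time changes the sign of the damping, which is corrected in the source.\<close>

lemma exact_solution_reflect:
  assumes "exact_solution f a b d"
  shows "exact_solution (\<lambda>t. f (\<tau> - t) - 2 *\<^sub>R Q (R (b (\<tau> - t))))
    (\<lambda>t. a (\<tau> - t)) (\<lambda>t. - b (\<tau> - t)) (\<lambda>t. d (\<tau> - t))"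
  unfolding exact_solution_def
proof (intro ballI conjI)
  fix t assume t: "t \<in> {0..\<tau>}"
  then have s: "\<tau> - t \<in> {0..\<tau>}" by auto
  show "((\<lambda>t. a (\<tau> - t)) has_vector_derivative - b (\<tau> - t)) (at t within {0..\<tau>})"
    using assms s unfolding exact_solution_def by (intro reflected_derivative) auto
  have "((\<lambda>t. - b (\<tau> - t)) has_vector_derivative - (- d (\<tau> - t))) (at t within {0..\<tau>})"
    using assms s unfolding exact_solution_def
    by (intro has_vector_derivative_minus reflected_derivative) auto
  then show "((\<lambda>t. - b (\<tau> - t)) has_vector_derivative d (\<tau> - t)) (at t within {0..\<tau>})" by simp
  have "a (\<tau> - t) = R (f (\<tau> - t) - R (d (\<tau> - t)) - Q (R (b (\<tau> - t))))"
    using assms s unfolding exact_solution_def by auto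
  then show "a (\<tau> - t) = R (f (\<tau> - t) - 2 *\<^sub>R Q (R (b (\<tau> - t))) - R (d (\<tau> - t)) - Q (R (- b (\<tau> - t))))"
    by (simp add: R.neg Q.neg scaleR_2 algebra_simps)
qed

lemma exact_solution_damped_flow:
  assumes "contraction_flow K T"
  shows "exact_solution (\<lambda>_. 0) (\<lambda>t. fst (T t (K (K x)))) (\<lambda>t. fst (T t (K x))) (\<lambda>t. fst (T t x))"
proof -
  interpret T: contraction_flow K T by fact
  show ?thesis
    unfolding exact_solution_def
  proof (intro ballI conjI)
    fix t assume t: "t \<in> {0..\<tau>}"
    have der: "((\<lambda>t. fst (T t (K u))) has_vector_derivative fst (T t u)) (at t within {0..\<tau>})" for u
      using t by (intro bounded_linear.has_vector_derivative[OF bounded_linear_fst]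
          has_vector_derivative_within_subset[OF T.T_derivative]) auto
    show "((\<lambda>t. fst (T t (K (K x)))) has_vector_derivative fst (T t (K x))) (at t within {0..\<tau>})"
      "((\<lambda>t. fst (T t (K x))) has_vector_derivative fst (T t x)) (at t within {0..\<tau>})" by (rule der)+
    have "fst (T t (K (K x))) = - R (snd (K (T t x)) + Q (R (fst (T t (K x)))))"
      using t by (simp add: T.T_commute)
    also have "\<dots> = R (0 - R (fst (T t x)) - Q (R (fst (T t (K x)))))"
      by (simp only: damped_inverse_simps R.diff R.add R.zero) simp
    finally show "fst (T t (K (K x))) = R (0 - R (fst (T t x)) - Q (R (fst (T t (K x)))))" .
  qed
qed

lemma exact_solution_wave_flow:
  assumes "contraction_flow J S"
  shows "exact_solution (\<lambda>t. Q (R (fst (S t (J y))))) (\<lambda>t. fst (S t (J (J y)))) (\<lambda>t. fst (S t (J y))) (\<lambda>t. fst (S t y))"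
proof -
  interpret S: contraction_flow J S by fact
  show ?thesis
    unfolding exact_solution_def
  proof (intro ballI conjI)
    fix t assume t: "t \<in> {0..\<tau>}"
    have der: "((\<lambda>t. fst (S t (J u))) has_vector_derivative fst (S t u)) (at t within {0..\<tau>})" for u
      using t by (intro bounded_linear.has_vector_derivative[OF bounded_linear_fst]
          has_vector_derivative_within_subset[OF S.T_derivative]) auto
    show "((\<lambda>t. fst (S t (J (J y)))) has_vector_derivative fst (S t (J y))) (at t within {0..\<tau>})"
      "((\<lambda>t. fst (S t (J y))) has_vector_derivative fst (S t y)) (at t within {0..\<tau>})" by (rule der)+
    have "fst (S t (J (J y))) = - R (snd (J (S t y)))"
      using t by (simp add: S.T_commute)
    also have "\<dots> = R (Q (R (fst (S t (J y)))) - R (fst (S t y)) - Q (R (fst (S t (J y)))))"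
      by (simp add: R.neg)
    finally show "fst (S t (J (J y))) = R (Q (R (fst (S t (J y)))) - R (fst (S t y)) - Q (R (fst (S t (J y)))))" .
  qed
qed

lemma weak_solution_diff:
  assumes "weak_solution f p p'" "weak_solution g q q'"
  shows "weak_solution (\<lambda>t. f t - g t) (\<lambda>t. p t - q t) (\<lambda>t. p' t - q' t)"
proof -
  obtain p'' N where p: "\<And>t. t \<in> {0..\<tau>} \<Longrightarrow> p t \<in> V"
    "\<And>t. t \<in> {0..\<tau>} \<Longrightarrow> (p has_vector_derivative p' t) (at t within {0..\<tau>})"
    "\<And>t \<phi>. t \<in> {0..\<tau>} \<Longrightarrow> ((\<lambda>r. p'' r \<bullet> \<phi>) has_integral (p' t - p' 0) \<bullet> \<phi>) {0..t}"
    "negligible N" "\<And>t \<phi>. t \<in> {0..\<tau>} - N \<Longrightarrow> \<phi> \<in> V \<Longrightarrow>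
      p'' t \<bullet> \<phi> + inner_half A (p t) \<phi> + Q (p' t) \<bullet> \<phi> = f t \<bullet> \<phi>"
    using assms(1) unfolding weak_solution_def by blast
  obtain q'' M where q: "\<And>t. t \<in> {0..\<tau>} \<Longrightarrow> q t \<in> V"
    "\<And>t. t \<in> {0..\<tau>} \<Longrightarrow> (q has_vector_derivative q' t) (at t within {0..\<tau>})"
    "\<And>t \<phi>. t \<in> {0..\<tau>} \<Longrightarrow> ((\<lambda>r. q'' r \<bullet> \<phi>) has_integral (q' t - q' 0) \<bullet> \<phi>) {0..t}"
    "negligible M" "\<And>t \<phi>. t \<in> {0..\<tau>} - M \<Longrightarrow> \<phi> \<in> V \<Longrightarrow>
      q'' t \<bullet> \<phi> + inner_half A (q t) \<phi> + Q (q' t) \<bullet> \<phi> = g t \<bullet> \<phi>"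
    using assms(2) unfolding weak_solution_def by blast
  show ?thesis
    unfolding weak_solution_def
  proof (intro exI[of _ "\<lambda>t. p'' t - q'' t"] exI[of _ "N \<union> M"] conjI ballI allI)
    fix t assume t: "t \<in> {0..\<tau>}"
    show "p t - q t \<in> V" using p(1) q(1) t subspace_V by (simp add: subspace_diff)
    show "((\<lambda>t. p t - q t) has_vector_derivative p' t - q' t) (at t within {0..\<tau>})"
      by (intro has_vector_derivative_diff p q t)
    fix \<phi>
    have "(p' t - q' t - (p' 0 - q' 0)) \<bullet> \<phi> = (p' t - p' 0) \<bullet> \<phi> - (q' t - q' 0) \<bullet> \<phi>"
      by (simp add: inner_diff_left)
    then show "((\<lambda>r. (p'' r - q'' r) \<bullet> \<phi>) has_integral (p' t - q' t - (p' 0 - q' 0)) \<bullet> \<phi>) {0..t}"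
      using has_integral_diff[OF p(3)[OF t, of \<phi>] q(3)[OF t, of \<phi>]] by (simp only: inner_diff_left)
  next
    show "negligible (N \<union> M)" using p(4) q(4) by (rule negligible_Un)
    fix t \<phi> assume t: "t \<in> {0..\<tau>} - (N \<union> M)" and \<phi>: "\<phi> \<in> V"
    have h: "inner_half A (p t - q t) \<phi> = inner_half A (p t) \<phi> - inner_half A (q t) \<phi>"
    proof -
      have "p t - q t = R (half (p t) - half (q t))" using p(1) q(1) t by (simp add: R.diff V_half)
      then show ?thesis by (simp add: inner_half_def inner_diff_left)
    qed
    show "(p'' t - q'' t) \<bullet> \<phi> + inner_half A (p t - q t) \<phi> + Q (p' t - q' t) \<bullet> \<phi> = (f t - g t) \<bullet> \<phi>"
      using p(5)[of t \<phi>] q(5)[of t \<phi>] t \<phi> by (simp add: h inner_diff_left Q.diff)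
  qed
qed

text \<open>The projection of \<open>p\<close> in the inner product of \<open>D(A\<^sup>1\<^sup>/\<^sup>2)\<close> drops out of the stiffness term. So it
  solves the Galerkin equation up to the projection errors of \<open>p'\<close> and \<open>p''\<close> in the norm of \<open>H\<close>.\<close>

lemma galerkin_error:
  assumes weak: "weak_solution fh p p'" and exact: "exact_solution f a b d"
    and approx: "\<And>y. norm (R (proj y) - R y) \<le> \<epsilon> * norm y" and \<epsilon>: "0 \<le> \<epsilon>"
    and D: "\<And>t. t \<in> {0..\<tau>} \<Longrightarrow> norm (d t) \<le> D" "\<And>t. t \<in> {0..\<tau>} \<Longrightarrow> norm (b t) \<le> D"
    and \<kappa>: "0 \<le> \<kappa>" "\<And>x. norm (Q x) \<le> \<kappa> * norm x"
    and int: "(\<lambda>t. norm (fh t - f t)) integrable_on {0..\<tau>}"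
  shows "state_norm A (p \<tau> - R (proj (a \<tau>)), p' \<tau> - R (proj (b \<tau>)))
    \<le> state_norm A (p 0 - R (proj (a 0)), p' 0 - R (proj (b 0)))
      + (\<epsilon> * (1 + \<kappa>) * D * \<tau> + integral {0..\<tau>} (\<lambda>t. norm (fh t - f t)))"
proof -
  obtain p'' N where p: "\<And>t. t \<in> {0..\<tau>} \<Longrightarrow> p t \<in> V"
    "\<And>t. t \<in> {0..\<tau>} \<Longrightarrow> (p has_vector_derivative p' t) (at t within {0..\<tau>})"
    "\<And>t \<phi>. t \<in> {0..\<tau>} \<Longrightarrow> ((\<lambda>r. p'' r \<bullet> \<phi>) has_integral (p' t - p' 0) \<bullet> \<phi>) {0..t}"
    "negligible N" "\<And>t \<phi>. t \<in> {0..\<tau>} - N \<Longrightarrow> \<phi> \<in> V \<Longrightarrow>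
      p'' t \<bullet> \<phi> + inner_half A (p t) \<phi> + Q (p' t) \<bullet> \<phi> = fh t \<bullet> \<phi>"
    using weak unfolding weak_solution_def by blast
  have ex: "(a has_vector_derivative b t) (at t within {0..\<tau>})"
    "(b has_vector_derivative d t) (at t within {0..\<tau>})"
    "a t = R (f t - R (d t) - Q (R (b t)))" if "t \<in> {0..\<tau>}" for t
    using exact that unfolding exact_solution_def by auto
  define c where "c = \<epsilon> * (1 + \<kappa>) * D"
  have D0: "0 \<le> D" using D(1)[of 0] \<tau> by (auto intro: order_trans[OF norm_ge_zero])
  then have c0: "0 \<le> c" using \<epsilon> \<kappa> by (simp add: c_def)
  have Rproj_der: "((\<lambda>t. R (proj (u t))) has_vector_derivative R (proj u')) (at t within {0..\<tau>})"
    if "(u has_vector_derivative u') (at t within {0..\<tau>})" for u u' t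
    by (intro R.has_vector_derivative proj.has_vector_derivative that)
  have "state_norm A (p \<tau> - R (proj (a \<tau>)), p' \<tau> - R (proj (b \<tau>)))
    \<le> state_norm A (p 0 - R (proj (a 0)), p' 0 - R (proj (b 0)))
      + integral {0..\<tau>} (\<lambda>t. norm (fh t - f t) + c)"
  proof (rule energy_estimate[where w = "\<lambda>t. p'' t - R (proj (d t))" and N = N
        and e = "\<lambda>t. p t - R (proj (a t))" and e' = "\<lambda>t. p' t - R (proj (b t))"])
    fix t assume t: "t \<in> {0..\<tau>}"
    show "p t - R (proj (a t)) \<in> V" using p(1)[OF t] proj_V subspace_V by (simp add: subspace_diff)
    show "((\<lambda>t. p t - R (proj (a t))) has_vector_derivative p' t - R (proj (b t))) (at t within {0..\<tau>})"
      by (intro has_vector_derivative_diff p(2) Rproj_der ex t)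
    show "0 \<le> norm (fh t - f t) + c" using c0 by simp
    fix \<phi>
    have "((\<lambda>r. R (proj (d r)) \<bullet> \<phi>) has_integral (R (proj (b t)) \<bullet> \<phi> - R (proj (b 0)) \<bullet> \<phi>)) {0..t}"
    proof (rule fundamental_theorem_of_calculus)
      show "((\<lambda>r. R (proj (b r)) \<bullet> \<phi>) has_vector_derivative R (proj (d r)) \<bullet> \<phi>) (at r within {0..t})"
        if "r \<in> {0..t}" for r
        by (rule has_vector_derivative_within_subset
            [OF bounded_linear.has_vector_derivative[OF bounded_linear_inner_left Rproj_der[OF ex(2)]]])
          (use that t in auto)
    qed (use t in simp)
    from has_integral_diff[OF p(3)[OF t, of \<phi>] this]
    show "((\<lambda>r. (p'' r - R (proj (d r))) \<bullet> \<phi>) has_integral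
        (p' t - R (proj (b t)) - (p' 0 - R (proj (b 0)))) \<bullet> \<phi>) {0..t}"
      by (simp only: inner_diff_left) (simp add: algebra_simps)
  next
    show "negligible N" by (rule p(4))
    show "(\<lambda>t. norm (fh t - f t) + c) integrable_on {0..\<tau>}"
      by (intro integrable_add int) (use integrable_const_ivl in blast)
    fix t \<phi> assume t: "t \<in> {0..\<tau>} - N" and \<phi>: "\<phi> \<in> V"
    then have t\<tau>: "t \<in> {0..\<tau>}" by simp
    have "p t - R (proj (a t)) = R (half (p t) - proj (a t))" using p(1)[OF t\<tau>] by (simp add: R.diff V_half)
    then have 1: "inner_half A (p t - R (proj (a t))) \<phi> = inner_half A (p t) \<phi> - proj (a t) \<bullet> half \<phi>"
      by (simp add: inner_half_def inner_diff_left)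
    have "proj (a t) \<bullet> half \<phi> = a t \<bullet> half \<phi>"
      using proj_orthogonal[of "half \<phi>" "a t"] \<phi> by (simp add: V_half inner_diff_left)
    also have "\<dots> = (f t - R (d t) - Q (R (b t))) \<bullet> \<phi>"
      using ex(3)[OF t\<tau>] \<phi> by (simp add: sym_R V_half)
    finally have 2: "proj (a t) \<bullet> half \<phi> = f t \<bullet> \<phi> - R (d t) \<bullet> \<phi> - Q (R (b t)) \<bullet> \<phi>"
      by (simp only: inner_diff_left)
    have "(p'' t - R (proj (d t))) \<bullet> \<phi> + inner_half A (p t - R (proj (a t))) \<phi> + Q (p' t - R (proj (b t))) \<bullet> \<phi>
        = (fh t - f t) \<bullet> \<phi> - (R (proj (d t)) - R (d t)) \<bullet> \<phi> - Q (R (proj (b t)) - R (b t)) \<bullet> \<phi>"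
      using p(5)[OF t \<phi>] by (simp only: 1 2 inner_diff_left Q.diff)
    also have "\<dots> \<le> norm (fh t - f t) * norm \<phi> + norm (R (proj (d t)) - R (d t)) * norm \<phi>
        + norm (Q (R (proj (b t)) - R (b t))) * norm \<phi>"
      using norm_cauchy_schwarz[of "fh t - f t" \<phi>] Cauchy_Schwarz_ineq2[of "R (proj (d t)) - R (d t)" \<phi>]
        Cauchy_Schwarz_ineq2[of "Q (R (proj (b t)) - R (b t))" \<phi>] by linarith
    also have "\<dots> = (norm (fh t - f t) + norm (R (proj (d t)) - R (d t)) + norm (Q (R (proj (b t)) - R (b t)))) * norm \<phi>"
      by (simp add: distrib_right)
    also have "\<dots> \<le> (norm (fh t - f t) + c) * norm \<phi>"
    proof (rule mult_right_mono)
      have "norm (R (proj (d t)) - R (d t)) \<le> \<epsilon> * D"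
        using approx[of "d t"] mult_left_mono[OF D(1)[OF t\<tau>] \<epsilon>] by linarith
      moreover have "norm (Q (R (proj (b t)) - R (b t))) \<le> \<kappa> * (\<epsilon> * D)"
      proof -
        have "norm (R (proj (b t)) - R (b t)) \<le> \<epsilon> * D"
          using approx[of "b t"] mult_left_mono[OF D(2)[OF t\<tau>] \<epsilon>] by linarith
        then show ?thesis using \<kappa>(2)[of "R (proj (b t)) - R (b t)"] \<kappa>(1) by (meson mult_left_mono order_trans)
      qed
      moreover have "c = \<epsilon> * D + \<kappa> * (\<epsilon> * D)" by (simp add: c_def algebra_simps)
      ultimately show "norm (fh t - f t) + norm (R (proj (d t)) - R (d t)) + norm (Q (R (proj (b t)) - R (b t)))
          \<le> norm (fh t - f t) + c" by linarith
    qed simp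
    finally show "(p'' t - R (proj (d t))) \<bullet> \<phi> + inner_half A (p t - R (proj (a t))) \<phi>
        + Q (p' t - R (proj (b t))) \<bullet> \<phi> \<le> (norm (fh t - f t) + c) * norm \<phi>" .
  qed
  also have "integral {0..\<tau>} (\<lambda>t. norm (fh t - f t) + c) = c * \<tau> + integral {0..\<tau>} (\<lambda>t. norm (fh t - f t))"
    using \<tau> by (subst Henstock_Kurzweil_Integration.integral_add[OF int]) (auto intro: integrable_const_ivl)
  finally show ?thesis by (simp add: c_def)
qed

lemma weak_solution_stable:
  assumes "weak_solution (\<lambda>_. 0) p p'"
  shows "state_norm A (p \<tau>, p' \<tau>) \<le> state_norm A (p 0, p' 0)"
proof -
  obtain c where c: "c > 0" "\<And>x. norm (Q x) \<le> norm x * c" using Q.pos_bounded by blast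
  obtain P where P: "P > 0" "\<And>x. norm (R (proj x) - R x) \<le> norm x * P"
    using bounded_linear.pos_bounded[OF bounded_linear_sub[OF bounded_linear_compose[OF bounded_linear_R proj_linear] bounded_linear_R]]
    by blast
  show ?thesis
    using galerkin_error[OF assms exact_solution_zero, of P 0 c] c P
    by (simp add: mult.commute R.zero proj.zero integrable_0)
qed

text \<open>Duality: the error \<open>u = R y - proj (R y)\<close> has projection 0, so the assumption, applied to the error
  itself, gives \<open>\<parallel>R u\<parallel> \<le> \<epsilon> \<parallel>u\<parallel>\<close>; and \<open>\<parallel>u\<parallel>\<^sup>2 = u \<bullet> R y = R u \<bullet> y\<close>.\<close>

lemma projection_error:
  assumes approx: "\<And>y. norm (R (proj y) - R y) \<le> \<epsilon> * norm y"
  shows "norm (proj (R y) - R y) \<le> \<epsilon> * norm y"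
proof (cases "proj (R y) = R y")
  case True
  have "0 \<le> \<epsilon> * norm y" using approx[of y] by (rule order_trans[OF norm_ge_zero])
  then show ?thesis using True by simp
next
  case False
  define u where "u = R y - proj (R y)"
  have nu: "norm u > 0" using False by (simp add: u_def)
  have "R (proj u) - R u = - R u" by (simp add: u_def proj.diff proj_id proj_V)
  then have Ru: "norm (R u) \<le> \<epsilon> * norm u" using approx[of u] by simp
  have "u \<bullet> proj (R y) = 0" unfolding u_def by (rule proj_orthogonal) (rule proj_V)
  then have "(norm u)\<^sup>2 = u \<bullet> R y" by (simp add: power2_norm_eq_inner) (simp add: u_def inner_diff_right)
  also have "\<dots> = R u \<bullet> y" by (simp add: sym_R)
  also have "\<dots> \<le> norm (R u) * norm y" by (rule norm_cauchy_schwarz)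
  also have "\<dots> \<le> \<epsilon> * norm u * norm y" using Ru by (intro mult_right_mono) auto
  finally have "norm u \<le> \<epsilon> * norm y" using nu by (simp add: power2_eq_square mult_ac)
  then show ?thesis by (simp add: u_def norm_minus_commute)
qed

end


section \<open>The discrete semigroups and observers\<close>

lemma negligible_reflect:
  assumes "negligible N"
  shows "negligible ((\<lambda>t::real. \<tau> - t) ` N)"
  by (rule negligible_differentiable_image_negligible[OF _ assms])
    (auto intro!: derivative_intros simp: differentiable_on_def)

locale observed_galerkin = galerkin A R Q Q' V \<tau>
  for A :: "'h::{real_inner,complete_space} \<rightharpoonup> 'h" and R Q Q' :: "'h \<Rightarrow> 'h" and V :: "'h set" and \<tau> :: real +
  fixes C :: "'h \<Rightarrow> 'y::{real_inner,complete_space}"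
  assumes bounded_linear_C: "bounded_linear C" and Q_C: "adjoint C (C v) = Q v"
begin

lemma galerkin_solution_weak:
  assumes "galerkin_solution A C V \<tau> p0 p1 p p'"
  shows "weak_solution (\<lambda>_. 0) p p'" "p 0 = p0" "p' 0 = p1"
proof -
  obtain p'' where p: "\<And>t. t \<in> {0..\<tau>} \<Longrightarrow> p t \<in> V"
    "\<And>t. t \<in> {0..\<tau>} \<Longrightarrow> (p has_vector_derivative p' t) (at t within {0..\<tau>})"
    "\<And>t. t \<in> {0..\<tau>} \<Longrightarrow> (p' has_vector_derivative p'' t) (at t within {0..\<tau>})"
    "\<And>t \<phi>. t \<in> {0..\<tau>} \<Longrightarrow> \<phi> \<in> V \<Longrightarrow> p'' t \<bullet> \<phi> + inner_half A (p t) \<phi> + Q (p' t) \<bullet> \<phi> = 0"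
    using assms unfolding galerkin_solution_def Q_C by blast
  show "weak_solution (\<lambda>_. 0) p p'"
    unfolding weak_solution_def
  proof (intro exI[of _ p''] exI[of _ "{}"] conjI ballI allI)
    fix t \<phi> assume t: "t \<in> {0..\<tau>}"
    have "((\<lambda>r. p'' r \<bullet> \<phi>) has_integral p' t \<bullet> \<phi> - p' 0 \<bullet> \<phi>) {0..t}"
    proof (rule fundamental_theorem_of_calculus)
      show "((\<lambda>r. p' r \<bullet> \<phi>) has_vector_derivative p'' r \<bullet> \<phi>) (at r within {0..t})"
        if "r \<in> {0..t}" for r
        by (rule has_vector_derivative_within_subset
            [OF bounded_linear.has_vector_derivative[OF bounded_linear_inner_left p(3)]])
          (use that t in auto)
    qed (use t in simp)
    then show "((\<lambda>r. p'' r \<bullet> \<phi>) has_integral (p' t - p' 0) \<bullet> \<phi>) {0..t}" by (simp only: inner_diff_left)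
  qed (use p in \<open>auto\<close>)
  show "p 0 = p0" "p' 0 = p1" using assms by (auto simp: galerkin_solution_def)
qed

lemma observer_solution_elim:
  assumes "observer_solution s A C V \<tau> g w w'"
  obtains w'' N where "\<And>t. t \<in> {0..\<tau>} \<Longrightarrow> w t \<in> V"
    "\<And>t. t \<in> {0..\<tau>} \<Longrightarrow> (w has_vector_derivative w' t) (at t within {0..\<tau>})"
    "\<And>t \<phi>. t \<in> {0..\<tau>} \<Longrightarrow> ((\<lambda>r. w'' r \<bullet> \<phi>) has_integral w' t \<bullet> \<phi> - w' 0 \<bullet> \<phi>) {0..t}"
    "negligible N" "\<And>t \<phi>. t \<in> {0..\<tau>} - N \<Longrightarrow> \<phi> \<in> V \<Longrightarrow>
      w'' t \<bullet> \<phi> + inner_half A (w t) \<phi> + s * (Q (w' t) \<bullet> \<phi>) = s * (adjoint C (g t) \<bullet> \<phi>)"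
proof -
  obtain w'' where w: "\<And>t. t \<in> {0..\<tau>} \<Longrightarrow> w t \<in> V"
    "\<And>t. t \<in> {0..\<tau>} \<Longrightarrow> (w has_vector_derivative w' t) (at t within {0..\<tau>})"
    "\<And>t. t \<in> {0..\<tau>} \<Longrightarrow> (w'' has_integral w' t - w' 0) {0..t}"
    and ae: "AE t in lebesgue_on {0..\<tau>}. \<forall>\<phi>\<in>V.
      w'' t \<bullet> \<phi> + inner_half A (w t) \<phi> + s * (Q (w' t) \<bullet> \<phi>) = s * (adjoint C (g t) \<bullet> \<phi>)"
    using assms unfolding observer_solution_def Q_C by blast
  obtain N where N: "negligible N" "\<And>t. t \<in> {0..\<tau>} - N \<Longrightarrow> \<forall>\<phi>\<in>V.
      w'' t \<bullet> \<phi> + inner_half A (w t) \<phi> + s * (Q (w' t) \<bullet> \<phi>) = s * (adjoint C (g t) \<bullet> \<phi>)"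
    using AE_lebesgue_on_negligible[OF ae] by blast
  show thesis
  proof (rule that[OF w(1,2) _ N(1)])
    show "((\<lambda>r. w'' r \<bullet> \<phi>) has_integral w' t \<bullet> \<phi> - w' 0 \<bullet> \<phi>) {0..t}" if "t \<in> {0..\<tau>}" for t \<phi>
      using has_integral_linear[OF w(3)[OF that] bounded_linear_inner_left[of \<phi>]]
      by (simp add: o_def inner_diff_left)
  qed (use N(2) in blast)+
qed

lemma observer_initial_V:
  assumes "observer_solution s A C V \<tau> g w w'"
  shows "w 0 \<in> V" "w' 0 \<in> V"
proof -
  have w: "\<And>t. t \<in> {0..\<tau>} \<Longrightarrow> w t \<in> V"
    "\<And>t. t \<in> {0..\<tau>} \<Longrightarrow> (w has_vector_derivative w' t) (at t within {0..\<tau>})"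
    using assms unfolding observer_solution_def by blast+
  have "0 \<in> {0..\<tau>}" using \<tau> by simp
  then show "w 0 \<in> V" "w' 0 \<in> V" using w derivative_in_V[OF _ w(2) w(1), of 0] by blast+
qed

lemma observer_forward_weak:
  assumes "observer_solution 1 A C V \<tau> g w w'"
  shows "weak_solution (\<lambda>t. adjoint C (g t)) w w'"
proof (rule observer_solution_elim[OF assms])
  fix w'' N
  assume w: "\<And>t. t \<in> {0..\<tau>} \<Longrightarrow> w t \<in> V"
    "\<And>t. t \<in> {0..\<tau>} \<Longrightarrow> (w has_vector_derivative w' t) (at t within {0..\<tau>})"
    "\<And>t \<phi>. t \<in> {0..\<tau>} \<Longrightarrow> ((\<lambda>r. w'' r \<bullet> \<phi>) has_integral w' t \<bullet> \<phi> - w' 0 \<bullet> \<phi>) {0..t}"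
    "negligible N" "\<And>t \<phi>. t \<in> {0..\<tau>} - N \<Longrightarrow> \<phi> \<in> V \<Longrightarrow>
      w'' t \<bullet> \<phi> + inner_half A (w t) \<phi> + 1 * (Q (w' t) \<bullet> \<phi>) = 1 * (adjoint C (g t) \<bullet> \<phi>)"
  show ?thesis
    unfolding weak_solution_def inner_diff_left
    by (intro exI[of _ w''] exI[of _ N] conjI ballI allI) (use w in auto)
qed

text \<open>Running backward from \<open>\<tau>\<close> turns the antidamped observer into a damped equation, started with
  the reversed velocity.\<close>

lemma observer_backward_weak:
  assumes "observer_solution (- 1) A C V \<tau> g w w'"
  shows "weak_solution (\<lambda>t. - adjoint C (g (\<tau> - t))) (\<lambda>t. w (\<tau> - t)) (\<lambda>t. - w' (\<tau> - t))"
proof (rule observer_solution_elim[OF assms])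
  fix w'' N
  assume w: "\<And>t. t \<in> {0..\<tau>} \<Longrightarrow> w t \<in> V"
    "\<And>t. t \<in> {0..\<tau>} \<Longrightarrow> (w has_vector_derivative w' t) (at t within {0..\<tau>})"
    "\<And>t \<phi>. t \<in> {0..\<tau>} \<Longrightarrow> ((\<lambda>r. w'' r \<bullet> \<phi>) has_integral w' t \<bullet> \<phi> - w' 0 \<bullet> \<phi>) {0..t}"
    "negligible N" "\<And>t \<phi>. t \<in> {0..\<tau>} - N \<Longrightarrow> \<phi> \<in> V \<Longrightarrow>
      w'' t \<bullet> \<phi> + inner_half A (w t) \<phi> + - 1 * (Q (w' t) \<bullet> \<phi>) = - 1 * (adjoint C (g t) \<bullet> \<phi>)"
  show ?thesis
    unfolding weak_solution_def
  proof (intro exI[of _ "\<lambda>t. w'' (\<tau> - t)"] exI[of _ "(\<lambda>t. \<tau> - t) ` N"] conjI ballI allI)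
    fix t assume t: "t \<in> {0..\<tau>}"
    then have s: "\<tau> - t \<in> {0..\<tau>}" by auto
    show "w (\<tau> - t) \<in> V" by (rule w(1)[OF s])
    show "((\<lambda>t. w (\<tau> - t)) has_vector_derivative - w' (\<tau> - t)) (at t within {0..\<tau>})"
      by (rule reflected_derivative[OF w(2)[OF s]])
    fix \<phi>
    have "((\<lambda>r. w'' r \<bullet> \<phi>) has_integral (w' \<tau> \<bullet> \<phi> - w' 0 \<bullet> \<phi>) - (w' (\<tau> - t) \<bullet> \<phi> - w' 0 \<bullet> \<phi>)) {\<tau> - t..\<tau>}"
      using s \<tau> t by (intro has_integral_interval_difference[where F = "\<lambda>t. w' t \<bullet> \<phi> - w' 0 \<bullet> \<phi>"] w(3)) auto
    from reflected_integral[OF this]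
    show "((\<lambda>r. w'' (\<tau> - r) \<bullet> \<phi>) has_integral (- w' (\<tau> - t) - - w' (\<tau> - 0)) \<bullet> \<phi>) {0..t}"
      by (simp add: inner_diff_left)
  next
    show "negligible ((\<lambda>t. \<tau> - t) ` N)" by (rule negligible_reflect[OF w(4)])
    fix t \<phi> assume t: "t \<in> {0..\<tau>} - (\<lambda>t. \<tau> - t) ` N" and \<phi>: "\<phi> \<in> V"
    have "\<tau> - t \<notin> N"
    proof
      assume "\<tau> - t \<in> N"
      then have "\<tau> - (\<tau> - t) \<in> (\<lambda>t. \<tau> - t) ` N" by blast
      then show False using t by simp
    qed
    then have "\<tau> - t \<in> {0..\<tau>} - N" using t by auto
    from w(5)[OF this \<phi>]
    show "w'' (\<tau> - t) \<bullet> \<phi> + inner_half A (w (\<tau> - t)) \<phi> + Q (- w' (\<tau> - t)) \<bullet> \<phi>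
        = - adjoint C (g (\<tau> - t)) \<bullet> \<phi>" by (simp add: Q.neg)
  qed
qed

text \<open>The Galerkin equation is the flow of a bounded operator \<open>M\<close>. Composition with the orthogonal
  projection onto \<open>V\<close> on both sides makes \<open>M\<close> commute with the projection of states, so that the flow
  preserves \<open>V \<times> V\<close>.\<close>

lemma galerkin_solution_exists:
  assumes p0: "p0 \<in> V" and p1: "p1 \<in> V"
  shows "\<exists>p p'. galerkin_solution A C V \<tau> p0 p1 p p'"
proof -
  obtain P where P: "bounded_linear P" "\<And>v. v \<in> V \<Longrightarrow> P v = v" "\<And>x. P x \<in> V"
    "\<And>x v. v \<in> V \<Longrightarrow> P x \<bullet> v = x \<bullet> v"
    using orthogonal_projection_V by blast
  obtain G where G: "bounded_linear G" "\<And>v. v \<in> V \<Longrightarrow> G v = half v"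
    using half_bounded_on_V by blast
  interpret P: bounded_linear P by (rule P)
  note G' = bounded_linear_adjoint[OF G(1)]
  define M where "M z = (P (snd z), - P (adjoint G (G (P (fst z)))) - P (Q (P (snd z))))" for z
  define PP where "PP z = (P (fst z), P (snd z))" for z
  have blM: "bounded_linear M"
    unfolding M_def
    by (intro bounded_linear_Pair bounded_linear_sub bounded_linear_minus
        bounded_linear_compose[OF P(1)] bounded_linear_compose[OF G'] bounded_linear_compose[OF G(1)]
        bounded_linear_compose[OF bounded_linear_Q] bounded_linear_fst bounded_linear_snd)
  have blPP: "bounded_linear PP"
    unfolding PP_def
    by (intro bounded_linear_Pair bounded_linear_compose[OF P(1)] bounded_linear_fst bounded_linear_snd)
  have comm: "PP (M z) = M (PP z)" for z
    by (simp add: PP_def M_def P.diff P.neg P(2)[OF P(3)])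
  obtain E where E: "\<And>x. E 0 x = x"
    "\<And>t x. ((\<lambda>t. E t x) has_vector_derivative M (E t x)) (at t)"
    "\<And>C t x. \<lbrakk>bounded_linear C; \<And>x. C (M x) = M (C x)\<rbrakk> \<Longrightarrow> C (E t x) = E t (C x)"
    using exp_flow[OF blM] by metis
  define z where "z t = E t (p0, p1)" for t
  have zV: "P (fst (z t)) = fst (z t)" "P (snd (z t)) = snd (z t)" for t
  proof -
    have "PP (z t) = z t" unfolding z_def using E(3)[OF blPP comm] p0 p1 by (simp add: PP_def P(2))
    then show "P (fst (z t)) = fst (z t)" "P (snd (z t)) = snd (z t)" by (simp_all add: PP_def prod_eq_iff)
  qed
  have zin: "fst (z t) \<in> V" "snd (z t) \<in> V" for t using zV[of t] P(3) by metis+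
  have der: "(z has_vector_derivative M (z t)) (at t within {0..\<tau>})" for t
    unfolding z_def using E(2) by (rule has_vector_derivative_at_within)
  show ?thesis
    unfolding galerkin_solution_def Q_C
  proof (rule exI[of _ "\<lambda>t. fst (z t)"], rule exI[of _ "\<lambda>t. snd (z t)"],
      intro exI[of _ "\<lambda>t. snd (M (z t))"] conjI ballI)
    fix t assume "t \<in> {0..\<tau>}"
    show "fst (z t) \<in> V" by (rule zin)
    have "fst (M (z t)) = snd (z t)" by (simp add: M_def zV)
    then show "((\<lambda>t. fst (z t)) has_vector_derivative snd (z t)) (at t within {0..\<tau>})"
      using bounded_linear.has_vector_derivative[OF bounded_linear_fst der[of t]] by simp
    show "((\<lambda>t. snd (z t)) has_vector_derivative snd (M (z t))) (at t within {0..\<tau>})"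
      by (rule bounded_linear.has_vector_derivative[OF bounded_linear_snd der])
    fix \<phi> assume \<phi>: "\<phi> \<in> V"
    have "adjoint G (G (fst (z t))) \<bullet> \<phi> = inner_half A (fst (z t)) \<phi>"
    proof -
      have "adjoint G (G (fst (z t))) \<bullet> \<phi> = G \<phi> \<bullet> G (fst (z t))"
        by (simp only: inner_commute[of "adjoint G _"] adjoint_inner[OF G(1)])
      then show ?thesis using G(2)[OF \<phi>] G(2)[OF zin(1)] by (simp add: inner_half_def inner_commute)
    qed
    then show "snd (M (z t)) \<bullet> \<phi> + inner_half A (fst (z t)) \<phi> + Q (snd (z t)) \<bullet> \<phi> = 0"
      using \<phi> by (simp add: M_def zV inner_diff_left P(4))
  qed (simp_all add: z_def E(1))
qed

definition galerkin_flow :: "'h \<times> 'h \<Rightarrow> 'h \<times> 'h" where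
  "galerkin_flow z = (THE z'. \<exists>p p'. galerkin_solution A C V \<tau> (fst z) (snd z) p p' \<and> z' = (p \<tau>, p' \<tau>))"

lemma state_norm_diff_0: "state_norm A (x - y) \<le> 0 \<Longrightarrow> x \<in> V \<times> V \<Longrightarrow> y \<in> V \<times> V \<Longrightarrow> x = y"
proof -
  assume le: "state_norm A (x - y) \<le> 0" and x: "x \<in> V \<times> V" and y: "y \<in> V \<times> V"
  have eq: "x - y = (R (half (fst x) - half (fst y)), snd x - snd y)"
    using x y by (simp add: prod_eq_iff R.diff V_half mem_Times_iff)
  have "norm (half (fst x) - half (fst y), snd x - snd y) \<le> 0"
    using le unfolding eq state_norm_R .
  then have "half (fst x) = half (fst y)" "snd x = snd y" by (simp_all add: zero_prod_def)
  then show "x = y" using x y V_half by (metis mem_Times_iff prod_eq_iff)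
qed

lemma galerkin_flow_eq:
  assumes sol: "galerkin_solution A C V \<tau> (fst z) (snd z) p p'"
  shows "galerkin_flow z = (p \<tau>, p' \<tau>)" and "(p \<tau>, p' \<tau>) \<in> V \<times> V"
proof -
  have inV: "(q \<tau>, q' \<tau>) \<in> V \<times> V" if "galerkin_solution A C V \<tau> (fst z) (snd z) q q'" for q q'
  proof -
    have q: "\<And>t. t \<in> {0..\<tau>} \<Longrightarrow> q t \<in> V"
      "\<And>t. t \<in> {0..\<tau>} \<Longrightarrow> (q has_vector_derivative q' t) (at t within {0..\<tau>})"
      using that unfolding galerkin_solution_def by blast+
    have t: "\<tau> \<in> {0..\<tau>}" using \<tau> by simp
    show ?thesis using derivative_in_V[OF t q(2)[OF t] q(1)] q(1)[OF t] by simp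
  qed
  show "(p \<tau>, p' \<tau>) \<in> V \<times> V" by (rule inV[OF sol])
  show "galerkin_flow z = (p \<tau>, p' \<tau>)"
    unfolding galerkin_flow_def
  proof (rule the_equality)
    show "\<exists>q q'. galerkin_solution A C V \<tau> (fst z) (snd z) q q' \<and> (p \<tau>, p' \<tau>) = (q \<tau>, q' \<tau>)"
      using sol by blast
    fix z' assume "\<exists>q q'. galerkin_solution A C V \<tau> (fst z) (snd z) q q' \<and> z' = (q \<tau>, q' \<tau>)"
    then obtain q q' where q: "galerkin_solution A C V \<tau> (fst z) (snd z) q q'" "z' = (q \<tau>, q' \<tau>)" by blast
    have "weak_solution (\<lambda>t. 0) (\<lambda>t. q t - p t) (\<lambda>t. q' t - p' t)"
      using weak_solution_diff[OF galerkin_solution_weak(1)[OF q(1)] galerkin_solution_weak(1)[OF sol]] by simp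
    from weak_solution_stable[OF this]
    have "state_norm A ((q \<tau>, q' \<tau>) - (p \<tau>, p' \<tau>)) \<le> state_norm A (R 0, 0)"
      using galerkin_solution_weak(2,3)[OF q(1)] galerkin_solution_weak(2,3)[OF sol] by (simp add: R.zero)
    also have "\<dots> = 0" by (simp only: state_norm_R) (simp add: norm_Pair)
    finally show "z' = (p \<tau>, p' \<tau>)"
      using state_norm_diff_0[OF _ inV[OF q(1)] inV[OF sol]] q(2) by simp
  qed
qed

lemma galerkin_flow_solution:
  assumes "z \<in> V \<times> V"
  obtains p p' where "galerkin_solution A C V \<tau> (fst z) (snd z) p p'" "galerkin_flow z = (p \<tau>, p' \<tau>)"
  using galerkin_solution_exists[of "fst z" "snd z"] galerkin_flow_eq(1) assms by (auto simp: mem_Times_iff)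

lemma galerkin_flow_V: "z \<in> V \<times> V \<Longrightarrow> galerkin_flow z \<in> V \<times> V"
  using galerkin_flow_solution galerkin_flow_eq(2) by metis

lemma galerkin_flow_diff:
  assumes "z \<in> V \<times> V" "z' \<in> V \<times> V"
  shows "state_norm A (galerkin_flow z - galerkin_flow z') \<le> state_norm A (z - z')"
proof -
  obtain p p' where p: "galerkin_solution A C V \<tau> (fst z) (snd z) p p'" "galerkin_flow z = (p \<tau>, p' \<tau>)"
    using galerkin_flow_solution[OF assms(1)] by blast
  obtain q q' where q: "galerkin_solution A C V \<tau> (fst z') (snd z') q q'" "galerkin_flow z' = (q \<tau>, q' \<tau>)"
    using galerkin_flow_solution[OF assms(2)] by blast
  have "weak_solution (\<lambda>t. 0) (\<lambda>t. p t - q t) (\<lambda>t. p' t - q' t)"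
    using weak_solution_diff[OF galerkin_solution_weak(1)[OF p(1)] galerkin_solution_weak(1)[OF q(1)]] by simp
  from weak_solution_stable[OF this] show ?thesis
    using galerkin_solution_weak(2,3)[OF p(1)] galerkin_solution_weak(2,3)[OF q(1)]
    by (simp add: p(2) q(2) minus_prod_def)
qed

text \<open>The backward discrete semigroup is the forward one between two velocity reversals, so a full cycle
  is the square of this map.\<close>

definition half_cycle :: "'h \<times> 'h \<Rightarrow> 'h \<times> 'h" where
  "half_cycle z = velocity_flip (galerkin_flow z)"

lemma velocity_flip_V: "z \<in> V \<times> V \<Longrightarrow> velocity_flip z \<in> V \<times> V"
  using subspace_V by (simp add: mem_Times_iff subspace_neg)

lemma half_cycle_V: "z \<in> V \<times> V \<Longrightarrow> half_cycle z \<in> V \<times> V"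
  unfolding half_cycle_def by (intro velocity_flip_V galerkin_flow_V)

lemma half_cycle_power_V: "z \<in> V \<times> V \<Longrightarrow> (half_cycle ^^ n) z \<in> V \<times> V"
  by (induction n) (auto simp: half_cycle_V simp del: mem_Sigma_iff)

lemma discrete_L_half_cycle:
  assumes z: "z \<in> V \<times> V"
  shows "discrete_L A C V \<tau> z = half_cycle (half_cycle z)"
proof -
  have plus: "discrete_semigroup_plus A C V \<tau> \<tau> u = galerkin_flow u" if "u \<in> V \<times> V" for u
    using that
    by (simp add: discrete_semigroup_plus_def galerkin_flow_def split_beta galerkin_projection_id mem_Times_iff)
  have minus: "discrete_semigroup_minus A C V \<tau> \<tau> u = velocity_flip (galerkin_flow (velocity_flip u))"
    if u: "u \<in> V \<times> V" for u
  proof -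
    obtain p p' where p: "galerkin_solution A C V \<tau> (fst u) (- snd u) p p'"
      "galerkin_flow (velocity_flip u) = (p \<tau>, p' \<tau>)"
      using galerkin_flow_solution[OF velocity_flip_V[OF u]] by auto
    have "discrete_semigroup_minus A C V \<tau> \<tau> u =
        (THE z. \<exists>p p'. galerkin_solution A C V \<tau> (fst u) (- snd u) p p' \<and> z = (p \<tau>, - p' \<tau>))"
      using u by (simp add: discrete_semigroup_minus_def split_beta galerkin_projection_id mem_Times_iff)
    also have "\<dots> = (p \<tau>, - p' \<tau>)"
    proof (rule the_equality)
      fix z assume "\<exists>p p'. galerkin_solution A C V \<tau> (fst u) (- snd u) p p' \<and> z = (p \<tau>, - p' \<tau>)"
      then obtain q q' where q: "galerkin_solution A C V \<tau> (fst u) (- snd u) q q'" "z = (q \<tau>, - q' \<tau>)" by blast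
      have "galerkin_flow (velocity_flip u) = (q \<tau>, q' \<tau>)" using galerkin_flow_eq(1)[of "velocity_flip u"] q(1) by simp
      then show "z = (p \<tau>, - p' \<tau>)" using p(2) q(2) by simp
    qed (use p(1) in blast)
    finally show ?thesis using p(2) by (simp add: velocity_flip_def)
  qed
  show ?thesis using z by (simp add: discrete_L_def plus minus galerkin_flow_V half_cycle_def)
qed

lemma discrete_L_power:
  assumes z: "z \<in> V \<times> V"
  shows "(discrete_L A C V \<tau> ^^ n) z = (half_cycle ^^ (2 * n)) z"
  by (induction n) (simp_all add: discrete_L_half_cycle half_cycle_power_V[OF z])

lemma state_norm_velocity_flip: "state_norm A (velocity_flip z) = state_norm A z"
  by (simp add: state_norm_def)

lemma half_cycle_diff:
  assumes "z \<in> V \<times> V" "z' \<in> V \<times> V"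
  shows "state_norm A (half_cycle z - half_cycle z') \<le> state_norm A (z - z')"
proof -
  have "half_cycle z - half_cycle z' = velocity_flip (galerkin_flow z - galerkin_flow z')"
    by (simp add: half_cycle_def prod_eq_iff)
  then show ?thesis using galerkin_flow_diff[OF assms] by (simp add: state_norm_velocity_flip)
qed

lemma half_cycle_power_diff:
  assumes "z \<in> V \<times> V" "z' \<in> V \<times> V"
  shows "state_norm A ((half_cycle ^^ n) z - (half_cycle ^^ n) z') \<le> state_norm A (z - z')"
proof (induction n)
  case (Suc n)
  then show ?case
    using half_cycle_diff[OF half_cycle_power_V[OF assms(1), of n] half_cycle_power_V[OF assms(2), of n]] by simp
qed simp

lemma state_norm_coords: "state_norm A z = norm (energy_coords A 1 z)"
  by (simp add: state_norm_def norm_half_def energy_coords_def norm_Pair)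

lemma state_norm_minus_commute:
  assumes "x \<in> V \<times> V" "y \<in> V \<times> V"
  shows "state_norm A (x - y) = state_norm A (y - x)"
proof -
  have "half (fst x - fst y) = half (fst x) - half (fst y)" if "x \<in> V \<times> V" "y \<in> V \<times> V" for x y
    using that ap_sqrt[of "half (fst x) - half (fst y)"] by (simp add: R.diff V_half mem_Times_iff)
  then show ?thesis
    using assms by (simp add: state_norm_def norm_half_def norm_minus_commute)
qed

lemma energy_coords_diff:
  assumes "z \<in> state_space A" "z' \<in> state_space A"
  shows "energy_coords A 1 (z - z') = energy_coords A 1 z - energy_coords A 1 z'" "z - z' \<in> state_space A"
    "energy_coords A 1 (z + z') = energy_coords A 1 z + energy_coords A 1 z'" "z + z' \<in> state_space A"
proof -
  obtain a b a' b' where "z = (R a, b)" "z' = (R a', b')"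
    using assms by (auto simp: state_space_def dom_sqrt)
  then show "energy_coords A 1 (z - z') = energy_coords A 1 z - energy_coords A 1 z'" "z - z' \<in> state_space A"
    "energy_coords A 1 (z + z') = energy_coords A 1 z + energy_coords A 1 z'" "z + z' \<in> state_space A"
    by (simp_all add: energy_coords_def state_space_def dom_sqrt R.diff[symmetric] R.add[symmetric])
qed

lemma state_norm_triangle:
  assumes "x \<in> state_space A" "y \<in> state_space A" "z \<in> state_space A"
  shows "state_norm A (x - z) \<le> state_norm A (x - y) + state_norm A (y - z)"
  using norm_triangle_ineq[of "energy_coords A 1 x - energy_coords A 1 y" "energy_coords A 1 y - energy_coords A 1 z"]
  by (simp add: state_norm_coords energy_coords_diff assms)

lemma state_norm_sum_diff:
  assumes "finite I" "\<And>i. i \<in> I \<Longrightarrow> f i \<in> state_space A" "\<And>i. i \<in> I \<Longrightarrow> g i \<in> state_space A"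
  shows "state_norm A (sum f I - sum g I) \<le> (\<Sum>i\<in>I. state_norm A (f i - g i))"
    and "sum f I \<in> state_space A"
proof -
  have z: "0 \<in> state_space A" "energy_coords A 1 0 = 0"
    using state_of_in[of 1 0] energy_coords_state_of[of 1 0] by (simp_all add: state_of_def R.zero zero_prod_def)
  have lin: "energy_coords A 1 (sum h I) = (\<Sum>i\<in>I. energy_coords A 1 (h i)) \<and> sum h I \<in> state_space A"
    if "\<And>i. i \<in> I \<Longrightarrow> h i \<in> state_space A" for h
    using assms(1) that by (induction I rule: finite_induct) (auto simp: z energy_coords_diff)
  show "sum f I \<in> state_space A" using lin assms(2) by blast
  have "energy_coords A 1 (sum f I - sum g I) = (\<Sum>i\<in>I. energy_coords A 1 (f i - g i))"
    using lin[of f] lin[of g] assms by (simp add: energy_coords_diff sum_subtractf)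
  then show "state_norm A (sum f I - sum g I) \<le> (\<Sum>i\<in>I. state_norm A (f i - g i))"
    unfolding state_norm_coords by (simp only:) (rule norm_sum)
qed

lemma V_state_space: "z \<in> V \<times> V \<Longrightarrow> z \<in> state_space A"
  using V_dom by (auto simp: state_space_def dom_sqrt)

end


section \<open>Error of the reconstruction\<close>

context observed_galerkin
begin

definition project_state :: "'h \<times> 'h \<Rightarrow> 'h \<times> 'h" where
  "project_state z = (R (proj (fst z)), galerkin_projection A V (snd z))"

lemma project_state_K: "project_state (K v) = (R (proj (fst (K v))), R (proj (fst v)))"
  by (simp only: project_state_def damped_inverse_simps galerkin_projection_R)

lemma project_state_V: "project_state (K v) \<in> V \<times> V"
  by (simp add: project_state_K proj_V)

lemma project_state_diff: "project_state (K (u - v)) = project_state (K u) - project_state (K v)"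
proof -
  have k: "K (u - v) = K u - K v"
    by (rule linear_diff[OF bounded_linear.linear[OF bounded_linear_damped_inverse]])
  show ?thesis
    unfolding prod_eq_iff project_state_K fst_conv snd_conv fst_diff snd_diff
    by (simp only: k fst_diff proj.diff R.diff simp_thms)
qed

lemma state_norm_le:
  assumes "norm a \<le> x" "norm b \<le> y"
  shows "state_norm A (R a, b) \<le> x + y"
  using norm_Pair_le[of a b] assms by (simp only: state_norm_R)

lemma project_state_error:
  assumes approx: "\<And>y. norm (R (proj y) - R y) \<le> \<epsilon> * norm y" and \<epsilon>: "0 \<le> \<epsilon>"
    and c: "\<And>v. norm (K v) \<le> c * norm v" "\<And>v. norm (snd v + Q (R (fst v))) \<le> c * norm v" "0 \<le> c"
  shows "state_norm A (state_of R 1 (K (K x)) - project_state (K (K x))) \<le> \<epsilon> * (c + 1) * c * norm x"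
proof -
  let ?a = "fst (K (K x))" and ?b = "fst (K x)"
  define \<alpha> where "\<alpha> = - (snd (K x) + Q (R ?b))"
  have a: "?a = R \<alpha>" by (simp only: \<alpha>_def damped_inverse_simps R.neg)
  have Kx: "norm (K x) \<le> c * norm x" by (rule c)
  have "norm (proj ?a - ?a) \<le> \<epsilon> * norm \<alpha>" unfolding a by (rule projection_error[OF approx])
  also have "\<dots> \<le> \<epsilon> * (c * (c * norm x))"
  proof (rule mult_left_mono[OF _ \<epsilon>])
    have "norm \<alpha> \<le> c * norm (K x)" unfolding \<alpha>_def norm_minus_cancel by (rule c)
    then show "norm \<alpha> \<le> c * (c * norm x)" using mult_left_mono[OF Kx c(3)] by linarith
  qed
  finally have 1: "norm (?a - proj ?a) \<le> \<epsilon> * (c * (c * norm x))" by (simp only: norm_minus_commute)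
  have "norm (R (proj ?b) - R ?b) \<le> \<epsilon> * norm ?b" by (rule approx)
  also have "\<dots> \<le> \<epsilon> * (c * norm x)"
  proof (rule mult_left_mono[OF _ \<epsilon>])
    show "norm ?b \<le> c * norm x" using norm_fst_le[of ?b "snd (K x)", unfolded prod.collapse] Kx by linarith
  qed
  finally have 2: "norm (R ?b - R (proj ?b)) \<le> \<epsilon> * (c * norm x)" by (simp only: norm_minus_commute)
  have "state_of R 1 (K (K x)) - project_state (K (K x)) = (R (?a - proj ?a), R ?b - R (proj ?b))"
    by (simp only: state_of_def project_state_K minus_prod_def fst_conv snd_conv R.diff scaleR_one damped_inverse_simps)
  then have "state_norm A (state_of R 1 (K (K x)) - project_state (K (K x)))
      \<le> \<epsilon> * (c * (c * norm x)) + \<epsilon> * (c * norm x)" using state_norm_le[OF 1 2] by simp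
  also have "\<dots> = \<epsilon> * (c + 1) * c * norm x" by (simp add: algebra_simps)
  finally show ?thesis .
qed

text \<open>The Galerkin solution that starts at the projected state is compared with the projection of the
  exact one.\<close>

lemma half_cycle_consistent:
  assumes T: "contraction_flow K T"
    and approx: "\<And>y. norm (R (proj y) - R y) \<le> \<epsilon> * norm y" and \<epsilon>: "0 \<le> \<epsilon>"
    and c: "\<And>v. norm (K v) \<le> c * norm v" "1 \<le> c"
    and \<kappa>: "0 \<le> \<kappa>" "\<And>x. norm (Q x) \<le> \<kappa> * norm x"
  shows "state_norm A (half_cycle (project_state (K (K x))) - project_state (velocity_flip (T \<tau> (K (K x)))))
    \<le> \<epsilon> * (1 + \<kappa>) * (c * norm x) * \<tau>"
proof -
  interpret T: contraction_flow K T by fact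
  have \<tau>0: "0 \<le> \<tau>" using \<tau> by simp
  obtain p p' where p: "galerkin_solution A C V \<tau> (fst (project_state (K (K x)))) (snd (project_state (K (K x)))) p p'"
    "galerkin_flow (project_state (K (K x))) = (p \<tau>, p' \<tau>)"
    using galerkin_flow_solution[OF project_state_V] by blast
  note w = galerkin_solution_weak[OF p(1)]
  let ?a = "\<lambda>t. fst (T t (K (K x)))" and ?b = "\<lambda>t. fst (T t (K x))"
  have fst_le: "norm (fst v) \<le> norm v" for v :: "'h \<times> 'h" using norm_fst_le[of "fst v" "snd v"] by simp
  have "state_norm A (p \<tau> - R (proj (?a \<tau>)), p' \<tau> - R (proj (?b \<tau>)))
    \<le> state_norm A (p 0 - R (proj (?a 0)), p' 0 - R (proj (?b 0)))
      + (\<epsilon> * (1 + \<kappa>) * (c * norm x) * \<tau> + integral {0..\<tau>} (\<lambda>t. norm (0 - 0 :: 'h)))"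
  proof (rule galerkin_error[OF w(1) exact_solution_damped_flow[OF T] approx \<epsilon> _ _ \<kappa>])
    fix t assume t: "t \<in> {0..\<tau>}"
    have "norm (fst (T t x)) \<le> norm x" using fst_le[of "T t x"] T.T_contraction[of t x] t by simp
    also have "\<dots> \<le> c * norm x" using mult_right_mono[OF c(2), of "norm x"] by simp
    finally show "norm (fst (T t x)) \<le> c * norm x" .
    have "norm (fst (T t (K x))) \<le> norm (K x)" using fst_le[of "T t (K x)"] T.T_contraction[of t "K x"] t by simp
    then show "norm (fst (T t (K x))) \<le> c * norm x" using c(1)[of x] by linarith
  qed (simp add: integrable_0)
  moreover have "state_norm A (p 0 - R (proj (?a 0)), p' 0 - R (proj (?b 0))) = 0"
  proof -
    have "p 0 - R (proj (?a 0)) = R 0" "p' 0 - R (proj (?b 0)) = 0"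
      using w(2,3) by (simp_all only: T.T_0 project_state_K fst_conv snd_conv R.zero) simp_all
    then show ?thesis by (simp only: state_norm_R) (simp add: norm_Pair)
  qed
  moreover have "half_cycle (project_state (K (K x))) - project_state (velocity_flip (T \<tau> (K (K x))))
      = velocity_flip (p \<tau> - R (proj (?a \<tau>)), p' \<tau> - R (proj (?b \<tau>)))"
  proof -
    have b: "- snd (T \<tau> (K (K x))) = R (- ?b \<tau>)"
      by (simp only: T.T_commute[OF \<tau>0] damped_inverse_simps R.neg)
    have "galerkin_projection A V (- snd (T \<tau> (K (K x)))) = R (proj (- ?b \<tau>))"
      unfolding b by (rule galerkin_projection_R)
    also have "\<dots> = - R (proj (?b \<tau>))" by (simp only: proj.neg R.neg)
    finally have "project_state (velocity_flip (T \<tau> (K (K x)))) = (R (proj (?a \<tau>)), - R (proj (?b \<tau>)))"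
      by (simp only: project_state_def velocity_flip_simps)
    moreover have "half_cycle (project_state (K (K x))) = (p \<tau>, - p' \<tau>)"
      by (simp only: half_cycle_def p(2) velocity_flip_def fst_conv snd_conv)
    ultimately show ?thesis by (simp only: velocity_flip_def minus_prod_def fst_conv snd_conv) simp
  qed
  ultimately show ?thesis by (simp add: state_norm_velocity_flip)
qed

text \<open>The half cycle is a contraction in the energy norm, so the errors of the single steps add up.\<close>

lemma half_cycle_iterates:
  assumes T: "contraction_flow K T"
    and approx: "\<And>y. norm (R (proj y) - R y) \<le> \<epsilon> * norm y" and \<epsilon>: "0 \<le> \<epsilon>"
    and c: "\<And>v. norm (K v) \<le> c * norm v" "1 \<le> c"
    and \<kappa>: "0 \<le> \<kappa>" "\<And>x. norm (Q x) \<le> \<kappa> * norm x"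
    and y: "\<And>n. velocity_flip (T \<tau> (K (K (y n)))) = K (K (y (Suc n)))" "\<And>n. norm (y n) \<le> Y"
  shows "state_norm A ((half_cycle ^^ n) (project_state (K (K (y 0)))) - project_state (K (K (y n))))
    \<le> real n * (\<epsilon> * (1 + \<kappa>) * (c * Y) * \<tau>)"
proof (induction n)
  case 0
  have "state_norm A (R 0, 0) = 0" by (simp only: state_norm_R) (simp add: norm_Pair)
  then show ?case by (simp add: R.zero zero_prod_def)
next
  case (Suc n)
  let ?P = "\<lambda>n. project_state (K (K (y n)))"
  have inX: "(half_cycle ^^ k) (?P 0) \<in> state_space A" "half_cycle (?P k) \<in> state_space A" "?P k \<in> state_space A" for k
    by (intro V_state_space half_cycle_power_V half_cycle_V project_state_V)+
  have "state_norm A ((half_cycle ^^ Suc n) (?P 0) - ?P (Suc n))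
    \<le> state_norm A ((half_cycle ^^ Suc n) (?P 0) - half_cycle (?P n)) + state_norm A (half_cycle (?P n) - ?P (Suc n))"
    by (rule state_norm_triangle[OF inX])
  also have "state_norm A ((half_cycle ^^ Suc n) (?P 0) - half_cycle (?P n))
      \<le> state_norm A ((half_cycle ^^ n) (?P 0) - ?P n)"
    using half_cycle_diff[OF half_cycle_power_V[OF project_state_V] project_state_V] by simp
  also have "state_norm A (half_cycle (?P n) - ?P (Suc n)) \<le> \<epsilon> * (1 + \<kappa>) * (c * norm (y n)) * \<tau>"
    using half_cycle_consistent[OF T approx \<epsilon> c \<kappa>, of "y n"] by (simp only: y(1))
  also have "\<dots> \<le> \<epsilon> * (1 + \<kappa>) * (c * Y) * \<tau>"
    using \<epsilon> \<kappa>(1) c(2) \<tau> y(2) by (intro mult_right_mono mult_left_mono) auto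
  finally show ?case using Suc by (simp add: algebra_simps)
qed

text \<open>The exact forward observer is the true state minus \<open>T t (K (K x0))\<close>, and the exact backward one,
  in reversed time, is the reflected true state minus \<open>T t (K (K x1))\<close>. The first starts
  at 0, the second starts where the first ends, and its end is, up to reflection, \<open>K (K (x0 - x2))\<close>,
  that is, \<open>(I - L) z\<^sub>0\<close>. Each of the two passes adds one Galerkin error.\<close>

lemma observer_error:
  assumes T: "contraction_flow K T" and S: "contraction_flow J S"
    and approx: "\<And>y. norm (R (proj y) - R y) \<le> \<epsilon> * norm y" and \<epsilon>: "0 \<le> \<epsilon>"
    and c: "\<And>v. norm (K v) \<le> c * norm v" "\<And>v. norm (J v) \<le> c * norm v" "1 \<le> c"
    and \<kappa>: "0 \<le> \<kappa>" "\<And>x. norm (Q x) \<le> \<kappa> * norm x"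
    and z0: "J (J u) = K (K x0)"
    and x1: "velocity_flip (T \<tau> (K (K x0))) = K (K x1)" and x2: "velocity_flip (T \<tau> (K (K x1))) = K (K x2)"
    and v: "\<And>t. t \<in> {0..\<tau>} \<Longrightarrow> v t = R (fst (S t (J u)))"
    and fwd: "observer_solution 1 A C V \<tau> g wp wp'" "wp 0 = 0" "wp' 0 = 0"
    and bwd: "observer_solution (- 1) A C V \<tau> g wm wm'" "wm \<tau> = wp \<tau>" "wm' \<tau> = wp' \<tau>"
    and int: "(\<lambda>s. norm (adjoint C (C (v s) - g s))) integrable_on {0..\<tau>}"
  shows "state_norm A ((wm 0, wm' 0) - project_state (K (K (x0 - x2))))
    \<le> 2 * (\<epsilon> * (1 + \<kappa>) * (c * (norm u + norm x0 + norm x1)) * \<tau>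
          + integral {0..\<tau>} (\<lambda>s. norm (adjoint C (C (v s) - g s))))"
proof -
  interpret T: contraction_flow K T by fact
  interpret S: contraction_flow J S by fact
  interpret Kl: bounded_linear K by (rule T.bounded_linear_K)
  have \<tau>0: "0 \<le> \<tau>" using \<tau> by simp
  interpret Cs: bounded_linear "adjoint C" by (rule bounded_linear_adjoint[OF bounded_linear_C])
  have Rinj: "R a = R b \<longleftrightarrow> a = b" for a b using inj_R by (simp add: inj_eq)
  define D where "D = c * (norm u + norm x0 + norm x1)"
  define I where "I = integral {0..\<tau>} (\<lambda>s. norm (adjoint C (C (v s) - g s)))"
  have fst_le: "norm (fst q) \<le> norm q" for q :: "'h \<times> 'h" using norm_fst_le[of "fst q" "snd q"] by simp
  have boundS: "norm (fst (S t u)) \<le> c * norm u" "norm (fst (S t (J u))) \<le> c * norm u" if t: "0 \<le> t" for t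
  proof -
    have "norm (fst (S t u)) \<le> norm u" using fst_le[of "S t u"] S.T_contraction[OF t, of u] by linarith
    also have "\<dots> \<le> c * norm u" using mult_right_mono[OF c(3), of "norm u"] by simp
    finally show "norm (fst (S t u)) \<le> c * norm u" .
    show "norm (fst (S t (J u))) \<le> c * norm u"
      using fst_le[of "S t (J u)"] S.T_contraction[OF t, of "J u"] c(2)[of u] by linarith
  qed
  have boundT: "norm (fst (T t x)) \<le> c * norm x" "norm (fst (T t (K x))) \<le> c * norm x" if t: "0 \<le> t" for t x
  proof -
    have "norm (fst (T t x)) \<le> norm x" using fst_le[of "T t x"] T.T_contraction[OF t, of x] by linarith
    also have "\<dots> \<le> c * norm x" using mult_right_mono[OF c(3), of "norm x"] by simp
    finally show "norm (fst (T t x)) \<le> c * norm x" .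
    show "norm (fst (T t (K x))) \<le> c * norm x"
      using fst_le[of "T t (K x)"] T.T_contraction[OF t, of "K x"] c(1)[of x] by linarith
  qed
  have D_le: "norm (p - q) \<le> D" if "norm p \<le> c * norm u" "norm q \<le> c * norm x" "norm x \<le> norm x0 + norm x1"
    for p q :: 'h and x :: "'h \<times> 'h"
  proof -
    have "norm (p - q) \<le> c * norm u + c * norm x" using norm_triangle_ineq4[of p q] that by linarith
    also have "\<dots> \<le> c * norm u + c * (norm x0 + norm x1)" using that(3) c(3) by simp
    finally show ?thesis by (simp add: D_def algebra_simps)
  qed
  let ?aS = "\<lambda>t. fst (S t (J (J u)))" and ?bS = "\<lambda>t. fst (S t (J u))" and ?dS = "\<lambda>t. fst (S t u)"
  let ?a = "\<lambda>x t. fst (T t (K (K x)))" and ?b = "\<lambda>x t. fst (T t (K x))" and ?d = "\<lambda>x t. fst (T t x)"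
  have Qv: "Q (R (?bS t)) = adjoint C (C (v t))" if "t \<in> {0..\<tau>}" for t using v[OF that] by (simp add: Q_C)
  have sndKK: "snd (T \<tau> (K (K x))) = R (?b x \<tau>)" for x
    by (simp only: T.T_commute[OF \<tau>0] damped_inverse_simps)
  have flip: "fst (K (K x')) = ?a x \<tau>" "fst (K x') = - ?b x \<tau>"
    if "velocity_flip (T \<tau> (K (K x))) = K (K x')" for x x'
  proof -
    show "fst (K (K x')) = ?a x \<tau>" unfolding that[symmetric] by simp
    have "R (fst (K x')) = snd (K (K x'))" by (simp only: damped_inverse_simps)
    also have "\<dots> = R (- ?b x \<tau>)" unfolding that[symmetric] velocity_flip_simps sndKK R.neg ..
    finally show "fst (K x') = - ?b x \<tau>" by (simp only: Rinj)
  qed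
  have bS0: "fst (J u) = fst (K x0)"
  proof -
    have "R (fst (J u)) = snd (J (J u))" by (simp only: damped_inverse_simps)
    also have "\<dots> = R (fst (K x0))" unfolding z0 by (simp only: damped_inverse_simps)
    finally show ?thesis by (simp only: Rinj)
  qed
  have zero: "state_norm A (0, 0) = 0"
    using state_norm_R[of 0 0] by (simp add: R.zero norm_Pair)
  define E1 where "E1 = state_norm A (wp \<tau> - R (proj (?aS \<tau> - ?a x0 \<tau>)), wp' \<tau> - R (proj (?bS \<tau> - ?b x0 \<tau>)))"
  have E1: "E1 \<le> \<epsilon> * (1 + \<kappa>) * D * \<tau> + I"
  proof -
    let ?f = "\<lambda>t. Q (R (?bS t)) - 0"
    have eq: "norm (adjoint C (C (v t) - g t)) = norm (adjoint C (g t) - ?f t)" if "t \<in> {0..\<tau>}" for t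
      using that by (simp add: Qv Cs.diff norm_minus_commute)
    have int': "(\<lambda>t. norm (adjoint C (g t) - ?f t)) integrable_on {0..\<tau>}"
      using integrable_eq[OF int eq] by simp
    have I': "integral {0..\<tau>} (\<lambda>t. norm (adjoint C (g t) - ?f t)) = I"
      unfolding I_def by (rule integral_cong) (use eq in simp)
    have "E1 \<le> state_norm A (wp 0 - R (proj (?aS 0 - ?a x0 0)), wp' 0 - R (proj (?bS 0 - ?b x0 0)))
        + (\<epsilon> * (1 + \<kappa>) * D * \<tau> + integral {0..\<tau>} (\<lambda>t. norm (adjoint C (g t) - ?f t)))"
      unfolding E1_def
    proof (rule galerkin_error[OF observer_forward_weak[OF fwd(1)]
          exact_solution_diff[OF exact_solution_wave_flow[OF S] exact_solution_damped_flow[OF T]] approx \<epsilon> _ _ \<kappa> int'])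
      fix t assume "t \<in> {0..\<tau>}"
      then have t: "0 \<le> t" by simp
      show "norm (?dS t - ?d x0 t) \<le> D" "norm (?bS t - ?b x0 t) \<le> D"
        by (rule D_le[where x = x0]; simp add: boundS[OF t] boundT[OF t])+
    qed
    moreover have "state_norm A (wp 0 - R (proj (?aS 0 - ?a x0 0)), wp' 0 - R (proj (?bS 0 - ?b x0 0))) = 0"
      using fwd(2,3) bS0 zero by (simp only: S.T_0 T.T_0 z0) (simp add: proj.zero R.zero)
    ultimately show ?thesis by (simp only: I')
  qed
  define E2 where "E2 = state_norm A (wm (\<tau> - \<tau>) - R (proj (?aS (\<tau> - \<tau>) - ?a x1 \<tau>)),
    - wm' (\<tau> - \<tau>) - R (proj (- ?bS (\<tau> - \<tau>) - ?b x1 \<tau>)))"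
  have E2: "E2 \<le> E1 + (\<epsilon> * (1 + \<kappa>) * D * \<tau> + I)"
  proof -
    let ?f = "\<lambda>t. Q (R (?bS (\<tau> - t))) - 2 *\<^sub>R Q (R (?bS (\<tau> - t))) - 0"
    let ?n = "\<lambda>s. norm (adjoint C (C (v s) - g s))"
    have eq: "?n (\<tau> - t) = norm (- adjoint C (g (\<tau> - t)) - ?f t)" if t: "t \<in> {0..\<tau>}" for t
    proof -
      have "\<tau> - t \<in> {0..\<tau>}" using t by auto
      then show ?thesis by (simp add: Qv Cs.diff scaleR_2)
    qed
    have "(?n has_integral I) {\<tau> - \<tau>..\<tau>}" using int unfolding I_def by (simp add: has_integral_integral)
    from reflected_integral[OF this] have ref: "((\<lambda>t. ?n (\<tau> - t)) has_integral I) {0..\<tau>}" .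
    have hi: "((\<lambda>t. norm (- adjoint C (g (\<tau> - t)) - ?f t)) has_integral I) {0..\<tau>}"
      by (rule has_integral_eq[OF _ ref]) (use eq in blast)
    have "E2 \<le> state_norm A (wm (\<tau> - 0) - R (proj (?aS (\<tau> - 0) - ?a x1 0)), - wm' (\<tau> - 0) - R (proj (- ?bS (\<tau> - 0) - ?b x1 0)))
        + (\<epsilon> * (1 + \<kappa>) * D * \<tau> + integral {0..\<tau>} (\<lambda>t. norm (- adjoint C (g (\<tau> - t)) - ?f t)))"
      unfolding E2_def
    proof (rule galerkin_error[OF observer_backward_weak[OF bwd(1)]
          exact_solution_diff[OF exact_solution_reflect[OF exact_solution_wave_flow[OF S]] exact_solution_damped_flow[OF T]]
          approx \<epsilon> _ _ \<kappa>])
      show "(\<lambda>t. norm (- adjoint C (g (\<tau> - t)) - ?f t)) integrable_on {0..\<tau>}" using hi by blast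
      fix t assume "t \<in> {0..\<tau>}"
      then have t: "0 \<le> t" and s: "0 \<le> \<tau> - t" by auto
      show "norm (?dS (\<tau> - t) - ?d x1 t) \<le> D" "norm (- ?bS (\<tau> - t) - ?b x1 t) \<le> D"
        by (rule D_le[where x = x1]; simp add: boundS[OF s] boundT[OF t])+
    qed
    moreover have "state_norm A (wm (\<tau> - 0) - R (proj (?aS (\<tau> - 0) - ?a x1 0)), - wm' (\<tau> - 0) - R (proj (- ?bS (\<tau> - 0) - ?b x1 0))) = E1"
    proof -
      have "wm (\<tau> - 0) - R (proj (?aS (\<tau> - 0) - ?a x1 0)) = wp \<tau> - R (proj (?aS \<tau> - ?a x0 \<tau>))"
        using bwd(2) flip(1)[OF x1] by (simp only: T.T_0 diff_0_right)
      moreover have "- wm' (\<tau> - 0) - R (proj (- ?bS (\<tau> - 0) - ?b x1 0)) = - (wp' \<tau> - R (proj (?bS \<tau> - ?b x0 \<tau>)))"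
        unfolding T.T_0 flip(2)[OF x1] diff_0_right bwd(3)
        by (simp only: proj.diff proj.neg R.diff R.neg) simp
      ultimately show ?thesis unfolding E1_def by (simp only: state_norm_def fst_conv snd_conv norm_minus_cancel)
    qed
    ultimately show ?thesis by (simp only: integral_unique[OF hi])
  qed
  have "state_norm A ((wm 0, wm' 0) - project_state (K (K (x0 - x2)))) = E2"
  proof -
    have "?aS (\<tau> - \<tau>) - ?a x1 \<tau> = fst (K (K (x0 - x2)))"
      unfolding flip(1)[OF x2, symmetric] by (simp only: diff_self S.T_0 z0 Kl.diff fst_diff)
    moreover have "- ?bS (\<tau> - \<tau>) - ?b x1 \<tau> = - fst (K (x0 - x2))"
      using flip(2)[OF x2] by (simp only: diff_self S.T_0 bS0 Kl.diff fst_diff) simp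
    moreover have "(wm 0, wm' 0) - project_state (K (K (x0 - x2)))
        = (wm 0 - R (proj (fst (K (K (x0 - x2))))), - (- wm' 0 - R (proj (- fst (K (x0 - x2))))))"
      by (simp only: project_state_K minus_prod_def fst_conv snd_conv proj.neg R.neg) simp
    ultimately show ?thesis
      unfolding E2_def by (simp only: state_norm_def fst_conv snd_conv norm_minus_cancel diff_self)
  qed
  moreover have "s \<le> 2 * b" if "s = e'" "e \<le> b" "e' \<le> e + b" for s e e' b :: real using that by linarith
  ultimately show ?thesis using E1 E2 unfolding D_def I_def by blast
qed

text \<open>The projections of the states \<open>K (K (x (2 * n) - x (2 * n + 2)))\<close> telescope to that of the initial
  state minus a remainder. Each summand of the reconstruction is compared with one of them.\<close>

lemma reconstruction_error:
  assumes T: "contraction_flow K T"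
    and approx: "\<And>y. norm (R (proj y) - R y) \<le> \<epsilon> * norm y" and \<epsilon>: "0 \<le> \<epsilon>"
    and c: "\<And>v. norm (K v) \<le> c * norm v" "1 \<le> c" "\<And>v. norm (snd v + Q (R (fst v))) \<le> c * norm v"
    and \<kappa>: "0 \<le> \<kappa>" "\<And>x. norm (Q x) \<le> \<kappa> * norm x"
    and x: "\<And>n. velocity_flip (T \<tau> (K (K (x n)))) = K (K (x (Suc n)))" "\<And>n. norm (x n) \<le> X"
    and zh: "zh \<in> V \<times> V" and \<delta>: "state_norm A (zh - project_state (K (K (x 0 - x 2)))) \<le> \<delta>"
  shows "state_norm A (state_of R 1 (K (K (x 0))) - (\<Sum>n\<le>N. (discrete_L A C V \<tau> ^^ n) zh))
    \<le> real (Suc N) * \<delta> + 2 * (real (Suc N))\<^sup>2 * (\<epsilon> * (1 + \<kappa>) * (c * (2 * X)) * \<tau>)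
      + \<epsilon> * (c + 1) * c * (2 * X) + norm (K (K (x (2 * Suc N))))"
proof -
  interpret T: contraction_flow K T by fact
  interpret Kl: bounded_linear K by (rule T.bounded_linear_K)
  have \<tau>0: "0 \<le> \<tau>" using \<tau> by simp
  define e where "e = \<epsilon> * (1 + \<kappa>) * (c * (2 * X)) * \<tau>"
  have X0: "0 \<le> X" using x(2)[of 0] by (rule order_trans[OF norm_ge_zero])
  have e0: "0 \<le> e" using \<epsilon> \<kappa> c(2) X0 \<tau> by (simp add: e_def)
  define y where "y k = x k - x (k + 2)" for k
  have yn: "norm (y k) \<le> 2 * X" for k
    using norm_triangle_ineq4[of "x k" "x (k + 2)"] x(2)[of k] x(2)[of "k + 2"] by (simp add: y_def)
  have y_step: "velocity_flip (T \<tau> (K (K (y k)))) = K (K (y (Suc k)))" for k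
    using x(1)[of k] x(1)[of "k + 2"]
    by (simp only: y_def Kl.diff linear_diff[OF T.linear_T[OF \<tau>0]] linear_diff[OF linear_velocity_flip] add_Suc)
  let ?L = "\<lambda>n. (discrete_L A C V \<tau> ^^ n) zh"
  let ?g = "\<lambda>n. project_state (K (K (y (2 * n))))"
  have LV: "?L n \<in> V \<times> V" for n using half_cycle_power_V[OF zh, of "2 * n"] by (simp only: discrete_L_power[OF zh])
  have term_le: "state_norm A (?g n - ?L n) \<le> \<delta> + real (2 * n) * e" for n
  proof -
    let ?h = "(half_cycle ^^ (2 * n)) (project_state (K (K (y 0))))"
    have hV: "?h \<in> V \<times> V" by (intro half_cycle_power_V project_state_V)
    have "state_norm A (?g n - ?L n) \<le> state_norm A (?g n - ?h) + state_norm A (?h - ?L n)"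
      by (rule state_norm_triangle) (intro V_state_space project_state_V hV LV)+
    moreover have "state_norm A (?g n - ?h) \<le> real (2 * n) * e"
      using half_cycle_iterates[where y = y and Y = "2 * X" and n = "2 * n", OF T approx \<epsilon> c(1,2) \<kappa> y_step yn]
      by (simp add: e_def state_norm_minus_commute[OF project_state_V hV])
    moreover have "state_norm A (?h - ?L n) \<le> \<delta>"
    proof -
      have "state_norm A (?h - ?L n) \<le> state_norm A (project_state (K (K (y 0))) - zh)"
        unfolding discrete_L_power[OF zh] by (rule half_cycle_power_diff[OF project_state_V zh])
      also have "\<dots> \<le> \<delta>" using \<delta> by (simp add: y_def numeral_2_eq_2 state_norm_minus_commute[OF project_state_V zh])
      finally show ?thesis .
    qed
    ultimately show ?thesis by linarith
  qed
  have tele: "(\<Sum>n\<le>N. ?g n) = project_state (K (K (x 0 - x (2 * Suc N))))"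
  proof -
    have ps: "project_state (K (K (u - v))) = project_state (K (K u)) - project_state (K (K v))" for u v
      unfolding Kl.diff[of u v] by (rule project_state_diff)
    show ?thesis
    proof (induction N)
      case 0 show ?case by (simp add: y_def numeral_2_eq_2)
    next
      case (Suc N)
      have "2 * Suc (Suc N) = 2 * Suc N + 2" by simp
      then have "?g (Suc N) = project_state (K (K (x (2 * Suc N)))) - project_state (K (K (x (2 * Suc (Suc N)))))"
        by (simp only: y_def ps)
      then show ?case unfolding sum.atMost_Suc Suc ps by (simp only: diff_add_eq_diff_diff_swap) simp
    qed
  qed
  let ?z = "K (K (x 0))" and ?r = "K (K (x (2 * Suc N)))" and ?d = "K (K (x 0 - x (2 * Suc N)))"
  have "state_norm A (state_of R 1 ?z - (\<Sum>n\<le>N. ?L n))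
    \<le> state_norm A (state_of R 1 ?z - (\<Sum>n\<le>N. ?g n)) + state_norm A ((\<Sum>n\<le>N. ?g n) - (\<Sum>n\<le>N. ?L n))"
  proof (rule state_norm_triangle[OF state_of_in])
    show "(\<Sum>n\<le>N. ?g n) \<in> state_space A"
      by (rule state_norm_sum_diff(2)[where g = ?g]) (intro finite_atMost V_state_space project_state_V)+
    show "(\<Sum>n\<le>N. ?L n) \<in> state_space A"
      by (rule state_norm_sum_diff(2)[where g = ?g]) (intro finite_atMost V_state_space project_state_V LV)+
  qed
  also have "state_norm A ((\<Sum>n\<le>N. ?g n) - (\<Sum>n\<le>N. ?L n)) \<le> (\<Sum>n\<le>N. state_norm A (?g n - ?L n))"
    by (intro state_norm_sum_diff(1) finite_atMost V_state_space project_state_V LV)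
  also have "\<dots> \<le> (\<Sum>n\<le>N. \<delta> + 2 * real (Suc N) * e)"
  proof (rule sum_mono)
    fix n assume "n \<in> {..N}"
    then have "real (2 * n) * e \<le> 2 * real (Suc N) * e" using e0 by (intro mult_right_mono) auto
    then show "state_norm A (?g n - ?L n) \<le> \<delta> + 2 * real (Suc N) * e" using term_le[of n] by linarith
  qed
  also have "\<dots> = real (Suc N) * \<delta> + 2 * (real (Suc N))\<^sup>2 * e"
    by (simp add: power2_eq_square algebra_simps)
  also have "state_norm A (state_of R 1 ?z - (\<Sum>n\<le>N. ?g n)) \<le> \<epsilon> * (c + 1) * c * (2 * X) + norm ?r"
  proof -
    have "state_norm A (state_of R 1 ?z - project_state ?d)
      \<le> state_norm A (state_of R 1 ?z - state_of R 1 ?d) + state_norm A (state_of R 1 ?d - project_state ?d)"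
      by (rule state_norm_triangle[OF state_of_in state_of_in]) (intro V_state_space project_state_V)
    moreover have "state_of R 1 ?z - state_of R 1 ?d = state_of R 1 ?r"
    proof -
      have "state_of R 1 u - state_of R 1 v = state_of R 1 (u - v)" for u v by (simp add: state_of_def R.diff)
      moreover have "?z - ?d = ?r" by (simp only: Kl.diff diff_diff_eq2 add_diff_cancel_left')
      ultimately show ?thesis by (simp only:)
    qed
    moreover have "state_norm A (state_of R 1 ?d - project_state ?d) \<le> \<epsilon> * (c + 1) * c * norm (x 0 - x (2 * Suc N))"
      by (rule project_state_error[OF approx \<epsilon> c(1,3)]) (use c(2) in simp)
    moreover have "\<epsilon> * (c + 1) * c * norm (x 0 - x (2 * Suc N)) \<le> \<epsilon> * (c + 1) * c * (2 * X)"
      using \<epsilon> c(2) norm_triangle_ineq4[of "x 0" "x (2 * Suc N)"] x(2)[of 0] x(2)[of "2 * Suc N"]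
      by (intro mult_left_mono) auto
    moreover have "state_norm A (state_of R 1 ?r) = norm ?r" by (rule state_norm_state_of) simp
    ultimately show ?thesis unfolding tele by (simp only:)
  qed
  finally show ?thesis unfolding e_def by linarith
qed

end


section \<open>Data, cycle norm and truncation\<close>

text \<open>Composing with a norm makes the function real valued; it is a limit almost everywhere of measurable
  functions built from the approximating simple functions.\<close>

lemma bochner_L1_integrable:
  fixes y f :: "real \<Rightarrow> 'e::real_normed_vector" and B :: "'e \<Rightarrow> 'f::real_normed_vector"
  assumes y: "bochner_L1 \<tau> y" and f: "continuous_on {0..\<tau>} f" and B: "bounded_linear B"
  shows "(\<lambda>s. norm (B (f s - y s))) integrable_on {0..\<tau>}"
proof -
  interpret B: bounded_linear B by (rule B)
  let ?M = "lebesgue_on {0..\<tau>}"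
  obtain s where s: "\<And>n::nat. simple_function ?M (s n)" "AE t in ?M. (\<lambda>n. s n t) \<longlonglongrightarrow> y t"
    and yint: "integrable ?M (\<lambda>t. norm (y t))"
    using y unfolding bochner_L1_def by blast
  obtain N where N: "negligible N" "\<And>t. t \<in> {0..\<tau>} - N \<Longrightarrow> (\<lambda>n. s n t) \<longlonglongrightarrow> y t"
    using AE_lebesgue_on_negligible[OF s(2)] by blast
  have ind: "indicat_real (- N) \<in> borel_measurable ?M"
    using negligible_imp_sets[OF N(1)]
    by (intro measurable_restrict_space1 borel_measurable_indicator) (simp add: Compl_in_sets_lebesgue)
  have meas: "(\<lambda>t. norm (B (f t - s n t))) \<in> borel_measurable ?M" for n
  proof (rule measurable_compose_countable'[where g = "s n" and I = "s n ` space ?M"])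
    show "(\<lambda>t. norm (B (f t - i))) \<in> borel_measurable ?M" for i
      by (intro continuous_imp_measurable_on_sets_lebesgue continuous_on_norm B.continuous_on
          continuous_on_diff f continuous_on_const) simp
    show "countable (s n ` space ?M)" using s(1)[of n] by (simp add: simple_function_def countable_finite)
    show "s n \<in> ?M \<rightarrow>\<^sub>M count_space (s n ` space ?M)"
      using s(1)[of n] unfolding simple_function_def
      by (intro measurable_count_space_eq2[THEN iffD2]) auto
  qed
  have meas_lim: "(\<lambda>t. indicat_real (- N) t * norm (B (f t - y t))) \<in> borel_measurable ?M"
  proof (rule borel_measurable_LIMSEQ_real)
    show "(\<lambda>t. indicat_real (- N) t * norm (B (f t - s n t))) \<in> borel_measurable ?M" for n
      by (intro borel_measurable_times ind meas)
    fix t assume t: "t \<in> space ?M"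
    show "(\<lambda>n. indicat_real (- N) t * norm (B (f t - s n t))) \<longlonglongrightarrow> indicat_real (- N) t * norm (B (f t - y t))"
    proof (cases "t \<in> N")
      case False
      then have "(\<lambda>n. s n t) \<longlonglongrightarrow> y t" using N(2) t by auto
      then show ?thesis by (intro tendsto_intros B.tendsto)
    qed simp
  qed
  obtain C where C: "C > 0" "\<And>x. norm (B x) \<le> norm x * C" using B.pos_bounded by blast
  have dom: "(\<lambda>t. (norm (f t) + norm (y t)) * C) integrable_on {0..\<tau>}"
  proof -
    have "(\<lambda>t. norm (f t)) integrable_on {0..\<tau>}"
      by (intro integrable_continuous_real continuous_on_norm f)
    moreover have "(\<lambda>t. norm (y t)) integrable_on {0..\<tau>}"
      by (rule integrable_on_lebesgue_on[OF yint]) simp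
    ultimately show ?thesis by (intro integrable_on_mult_left integrable_add)
  qed
  have le: "\<bar>indicat_real (- N) t * norm (B (f t - y t))\<bar> \<le> (norm (f t) + norm (y t)) * C" for t
  proof -
    have "\<bar>indicat_real (- N) t * norm (B (f t - y t))\<bar> \<le> norm (B (f t - y t))"
      by (simp add: indicator_def)
    also have "\<dots> \<le> norm (f t - y t) * C" by (rule C)
    also have "\<dots> \<le> (norm (f t) + norm (y t)) * C" using C(1) by (intro mult_right_mono norm_triangle_ineq4) simp
    finally show ?thesis .
  qed
  have "(\<lambda>t. indicat_real (- N) t * norm (B (f t - y t))) integrable_on {0..\<tau>}"
    by (rule measurable_bounded_by_integrable_imp_integrable_real[OF meas_lim dom le]) simp
  then show ?thesis
    by (rule integrable_spike[OF _ N(1)]) simp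
qed

text \<open>In coordinates both semigroups are the flow \<open>T\<close>, the backward one between two velocity reversals.\<close>

lemma (in damped_wave) cycle_operator_norm:
  assumes "sqrt_inverse A R" and Q: "Q = adjoint C \<circ> C"
    and Tp: "C0_semigroup_generated_by (state_space A) (state_norm A) Tp (damped_operator 1 A C)"
    and Tm: "C0_semigroup_generated_by (state_space A) (state_norm A) Tm (damped_operator (- 1) A C)"
    and T: "contraction_flow K T" and \<tau>: "0 < \<tau>"
    and \<gamma>: "0 < \<gamma>" "\<gamma> < 1" "\<And>x. norm (T \<tau> x) \<le> \<gamma> * norm x"
    and \<eta>: "\<eta> = operator_norm_on (state_space A) (state_norm A) (Tm \<tau> \<circ> Tp \<tau>)"
  shows "0 \<le> \<eta>" "\<eta> < 1"
    "norm (velocity_flip (T \<tau> (velocity_flip (T \<tau> z)))) \<le> \<eta> * norm z"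
proof -
  interpret sqrt_inverse A R by fact
  interpret T: contraction_flow K T by fact
  have dw: "damped_wave R Q Q'" by (rule damped_wave_axioms)
  have \<tau>0: "0 \<le> \<tau>" using \<tau> by simp
  define G where "G z = velocity_flip (T \<tau> z)" for z
  have G\<gamma>: "norm (G z) \<le> \<gamma> * norm z" for z using \<gamma>(3)[of z] by (simp add: G_def)
  have plus: "Tp \<tau> (state_of R 1 z) = state_of R 1 (T \<tau> z)" for z
  proof -
    note f = damped_semigroup_flow[OF assms(1) dw Q _ Tp]
    have "energy_coords A 1 (Tp \<tau> (state_of R 1 z)) = T \<tau> z"
      by (rule contraction_flow_unique[OF f(1) T damped_inverse_dissipative inj_damped_inverse \<tau>0]) simp
    then show ?thesis using f(2)[OF _ \<tau>0, of z] by simp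
  qed
  have minus: "Tm \<tau> (state_of R (- 1) z) = state_of R (- 1) (T \<tau> z)" for z
  proof -
    note f = damped_semigroup_flow[OF assms(1) dw Q _ Tm]
    have "energy_coords A (- 1) (Tm \<tau> (state_of R (- 1) z)) = T \<tau> z"
      by (rule contraction_flow_unique[OF f(1) T damped_inverse_dissipative inj_damped_inverse \<tau>0]) simp
    then show ?thesis using f(2)[OF _ \<tau>0, of z] by simp
  qed
  have sf: "state_of R 1 u = state_of R (- 1) (velocity_flip u)" "state_of R (- 1) u = state_of R 1 (velocity_flip u)" for u
    by (simp_all add: state_of_def)
  have L: "(Tm \<tau> \<circ> Tp \<tau>) (state_of R 1 z) = state_of R 1 (G (G z))" for z
    by (simp add: plus sf(1)[of "T \<tau> z"] minus sf(2)[of "T \<tau> _"] G_def)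
  have norm_state: "state_norm A (state_of R 1 z) = norm z" for z by (rule state_norm_state_of) simp
  have "state_space A = range (state_of R 1)"
    using state_of_energy_coords[of 1] state_of_in by (metis (no_types, lifting) image_subsetI mult_1 rangeI subsetI subset_antisym)
  then have set_eq: "(\<lambda>x. state_norm A ((Tm \<tau> \<circ> Tp \<tau>) x)) ` {x \<in> state_space A. state_norm A x \<le> 1}
      = (\<lambda>z. norm (G (G z))) ` {z. norm z \<le> 1}"
  proof -
    have "{x \<in> range (state_of R 1). state_norm A x \<le> 1} = state_of R 1 ` {z. norm z \<le> 1}"
      using norm_state by (auto simp del: split_paired_All split_paired_Ex)
    then show ?thesis unfolding \<open>state_space A = _\<close> by (simp only: image_image L norm_state)
  qed
  have \<eta>': "\<eta> = (SUP z\<in>{z. norm z \<le> 1}. norm (G (G z)))"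
    unfolding \<eta> operator_norm_on_def set_eq ..
  have GG: "norm (G (G z)) \<le> \<gamma>" if "norm z \<le> 1" for z
  proof -
    have "norm (G (G z)) \<le> \<gamma> * (\<gamma> * norm z)" using G\<gamma>[of "G z"] mult_left_mono[OF G\<gamma>[of z], of \<gamma>] \<gamma>(1) by linarith
    also have "\<dots> \<le> \<gamma> * (1 * 1)" using \<gamma> that by (intro mult_left_mono mult_mono) auto
    finally show ?thesis by simp
  qed
  have bdd: "bdd_above ((\<lambda>z. norm (G (G z))) ` {z. norm z \<le> 1})" using GG by (auto intro!: bdd_aboveI)
  have "\<eta> \<le> \<gamma>" unfolding \<eta>' 
  proof (rule cSUP_least)
    have "0 \<in> {z :: 'h \<times> 'h. norm z \<le> 1}" by simp
    then show "{z :: 'h \<times> 'h. norm z \<le> 1} \<noteq> {}" by blast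
  qed (use GG in simp)
  then show "\<eta> < 1" using \<gamma>(2) by simp
  have le: "norm (G (G z)) \<le> \<eta>" if "norm z \<le> 1" for z
    unfolding \<eta>' by (rule cSUP_upper[OF _ bdd]) (use that in simp)
  show "0 \<le> \<eta>" using le[of 0] by (intro order_trans[OF norm_ge_zero[of "G (G 0)"]]) simp
  have lin: "linear G" unfolding G_def
    using linear_compose[OF T.linear_T[OF \<tau>0] linear_velocity_flip] by (simp add: o_def)
  have "norm (G (G z)) \<le> \<eta> * norm z"
  proof (cases "z = 0")
    case True then show ?thesis using lin by (simp add: linear_0)
  next
    case False
    have "norm (G (G ((1 / norm z) *\<^sub>R z))) \<le> \<eta>" using False by (intro le) simp
    then have "(1 / norm z) * norm (G (G z)) \<le> \<eta>" by (simp only: linear_scale[OF lin] norm_scaleR) simp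
    then show ?thesis using False by (simp add: field_simps)
  qed
  then show "norm (velocity_flip (T \<tau> (velocity_flip (T \<tau> z)))) \<le> \<eta> * norm z" by (simp add: G_def)
qed

text \<open>If \<open>\<eta> = 0\<close>, then \<open>ln \<eta> = 0\<close> and division by 0 make \<open>N = 0\<close>, which suffices since \<open>\<eta> ^ Suc N = 0\<close>. The bound
  \<open>h < exp (- 1)\<close> makes \<open>\<bar>ln h\<bar>\<close> at least 1, so that it absorbs constants.\<close>

lemma truncation_index:
  fixes \<eta> \<theta> h :: real
  assumes \<eta>: "0 \<le> \<eta>" "\<eta> < 1" and \<theta>: "0 < \<theta>" and h: "0 < h" "h < exp (- 1)"
  obtains N where "{n::nat. real n \<le> \<theta> * (ln h / ln \<eta>)} = {..N}" "\<eta> ^ Suc N \<le> h powr \<theta>"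
    "real (Suc N) \<le> (\<theta> / \<bar>ln \<eta>\<bar> + 1) * \<bar>ln h\<bar>"
proof -
  have lnh: "ln h < - 1" using h by (metis ln_exp ln_less_cancel_iff exp_gt_zero)
  have ln\<eta>: "ln \<eta> \<le> 0" using \<eta> by (cases "\<eta> = 0") auto
  define r where "r = \<theta> * (ln h / ln \<eta>)"
  have r0: "0 \<le> r" unfolding r_def using \<theta> lnh ln\<eta> by (intro mult_nonneg_nonneg divide_nonpos_nonpos) auto
  define N where "N = nat \<lfloor>r\<rfloor>"
  have N: "real N \<le> r" "r < real (Suc N)"
    using r0 floor_correct[of r] by (simp_all add: N_def add.commute)
  show thesis
  proof (rule that[of N])
    show "{n::nat. real n \<le> \<theta> * (ln h / ln \<eta>)} = {..N}"
      unfolding r_def[symmetric] using r0 by (auto simp: N_def le_nat_floor) linarith+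
    show "\<eta> ^ Suc N \<le> h powr \<theta>"
    proof (cases "\<eta> = 0")
      case False
      then have p: "0 < \<eta>" and l: "ln \<eta> < 0" using \<eta> by auto
      have "real (Suc N) * ln \<eta> \<le> r * ln \<eta>" using N(2) l by (intro mult_right_mono_neg) auto
      also have "\<dots> = \<theta> * ln h" using l by (simp add: r_def)
      finally have le: "real (Suc N) * ln \<eta> \<le> \<theta> * ln h" .
      have "\<eta> ^ Suc N = exp (real (Suc N) * ln \<eta>)" using p by (simp only: exp_of_nat_mult exp_ln)
      also have "\<dots> \<le> exp (\<theta> * ln h)" using le by (simp only: exp_le_cancel_iff)
      also have "\<dots> = h powr \<theta>" using h(1) by (simp add: powr_def)
      finally show ?thesis .
    qed simp
    have "real (Suc N) \<le> r + 1" using N(1) by simp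
    also have "r = \<theta> / \<bar>ln \<eta>\<bar> * \<bar>ln h\<bar>" using lnh ln\<eta> by (simp add: r_def abs_if)
    also have "\<theta> / \<bar>ln \<eta>\<bar> * \<bar>ln h\<bar> + 1 \<le> (\<theta> / \<bar>ln \<eta>\<bar> + 1) * \<bar>ln h\<bar>"
      using lnh by (simp add: distrib_right)
    finally show "real (Suc N) \<le> (\<theta> / \<bar>ln \<eta>\<bar> + 1) * \<bar>ln h\<bar>" .
  qed
qed

lemma bounded_on_domain_transfer:
  assumes "sqrt_inverse A R" and inj: "inj R" and Q: "bounded_linear Q"
    and bd: "bounded_on_domain (op_sqrt A) Q"
  obtains Q' where "bounded_linear Q'" "\<And>x. Q (R x) = R (Q' x)"
proof -
  interpret sqrt_inverse A R by fact
  interpret R: bounded_linear R by (rule bl_R)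
  interpret Q: bounded_linear Q by (rule Q)
  obtain k where k: "\<And>x. Q (R x) \<in> range R" "\<And>x. norm (ap (op_sqrt A) (Q (R x))) \<le> k * norm x"
    using bd unfolding bounded_on_domain_def dom_sqrt by (auto simp: image_iff)
  define Q' where "Q' x = ap (op_sqrt A) (Q (R x))" for x
  have Q': "Q (R x) = R (Q' x)" for x
    using k(1)[of x] unfolding Q'_def by auto
  have inj': "R a = R b \<longleftrightarrow> a = b" for a b using inj by (simp add: inj_eq)
  have "bounded_linear Q'"
  proof (rule bounded_linear_intro[where K = k])
    show "Q' (x + y) = Q' x + Q' y" for x y
      by (rule inj'[THEN iffD1]) (simp add: Q'[symmetric] R.add Q.add)
    show "Q' (r *\<^sub>R x) = r *\<^sub>R Q' x" for r x
      by (rule inj'[THEN iffD1]) (simp add: Q'[symmetric] R.scaleR Q.scaleR)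
    show "norm (Q' x) \<le> norm x * k" for x using k(2)[of x] by (simp add: Q'_def mult.commute)
  qed
  then show thesis using that Q' by blast
qed


section \<open>The error estimate\<close>

theorem corollary3p2:
  fixes A0 :: "'h::{real_inner,complete_space} \<rightharpoonup> 'h"
    and C0 :: "'h \<Rightarrow> 'y::{real_inner,complete_space}"
    and Tplus Tminus :: "real \<Rightarrow> 'h \<times> 'h \<Rightarrow> 'h \<times> 'h"
    and H :: "real \<Rightarrow> 'h set"
    and \<tau> \<theta> \<eta> :: real
  assumes "self_adjoint A0" and "strictly_positive A0"
    and "bounded_linear C0"
    and "bounded_on_domain (op_three_halves A0) (adjoint C0 \<circ> C0)"
    and "bounded_on_domain (op_sqrt A0) (adjoint C0 \<circ> C0)"
    and "\<tau> > 0"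
    and "exactly_observable A0 C0 \<tau>"
    and "C0_semigroup_generated_by (state_space A0) (state_norm A0) Tplus
           (damped_operator 1 A0 C0)"
    and "C0_semigroup_generated_by (state_space A0) (state_norm A0) Tminus
           (damped_operator (- 1) A0 C0)"
    and "\<eta> = operator_norm_on (state_space A0) (state_norm A0) (Tminus \<tau> \<circ> Tplus \<tau>)"
    and "\<And>h. h > 0 \<Longrightarrow> (\<exists>B. finite B \<and> H h = span B) \<and> H h \<subseteq> dom (op_sqrt A0)"
    and "\<theta> > 0"
    and "approximation_property A0 H \<theta>"
  shows "\<exists>M>0. \<exists>hs>0. \<forall>h\<in>{0<..<hs}.
    \<forall>w0 w1 w w' yh wp wp' wm wm' w0h w1h.
      w0 \<in> dom (op_three_halves A0) \<longrightarrow> w1 \<in> dom A0 \<longrightarrow>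
      wave_solution A0 w0 w1 w w' \<longrightarrow>
      bochner_L1 \<tau> yh \<longrightarrow>
      observer_solution 1 A0 C0 (H h) \<tau> yh wp wp' \<longrightarrow> wp 0 = 0 \<longrightarrow> wp' 0 = 0 \<longrightarrow>
      observer_solution (- 1) A0 C0 (H h) \<tau> yh wm wm' \<longrightarrow> wm \<tau> = wp \<tau> \<longrightarrow> wm' \<tau> = wp' \<tau> \<longrightarrow>
      (w0h, w1h) = (\<Sum>n\<in>{n::nat. real n \<le> \<theta> * (ln h / ln \<eta>)}.
                      (discrete_L A0 C0 (H h) \<tau> ^^ n) (wm 0, wm' 0)) \<longrightarrow>
      norm_half A0 (w0 - w0h) + norm (w1 - w1h)
        \<le> M * (h powr \<theta> * (ln h)\<^sup>2 *
                 (norm (ap (op_three_halves A0) w0) + norm (ap A0 w1))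
               + \<bar>ln h\<bar> * integral {0..\<tau>} (\<lambda>s. norm (adjoint C0 (C0 (w' s) - yh s))))"
proof -
  define Q where "Q = adjoint C0 \<circ> C0"
  obtain R where R: "bounded_linear R" "\<And>x y. R x \<bullet> y = x \<bullet> R y" "inj R" "closure (range R) = UNIV"
    "\<And>x y. op_sqrt A0 x = Some y \<longleftrightarrow> x = R y" "\<And>x y. A0 x = Some y \<longleftrightarrow> x = R (R y)"
    using op_sqrt_inverse[OF assms(1,2)] by blast
  have sq: "sqrt_inverse A0 R" by (rule sqrt_inverse.intro) (rule R)+
  interpret sqrt_inverse A0 R by (rule sq)
  interpret Cs: bounded_linear "adjoint C0" by (rule bounded_linear_adjoint[OF assms(3)])
  have blQ: "bounded_linear Q"
    unfolding Q_def o_def by (rule bounded_linear_compose[OF Cs.bounded_linear_axioms assms(3)])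
  have posQ: "0 \<le> Q x \<bullet> x" for x
    using adjoint_inner[OF assms(3), of x "C0 x"] inner_ge_zero[of "C0 x"] unfolding Q_def o_def
    by (simp only: inner_commute[of "adjoint C0 _"])
  obtain Q' where Q': "bounded_linear Q'" "\<And>x. Q (R x) = R (Q' x)"
    using bounded_on_domain_transfer[OF sq R(3) blQ] assms(5) unfolding Q_def by blast
  have dw: "damped_wave R Q Q'"
    by (rule damped_wave.intro) (fact R blQ posQ Q')+
  interpret damped_wave R Q Q' by (rule dw)
  obtain T where T: "contraction_flow K T"
    using damped_semigroup_flow(1)[OF sq dw Q_def _ assms(8)] by auto
  have undis: "x \<bullet> J x \<le> 0" for x by (simp only: undamped_inverse_inner)
  obtain S where S: "contraction_flow J S"
    using dissipative_generates_flow[OF damped_wave.bounded_linear_damped_inverse[OF undamped] undis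
        damped_wave.dense_damped_inverse[OF undamped]] by blast
  interpret S: contraction_flow J S by (rule S)
  interpret Kl: bounded_linear K by (rule bounded_linear_damped_inverse)
  interpret Jl: bounded_linear J by (rule S.bounded_linear_K)
  obtain k where k: "k > 0"
    "\<And>y. k * (norm (J y))\<^sup>2 \<le> integral {0..\<tau>} (\<lambda>t. (norm (C0 (snd (S t (J y)))))\<^sup>2)"
    using observability_coords[OF sq S assms(7)] by blast
  obtain \<gamma> where \<gamma>: "0 < \<gamma>" "\<gamma> < 1" "\<And>x. norm (T \<tau> x) \<le> \<gamma> * norm x"
    using observability_decay[OF S T assms(3) Q_def assms(6) k] by blast
  note \<eta> = cycle_operator_norm[OF sq Q_def assms(8,9) T assms(6) \<gamma> assms(10)]
  obtain M1 where M1: "0 < M1" "\<And>x0. \<exists>x. x 0 = x0 \<and> (\<forall>n. velocity_flip (T \<tau> (K (K (x n)))) = K (K (x (Suc n)))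
      \<and> norm (x n) \<le> M1 * norm x0)"
    using iterates_regular[OF T less_imp_le[OF assms(6)] \<gamma>] by blast
  obtain M2 where M2: "0 < M2" "\<And>u v. \<exists>x. (R (R u), R (R v)) = K (K x) \<and> norm x \<le> M2 * (norm u + norm v)"
    using regular_data by blast
  obtain M0 h0 where M0: "M0 > 0" "h0 > 0" "\<And>\<phi> h. \<phi> \<in> dom (op_sqrt A0) \<Longrightarrow> h \<in> {0<..<h0} \<Longrightarrow>
      norm (galerkin_projection A0 (H h) \<phi> - \<phi>) \<le> M0 * h powr \<theta> * norm_half A0 \<phi>"
    using assms(13) unfolding approximation_property_def by blast
  obtain c1 where c1: "c1 > 0" "\<And>v. norm (K v) \<le> norm v * c1" using Kl.pos_bounded by blast
  obtain c2 where c2: "c2 > 0" "\<And>v. norm (J v) \<le> norm v * c2" using Jl.pos_bounded by blast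
  have "bounded_linear (\<lambda>v. snd v + Q (R (fst v)))"
    by (intro bounded_linear_add bounded_linear_snd bounded_linear_compose[OF blQ]
        bounded_linear_compose[OF R(1)] bounded_linear_fst)
  then obtain c3 where c3: "c3 > 0" "\<And>v. norm (snd v + Q (R (fst v))) \<le> norm v * c3"
    using bounded_linear.pos_bounded by blast
  obtain \<kappa> where \<kappa>: "\<kappa> > 0" "\<And>x. norm (Q x) \<le> norm x * \<kappa>" using Q.pos_bounded by blast
  have \<kappa>': "0 \<le> \<kappa>" "\<And>x. norm (Q x) \<le> \<kappa> * norm x" using \<kappa> by (auto simp: mult.commute)
  define c where "c = 1 + c1 + c2 + c3"
  have c: "1 \<le> c" using c1(1) c2(1) c3(1) by (simp add: c_def)
  have up: "b \<le> c * a" if "b \<le> a * d" "d \<le> c" "0 \<le> a" for a b d :: real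
    using that mult_left_mono[OF that(2,3)] by (simp add: mult.commute)
  have cK: "norm (K v) \<le> c * norm v" for v using c1 c2 c3 by (intro up[OF c1(2)]) (auto simp: c_def)
  have cJ: "norm (J v) \<le> c * norm v" for v using c1 c2 c3 by (intro up[OF c2(2)]) (auto simp: c_def)
  have cq: "norm (snd v + Q (R (fst v))) \<le> c * norm v" for v
    using c1 c2 c3 by (intro up[OF c3(2)]) (auto simp: c_def)
  define B where "B = M1 * M2"
  have B: "0 < B" using M1 M2 by (simp add: B_def)
  \<comment> \<open>constants of the observer error, the accumulated step errors, the projection error, the tail\<close>
  define a1 where "a1 = (1 + \<kappa>) * c * (1 + 2 * B) * \<tau>"
  define a2 where "a2 = (1 + \<kappa>) * c * (2 * B) * \<tau>"
  define a3 where "a3 = (c + 1) * c * (2 * B)"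
  define a4 where "a4 = c * c * M2"
  have a0: "0 \<le> a1" "0 \<le> a2" "0 \<le> a3" "0 \<le> a4"
    using \<kappa>(1) c B assms(6) M2(1) by (simp_all add: a1_def a2_def a3_def a4_def)
  define a where "a = 2 * M0 * a1 + 2 * M0 * a2 + M0 * a3 + a4"
  have apos: "0 \<le> a" using a0 M0(1) by (simp add: a_def)
  define b where "b = \<theta> / \<bar>ln \<eta>\<bar> + 1"
  have b: "1 \<le> b" using assms(12) by (simp add: b_def)
  define M where "M = 2 * (b\<^sup>2 * a + 2 * b)"
  have M: "0 < M" using b apos by (simp add: M_def add_nonneg_pos)
  show ?thesis
  proof (rule exI[of _ M], rule conjI[OF M], rule exI[of _ "min h0 (exp (- 1))"], intro conjI ballI allI impI)
    show "0 < min h0 (exp (- 1 :: real))" using M0(2) by simp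
  next
    fix h w0 w1 w w' yh wp wp' wm wm' w0h w1h
    assume h: "h \<in> {0<..<min h0 (exp (- 1))}"
      and w0: "w0 \<in> dom (op_three_halves A0)" and w1: "w1 \<in> dom A0"
      and w: "wave_solution A0 w0 w1 w w'" and yh: "bochner_L1 \<tau> yh"
      and fwd: "observer_solution 1 A0 C0 (H h) \<tau> yh wp wp'" "wp 0 = 0" "wp' 0 = 0"
      and bwd: "observer_solution (- 1) A0 C0 (H h) \<tau> yh wm wm'" "wm \<tau> = wp \<tau>" "wm' \<tau> = wp' \<tau>"
      and rec: "(w0h, w1h) = (\<Sum>n\<in>{n::nat. real n \<le> \<theta> * (ln h / ln \<eta>)}.
                  (discrete_L A0 C0 (H h) \<tau> ^^ n) (wm 0, wm' 0))"
    have h': "0 < h" "h < exp (- 1)" "h \<in> {0<..<h0}" using h by auto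
    interpret observed_galerkin A0 R Q Q' "H h" \<tau> C0
    proof (rule observed_galerkin.intro)
      show "galerkin A0 R Q Q' (H h) \<tau>"
      proof (rule galerkin.intro[OF dw sq], rule galerkin_axioms.intro)
        show "\<exists>B. finite B \<and> H h = span B" "H h \<subseteq> range R" "0 < \<tau>"
          using assms(11)[OF h'(1)] assms(6) by (auto simp: dom_sqrt)
      qed
      show "observed_galerkin_axioms Q C0"
        by (rule observed_galerkin_axioms.intro) (simp_all add: assms(3) Q_def)
    qed
    define \<epsilon> where "\<epsilon> = M0 * h powr \<theta>"
    have \<epsilon>: "0 \<le> \<epsilon>" using M0(1) by (simp add: \<epsilon>_def)
    have approx: "norm (R (proj y) - R y) \<le> \<epsilon> * norm y" for y
      using M0(3)[OF _ h'(3), of "R y"] by (simp add: galerkin_projection_R dom_sqrt norm_half_def \<epsilon>_def)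
    obtain u v where u: "w0 = R (R (R u))" "norm (ap (op_three_halves A0) w0) = norm u"
      and v: "w1 = R (R v)" "norm (ap A0 w1) = norm v"
    proof -
      obtain u where "op_three_halves A0 w0 = Some u" using w0 by blast
      moreover obtain v where "A0 w1 = Some v" using w1 by blast
      ultimately show thesis
        using that[of u v] by (auto simp: op_three_halves_def map_comp_Some_iff op_iff op_sqrt_iff)
    qed
    define W where "W = norm u + norm v"
    obtain x0 where x0: "(R (R u), R (R v)) = K (K x0)" "norm x0 \<le> M2 * W"
      using M2(2)[of u v] unfolding W_def by blast
    \<comment> \<open>coordinates of \<open>G\<^sup>n z\<^sub>0\<close> in the domain of the square of the damped generator\<close>
    obtain x where x: "x 0 = x0" "\<And>n. velocity_flip (T \<tau> (K (K (x n)))) = K (K (x (Suc n)))"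
      "\<And>n. norm (x n) \<le> M1 * norm x0" using M1(2)[of x0] by blast
    have xB: "norm (x n) \<le> B * W" for n
      using x(3)[of n] mult_left_mono[OF x0(2) less_imp_le[OF M1(1)]] by (simp add: B_def mult.assoc)
    have W0: "0 \<le> W" by (simp add: W_def)
    \<comment> \<open>the initial state as an element of the domain of the square of the undamped generator\<close>
    define y where "y = (- u, - v)"
    have z0: "J (J y) = K (K x0)" unfolding x0(1)[symmetric] by (simp add: y_def prod_eq_iff R.neg)
    have yW: "norm y \<le> W" using norm_Pair_le[of "- u" "- v"] by (simp add: y_def W_def)
    have start: "(w0, w1) = state_of R 1 (J (J y))"
      by (simp add: state_of_def y_def u v R.neg)
    have wt: "w' t = R (fst (S t (J y)))" if t: "t \<in> {0..\<tau>}" for t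
    proof -
      have t0: "0 \<le> t" using t by simp
      have "w' t = snd (state_of R 1 (S t (J (J y))))"
        using wave_solution_flow[OF sq S w start t0] by (simp add: prod_eq_iff)
      also have "\<dots> = snd (J (S t (J y)))"
        by (simp only: state_of_def snd_conv scaleR_one S.T_commute[OF t0])
      also have "\<dots> = R (fst (S t (J y)))" by (simp only: damped_inverse_simps)
      finally show ?thesis .
    qed
    have w'_cont: "continuous_on {0..\<tau>} w'"
      unfolding continuous_on_eq_continuous_within
    proof
      fix t assume "t \<in> {0..\<tau>}"
      then have "(w' has_vector_derivative - ap A0 (w t)) (at t within {0..})"
        using w unfolding wave_solution_def by simp
      then have "(w' has_vector_derivative - ap A0 (w t)) (at t within {0..\<tau>})"
        by (rule has_vector_derivative_within_subset) auto
      then show "continuous (at t within {0..\<tau>}) w'" by (rule has_vector_derivative_continuous)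
    qed
    have int: "(\<lambda>s. norm (adjoint C0 (C0 (w' s) - yh s))) integrable_on {0..\<tau>}"
      by (rule bochner_L1_integrable[OF yh _ Cs.bounded_linear_axioms])
        (rule bounded_linear.continuous_on[OF assms(3) w'_cont])
    define I where "I = integral {0..\<tau>} (\<lambda>s. norm (adjoint C0 (C0 (w' s) - yh s)))"
    have I0: "0 \<le> I" unfolding I_def using int by (rule integral_nonneg) simp
    have x1: "velocity_flip (T \<tau> (K (K x0))) = K (K (x 1))" "velocity_flip (T \<tau> (K (K (x 1)))) = K (K (x 2))"
      using x(2)[of 0] x(2)[of 1] by (simp_all only: x(1) numeral_2_eq_2 One_nat_def)
    have obs: "state_norm A0 ((wm 0, wm' 0) - project_state (K (K (x 0 - x 2)))) \<le> 2 * (\<epsilon> * a1 * W + I)"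
    proof -
      have "state_norm A0 ((wm 0, wm' 0) - project_state (K (K (x 0 - x 2))))
        \<le> 2 * (\<epsilon> * (1 + \<kappa>) * (c * (norm y + norm x0 + norm (x 1))) * \<tau> + I)"
        using observer_error[OF T S approx \<epsilon> cK cJ c \<kappa>' z0 x1 wt fwd bwd int] unfolding x(1) I_def .
      moreover have "\<epsilon> * (1 + \<kappa>) * (c * (norm y + norm x0 + norm (x 1))) * \<tau> \<le> \<epsilon> * (1 + \<kappa>) * (c * (W + B * W + B * W)) * \<tau>"
        using \<epsilon> \<kappa>(1) c assms(6) yW xB[of 0] xB[of 1]
        by (intro mult_right_mono mult_left_mono add_mono) (auto simp: x(1))
      moreover have "\<epsilon> * (1 + \<kappa>) * (c * (W + B * W + B * W)) * \<tau> = \<epsilon> * a1 * W"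
        by (simp add: a1_def algebra_simps)
      moreover have "s \<le> 2 * (r + I)" if "s \<le> 2 * (p + I)" "p \<le> q" "q = r" for s p q r :: real
        using that unfolding distrib_left by linarith
      ultimately show ?thesis by blast
    qed
    obtain N where N: "{n::nat. real n \<le> \<theta> * (ln h / ln \<eta>)} = {..N}" "\<eta> ^ Suc N \<le> h powr \<theta>"
      "real (Suc N) \<le> b * \<bar>ln h\<bar>"
      using truncation_index[OF \<eta>(1,2) assms(12) h'(1,2)] unfolding b_def by blast
    have tail: "norm (K (K (x (2 * n)))) \<le> \<eta> ^ n * norm (K (K x0))" for n
    proof (induction n)
      case 0 show ?case by (simp only: x(1) mult_0_right power_0 mult_1_left order_refl)
    next
      case (Suc n)
      have "K (K (x (2 * Suc n))) = velocity_flip (T \<tau> (velocity_flip (T \<tau> (K (K (x (2 * n)))))))"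
        by (simp only: x(2) mult_Suc_right add_2_eq_Suc)
      then have "norm (K (K (x (2 * Suc n)))) \<le> \<eta> * norm (K (K (x (2 * n))))" using \<eta>(3) by (simp only:)
      also have "\<dots> \<le> \<eta> * (\<eta> ^ n * norm (K (K x0)))" by (rule mult_left_mono[OF Suc \<eta>(1)])
      finally show ?case by (simp only: power_Suc mult.assoc)
    qed
    have "wm 0 \<in> H h" "wm' 0 \<in> H h"
      using observer_initial_V[OF bwd(1)] by auto
    then have zh: "(wm 0, wm' 0) \<in> H h \<times> H h" by simp
    have main: "state_norm A0 (state_of R 1 (K (K (x 0))) - (w0h, w1h))
      \<le> real (Suc N) * (2 * (\<epsilon> * a1 * W + I)) + 2 * (real (Suc N))\<^sup>2 * (\<epsilon> * a2 * W) + \<epsilon> * a3 * W + h powr \<theta> * a4 * W"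
    proof -
      have "state_norm A0 (state_of R 1 (K (K (x 0))) - (w0h, w1h))
        \<le> real (Suc N) * (2 * (\<epsilon> * a1 * W + I)) + 2 * (real (Suc N))\<^sup>2 * (\<epsilon> * (1 + \<kappa>) * (c * (2 * (B * W))) * \<tau>)
          + \<epsilon> * (c + 1) * c * (2 * (B * W)) + norm (K (K (x (2 * Suc N))))"
        unfolding rec N(1)
        by (rule reconstruction_error[OF T approx \<epsilon> cK c cq \<kappa>' x(2) xB zh obs])
      moreover have "\<epsilon> * (1 + \<kappa>) * (c * (2 * (B * W))) * \<tau> = \<epsilon> * a2 * W"
        "\<epsilon> * (c + 1) * c * (2 * (B * W)) = \<epsilon> * a3 * W"
        by (simp_all add: a2_def a3_def)
      moreover have "norm (K (K (x (2 * Suc N)))) \<le> h powr \<theta> * a4 * W"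
      proof -
        have "norm (K (K x0)) \<le> c * (c * (M2 * W))"
        proof -
          have "norm (K (K x0)) \<le> c * norm (K x0)" by (rule cK)
          also have "\<dots> \<le> c * (c * norm x0)" using c by (intro mult_left_mono cK) simp
          also have "\<dots> \<le> c * (c * (M2 * W))" using c by (intro mult_left_mono x0(2)) simp_all
          finally show ?thesis .
        qed
        then have "\<eta> ^ Suc N * norm (K (K x0)) \<le> h powr \<theta> * (c * (c * (M2 * W)))"
          using N(2) by (intro mult_mono) auto
        then show ?thesis using tail[of "Suc N"] by (simp add: a4_def mult.assoc)
      qed
      ultimately show ?thesis by simp
    qed
    define n where "n = real (Suc N)"
    define g where "g = h powr \<theta> * W"
    have n1: "1 \<le> n" by (simp add: n_def)
    have g0: "0 \<le> g" using W0 by (simp add: g_def)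
    have nn: "n \<le> n\<^sup>2" "1 \<le> n\<^sup>2" using n1 one_le_power[OF n1, of 2] by (simp_all add: power2_eq_square)
    have "state_norm A0 ((w0, w1) - (w0h, w1h)) \<le> n\<^sup>2 * a * g + 2 * n * I"
    proof -
      have "state_norm A0 ((w0, w1) - (w0h, w1h))
        \<le> n * (2 * M0 * a1 * g) + n\<^sup>2 * (2 * M0 * a2 * g) + 1 * (M0 * a3 * g) + 1 * (a4 * g) + 2 * n * I"
      proof -
        have "n * (2 * (\<epsilon> * a1 * W + I)) + 2 * n\<^sup>2 * (\<epsilon> * a2 * W) + \<epsilon> * a3 * W + h powr \<theta> * a4 * W
          = n * (2 * M0 * a1 * g) + n\<^sup>2 * (2 * M0 * a2 * g) + 1 * (M0 * a3 * g) + 1 * (a4 * g) + 2 * n * I"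
          by (simp add: \<epsilon>_def g_def algebra_simps)
        then show ?thesis using main unfolding n_def[symmetric] start z0 x(1) by (simp only:)
      qed
      also have "\<dots> \<le> n\<^sup>2 * (2 * M0 * a1 * g) + n\<^sup>2 * (2 * M0 * a2 * g) + n\<^sup>2 * (M0 * a3 * g) + n\<^sup>2 * (a4 * g) + 2 * n * I"
        using nn a0 M0(1) g0 by (intro add_mono mult_right_mono order_refl) auto
      also have "\<dots> = n\<^sup>2 * a * g + 2 * n * I" by (simp add: a_def algebra_simps)
      finally show ?thesis .
    qed
    also have "\<dots> \<le> (b * \<bar>ln h\<bar>)\<^sup>2 * a * g + 2 * (b * \<bar>ln h\<bar>) * I"
      using N(3) n1 apos g0 I0 unfolding n_def[symmetric]
      by (intro add_mono mult_right_mono mult_left_mono power_mono) auto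
    finally have sn: "state_norm A0 (w0 - w0h, w1 - w1h) \<le> (b * \<bar>ln h\<bar>)\<^sup>2 * a * g + 2 * (b * \<bar>ln h\<bar>) * I"
      by (simp add: minus_prod_def)
    have "norm_half A0 (w0 - w0h) + norm (w1 - w1h) \<le> 2 * state_norm A0 (w0 - w0h, w1 - w1h)"
    proof -
      have "norm_half A0 (w0 - w0h) \<le> state_norm A0 (w0 - w0h, w1 - w1h)"
        "norm (w1 - w1h) \<le> state_norm A0 (w0 - w0h, w1 - w1h)"
        unfolding state_norm_def fst_conv snd_conv by (rule real_le_rsqrt; simp)+
      then show ?thesis by linarith
    qed
    also have "\<dots> \<le> 2 * (b\<^sup>2 * a) * (g * (ln h)\<^sup>2) + 2 * (2 * b) * (\<bar>ln h\<bar> * I)"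
      using sn by (simp add: power_mult_distrib algebra_simps)
    also have "\<dots> \<le> M * (g * (ln h)\<^sup>2) + M * (\<bar>ln h\<bar> * I)"
      using b apos g0 I0 by (intro add_mono mult_right_mono) (auto simp: M_def)
    also have "\<dots> = M * (h powr \<theta> * (ln h)\<^sup>2 * W + \<bar>ln h\<bar> * I)"
      by (simp add: g_def algebra_simps)
    finally show "norm_half A0 (w0 - w0h) + norm (w1 - w1h)
        \<le> M * (h powr \<theta> * (ln h)\<^sup>2 *
                 (norm (ap (op_three_halves A0) w0) + norm (ap A0 w1))
               + \<bar>ln h\<bar> * integral {0..\<tau>} (\<lambda>s. norm (adjoint C0 (C0 (w' s) - yh s))))"
      unfolding u(2) v(2) W_def I_def .
  qed
qed

end
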